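(* Let $M>1$ be an integer. There exists a bounded simply-connected planar domain, namely a domain of the form $\Omega_{\varepsilon,\delta}$ described in the context (with suitable $\varepsilon>\delta>0$), whose torsion function has at least $M$ local maxima in the domain, while the function $z\mapsto \operatorname{dist}(z,\partial\Omega_{\varepsilon,\delta})$ has only one local maximum in the domain.
   Context: For a bounded domain $\Omega\subset\mathbb{C}$, the torsion function of $\Omega$ is the solution $v$ of $\Delta v=-2$ in $\Omega$, $v=0$ on $\partial\Omega$. The number of local maxima of a function means the number of points (locations) at which a local maximum occurs. $\operatorname{dist}(z,\partial\Omega)$ is the Euclidean distance from $z\in\Omega$ to $\partial\Omega$. The domains $\Omega_{\varepsilon,\delta}$: Identify $\mathbb{R}^2$ with $\mathbb{C}$. Let $\Gamma$ be the curve obtained as the union of the horizontal segments $[-1+2ki,\,1+2ki]$, $k=1,\dots,M-1$, with $M$ unit semicircles: for $\ell=0,\dots,\lfloor (M-1)/2\rfloor$ the right unit semicircle centered at $1+(1+4\ell)i$ (that is, the half with real part $\ge 1$), and for $\ell=0,\dots,\lfloor (M-2)/2\rfloor$ the left unit semicircle centered at $-1+(3+4\ell)i$ (the half with real part $\le -1$); then a small portion of the circular arcs at each junction where a semicircle meets a segment is smoothed so that $\Gamma$ is a $C^3$-smooth curve. Let $z(s)$, $s\in[0,L]$, be an arclength parametrization of $\Gamma$, and define $$\Omega_{\varepsilon,\delta}=\bigcup_{s\in[0,L]} B_{r(s)}(z(s)),\qquad r(s)=\varepsilon-\delta s,$$ where $B_r(p)$ denotes the open disk of radius $r$ centered at $p$.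 *)

theory Defs
  imports "HOL-Analysis.Analysis"
begin

section \<open>Torsion functions and local maxima\<close>

definition dir_deriv :: "'a \<Rightarrow> ('a::euclidean_space \<Rightarrow> real) \<Rightarrow> 'a \<Rightarrow> real" where
  "dir_deriv b f x = frechet_derivative f (at x) b"

definition laplacian :: "('a::euclidean_space \<Rightarrow> real) \<Rightarrow> 'a \<Rightarrow> real" where
  "laplacian f x = (\<Sum>b\<in>Basis. dir_deriv b (dir_deriv b f) x)"

text \<open>Only meaningful for open \<open>U\<close>; the differentiability clauses ensure that the values of
  \<^const>\<open>dir_deriv\<close> are genuine derivatives.\<close>

definition C2_on :: "'a::euclidean_space set \<Rightarrow> ('a \<Rightarrow> real) \<Rightarrow> bool" where
  "C2_on U f \<longleftrightarrow>
     (\<forall>x\<in>U. f differentiable (at x)) \<and>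
     (\<forall>b\<in>Basis. \<forall>x\<in>U. dir_deriv b f differentiable (at x)) \<and>
     (\<forall>b\<in>Basis. \<forall>c\<in>Basis. continuous_on U (dir_deriv c (dir_deriv b f)))"

text \<open>The classical solution of the torsion problem. The values of \<open>v\<close> outside
  \<^term>\<open>closure \<Omega>\<close> are irrelevant; on \<^term>\<open>closure \<Omega>\<close> there is at most one such \<open>v\<close>
  (\<open>torsion_function_unique\<close> below).\<close>

definition is_torsion_function :: "complex set \<Rightarrow> (complex \<Rightarrow> real) \<Rightarrow> bool" where
  "is_torsion_function \<Omega> v \<longleftrightarrow>
     continuous_on (closure \<Omega>) v \<and> C2_on \<Omega> v \<and>
     (\<forall>z\<in>\<Omega>. laplacian v z = -2) \<and> (\<forall>z\<in>frontier \<Omega>. v z = 0)"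

definition local_max_points :: "'a::topological_space set \<Rightarrow> ('a \<Rightarrow> real) \<Rightarrow> 'a set" where
  "local_max_points U f = {x\<in>U. \<forall>\<^sub>F y in at x within U. f y \<le> f x}"


section \<open>The meandering curve and its smoothings\<close>

definition right_semicircle :: "complex \<Rightarrow> complex set" where
  "right_semicircle c = {z \<in> sphere c 1. Re z \<ge> Re c}"

definition left_semicircle :: "complex \<Rightarrow> complex set" where
  "left_semicircle c = {z \<in> sphere c 1. Re z \<le> Re c}"

definition segments :: "nat \<Rightarrow> complex set" where
  "segments M = (\<Union>k\<in>{1..M-1}. closed_segment (Complex (-1) (2 * real k)) (Complex 1 (2 * real k)))"

definition semicircles :: "nat \<Rightarrow> complex set" where
  "semicircles M =
     (\<Union>l\<in>{0..(M-1) div 2}. right_semicircle (Complex 1 (1 + 4 * real l))) \<union>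
     (\<Union>l\<in>{0..(M-2) div 2}. left_semicircle (Complex (-1) (3 + 4 * real l)))"

definition junctions :: "nat \<Rightarrow> complex set" where
  "junctions M = (\<Union>k\<in>{1..M-1}. {Complex (-1) (2 * real k), Complex 1 (2 * real k)})"

fun Ck_on :: "nat \<Rightarrow> real set \<Rightarrow> (real \<Rightarrow> 'a::real_normed_vector) \<Rightarrow> bool" where
  "Ck_on 0 S f \<longleftrightarrow> continuous_on S f"
| "Ck_on (Suc k) S f \<longleftrightarrow>
     (\<exists>f'. (\<forall>x\<in>S. (f has_vector_derivative f' x) (at x within S)) \<and> Ck_on k S f')"

text \<open>\<open>z\<close> on \<^term>\<open>{0..L}\<close> is an arclength parametrization of the \<open>C\<^sup>3\<close>-smooth simple arc
  \<open>\<Gamma>\<close>; derivatives at the endpoints are one-sided.\<close>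

definition C3_arclength_param :: "(real \<Rightarrow> complex) \<Rightarrow> real \<Rightarrow> complex set \<Rightarrow> bool" where
  "C3_arclength_param z L \<Gamma> \<longleftrightarrow>
     0 < L \<and> Ck_on 3 {0..L} z \<and>
     (\<forall>s\<in>{0..L}. norm (vector_derivative z (at s within {0..L})) = 1) \<and>
     inj_on z {0..L} \<and> z ` {0..L} = \<Gamma>"

text \<open>Only portions of the circular arcs within distance \<open>\<eta>\<close> of a junction are altered: the
  segments are kept, and away from the junctions \<open>\<Gamma>\<close> is the original curve. That \<open>\<Gamma>\<close> is a
  \<open>C\<^sup>3\<close>-smooth simple arc is expressed by \<^const>\<open>C3_arclength_param\<close>.\<close>

definition alters_arcs_near_junctions :: "nat \<Rightarrow> real \<Rightarrow> complex set \<Rightarrow> bool" where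
  "alters_arcs_near_junctions M \<eta> \<Gamma> \<longleftrightarrow>
     segments M \<subseteq> \<Gamma> \<and>
     \<Gamma> - (\<Union>p\<in>junctions M. ball p \<eta>) =
       (segments M \<union> semicircles M) - (\<Union>p\<in>junctions M. ball p \<eta>)"

definition tapered_tube :: "(real \<Rightarrow> complex) \<Rightarrow> real \<Rightarrow> real \<Rightarrow> real \<Rightarrow> complex set" where
  "tapered_tube z L \<epsilon> \<delta> = (\<Union>s\<in>{0..L}. ball (z s) (\<epsilon> - \<delta> * s))"


section \<open>Uniqueness of the torsion function\<close>

lemma dir_deriv_line:
  assumes "f differentiable (at (x + t *\<^sub>R b))"
  shows "((\<lambda>t. f (x + t *\<^sub>R b)) has_real_derivative dir_deriv b f (x + t *\<^sub>R b)) (at t)"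
proof -
  let ?D = "frechet_derivative f (at (x + t *\<^sub>R b))"
  have 1: "(f has_derivative ?D) (at (x + t *\<^sub>R b))"
    using assms frechet_derivative_works by blast
  have 2: "((\<lambda>t. x + t *\<^sub>R b) has_derivative (\<lambda>h. h *\<^sub>R b)) (at t)"
    by (auto intro!: derivative_eq_intros)
  have "((\<lambda>t. f (x + t *\<^sub>R b)) has_derivative (\<lambda>h. ?D (h *\<^sub>R b))) (at t)"
    using has_derivative_compose[OF 2 1] .
  moreover have "(\<lambda>h. ?D (h *\<^sub>R b)) = (\<lambda>h. dir_deriv b f (x + t *\<^sub>R b) * h)"
    using linear_frechet_derivative[OF assms] by (auto simp: dir_deriv_def linear_cmul)
  ultimately show ?thesis
    by (simp add: has_field_derivative_def)
qed

lemma second_deriv_local_max: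
  fixes \<phi> :: "real \<Rightarrow> real"
  assumes "0 < d"
    and D1: "\<And>t. \<bar>t\<bar> < d \<Longrightarrow> (\<phi> has_real_derivative \<phi>' t) (at t)"
    and D2: "(\<phi>' has_real_derivative l) (at 0)"
    and mx: "\<And>t. \<bar>t\<bar> < d \<Longrightarrow> \<phi> t \<le> \<phi> 0"
  shows "l \<le> 0"
proof (rule ccontr)
  assume "\<not> l \<le> 0"
  have z: "\<phi>' 0 = 0"
    using DERIV_local_max[OF D1[of 0] \<open>0 < d\<close>] mx \<open>0 < d\<close> by simp
  obtain e where e: "0 < e" "\<And>h. 0 < h \<Longrightarrow> h < e \<Longrightarrow> \<phi>' 0 < \<phi>' (0 + h)"
    using DERIV_pos_inc_right[OF D2] \<open>\<not> l \<le> 0\<close> by auto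
  define a where "a = min d e / 2"
  have a: "0 < a" "a < d" "a < e"
    using e \<open>0 < d\<close> by (auto simp: a_def)
  have "\<exists>t. 0 < t \<and> t < a \<and> \<phi> a - \<phi> 0 = (a - 0) * \<phi>' t"
    by (rule MVT2) (use a in \<open>auto intro!: D1\<close>)
  then obtain t where t: "0 < t" "t < a" "\<phi> a - \<phi> 0 = a * \<phi>' t"
    by auto
  have "\<phi>' t > 0"
    using e(2)[of t] t a z by simp
  then have "a * \<phi>' t > 0"
    using a by simp
  moreover have "\<phi> a \<le> \<phi> 0"
    using mx[of a] a by simp
  ultimately show False
    using t by simp
qed

lemma torsion_function_le:
  assumes "open \<Omega>" "bounded \<Omega>" and v: "is_torsion_function \<Omega> v" and w: "is_torsion_function \<Omega> w"
    and x: "x \<in> closure \<Omega>"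
  shows "v x \<le> w x"
proof -
  obtain R where R: "\<And>z. z \<in> closure \<Omega> \<Longrightarrow> norm z \<le> R"
    using \<open>bounded \<Omega>\<close> bounded_closure bounded_iff by metis
  have R0: "0 \<le> R"
    using R[OF x] norm_ge_zero order_trans by blast
  have key: "v x - w x \<le> e * R\<^sup>2" if "0 < e" for e
  proof -
    define g where "g = (\<lambda>z. v z - w z + e * (z \<bullet> z))"
    have "continuous_on (closure \<Omega>) g"
      using v w unfolding g_def is_torsion_function_def by (intro continuous_intros) auto
    moreover have "compact (closure \<Omega>)"
      using \<open>bounded \<Omega>\<close> by (simp add: compact_closure)
    ultimately obtain y where y: "y \<in> closure \<Omega>" "\<And>z. z \<in> closure \<Omega> \<Longrightarrow> g z \<le> g y"
      using continuous_attains_sup[of "closure \<Omega>" g] x by (metis empty_iff)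
    have "y \<notin> \<Omega>"
    proof
      assume "y \<in> \<Omega>"
      then obtain d where d: "0 < d" "ball y d \<subseteq> \<Omega>"
        using \<open>open \<Omega>\<close> open_contains_ball by blast
      have le: "dir_deriv b (dir_deriv b v) y - dir_deriv b (dir_deriv b w) y + 2 * e \<le> 0"
        if b: "b \<in> Basis" for b
      proof (rule second_deriv_local_max[OF \<open>0 < d\<close>, where \<phi> = "\<lambda>t. g (y + t *\<^sub>R b)"
          and \<phi>' = "\<lambda>t. dir_deriv b v (y + t *\<^sub>R b) - dir_deriv b w (y + t *\<^sub>R b)
                + e * (2 * (y \<bullet> b) + 2 * t)"])
        fix t :: real assume "\<bar>t\<bar> < d"
        then have "y + t *\<^sub>R b \<in> ball y d"
          using b by (simp add: dist_norm)
        then have i: "y + t *\<^sub>R b \<in> \<Omega>"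
          using d by auto
        then have vd: "v differentiable (at (y + t *\<^sub>R b))" "w differentiable (at (y + t *\<^sub>R b))"
          using v w by (auto simp: is_torsion_function_def C2_on_def)
        have eq: "(\<lambda>t. g (y + t *\<^sub>R b)) = (\<lambda>t. v (y + t *\<^sub>R b) - w (y + t *\<^sub>R b)
            + e * (y \<bullet> y + 2 * t * (y \<bullet> b) + t\<^sup>2))"
          using b by (auto simp: g_def inner_add inner_commute power2_eq_square algebra_simps)
        show "((\<lambda>t. g (y + t *\<^sub>R b)) has_real_derivative dir_deriv b v (y + t *\<^sub>R b)
            - dir_deriv b w (y + t *\<^sub>R b) + e * (2 * (y \<bullet> b) + 2 * t)) (at t)"
          unfolding eq
          by (intro DERIV_add DERIV_diff dir_deriv_line vd)
            (auto intro!: derivative_eq_intros simp: algebra_simps)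
        show "g (y + t *\<^sub>R b) \<le> g (y + 0 *\<^sub>R b)"
          using y(2)[of "y + t *\<^sub>R b"] i closure_subset by auto
      next
        have vd: "dir_deriv b v differentiable (at (y + 0 *\<^sub>R b))"
          "dir_deriv b w differentiable (at (y + 0 *\<^sub>R b))"
          using v w \<open>y \<in> \<Omega>\<close> b by (auto simp: is_torsion_function_def C2_on_def)
        show "((\<lambda>t. dir_deriv b v (y + t *\<^sub>R b) - dir_deriv b w (y + t *\<^sub>R b)
                + e * (2 * (y \<bullet> b) + 2 * t)) has_real_derivative
            dir_deriv b (dir_deriv b v) y - dir_deriv b (dir_deriv b w) y + 2 * e) (at 0)"
        proof (intro DERIV_add DERIV_diff)
          show "((\<lambda>t. dir_deriv b v (y + t *\<^sub>R b)) has_real_derivative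
              dir_deriv b (dir_deriv b v) y) (at 0)"
            using dir_deriv_line[OF vd(1)] by simp
          show "((\<lambda>t. dir_deriv b w (y + t *\<^sub>R b)) has_real_derivative
              dir_deriv b (dir_deriv b w) y) (at 0)"
            using dir_deriv_line[OF vd(2)] by simp
          show "((\<lambda>t. e * (2 * (y \<bullet> b) + 2 * t)) has_real_derivative 2 * e) (at 0)"
            by (auto intro!: derivative_eq_intros)
        qed
      qed
      have "laplacian v y - laplacian w y + (\<Sum>b\<in>(Basis::complex set). 2 * e) \<le> 0"
        unfolding laplacian_def sum_subtractf[symmetric] sum.distrib[symmetric]
        by (rule sum_nonpos) (use le in auto)
      then show False
        using v w \<open>y \<in> \<Omega>\<close> \<open>0 < e\<close> by (simp add: is_torsion_function_def)
    qed
    then have "y \<in> frontier \<Omega>"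
      using y \<open>open \<Omega>\<close> by (simp add: frontier_def interior_open)
    then have "g y = e * (norm y)\<^sup>2"
      using v w by (simp add: g_def is_torsion_function_def power2_norm_eq_inner)
    also have "\<dots> \<le> e * R\<^sup>2"
      using R[OF y(1)] \<open>0 < e\<close> by (intro mult_left_mono power_mono) auto
    finally have "g x \<le> e * R\<^sup>2"
      using y(2)[OF x] by simp
    moreover have "v x - w x \<le> g x"
      using \<open>0 < e\<close> by (simp add: g_def)
    ultimately show ?thesis
      by simp
  qed
  have "v x - w x \<le> 0"
  proof (rule field_le_epsilon)
    fix e :: real assume "0 < e"
    have "v x - w x \<le> (e / (R\<^sup>2 + 1)) * R\<^sup>2"
      using \<open>0 < e\<close> by (intro key) (simp add: add_nonneg_pos)
    also have "\<dots> \<le> e"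
      using \<open>0 < e\<close> add_nonneg_pos[of "R\<^sup>2" 1]
      by (simp add: pos_divide_le_eq distrib_left)
    finally show "v x - w x \<le> 0 + e"
      by simp
  qed
  then show ?thesis
    by simp
qed

lemma torsion_function_unique:
  assumes "open \<Omega>" "bounded \<Omega>" "is_torsion_function \<Omega> v" "is_torsion_function \<Omega> w" "z \<in> closure \<Omega>"
  shows "v z = w z"
  using assms by (intro antisym torsion_function_le)

end

theory Submission
  imports Defs "HOL-Complex_Analysis.Complex_Analysis" "HOL-Real_Asymp.Real_Asymp"
begin

text \<open>
The torsion function notices curvature at fourth order in the width of the tube. In a straight strip
of half-width \<open>\<epsilon>\<close> the solution of \<open>\<Delta>v = -2\<close> is \<open>\<epsilon>\<^sup>2 - y\<^sup>2\<close>, with maximum \<open>\<epsilon>\<^sup>2\<close>; in the annulus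
\<open>1 - \<epsilon> < \<bar>z\<bar> < 1 + \<epsilon>\<close> the radial solution has the value \<open>\<epsilon>\<^sup>2 + \<epsilon>\<^sup>4 / 12 + \<dots>\<close> on the unit circle. The
influence of what happens at distance \<open>d\<close> along the tube is damped by a factor like \<open>exp (- c d / \<epsilon>)\<close>,
so if the radius shrinks by much less than \<open>\<epsilon>\<^sup>3\<close> in total (here by at most \<open>e\<^sup>6\<close>, where
\<open>\<epsilon> = e + e\<^sup>6\<close>), then \<open>v\<close> is larger in the middle of each of the \<open>M\<close> semicircles than anywhere on the
cross-cuts through the midpoints of the \<open>M - 1\<close> segments. The cross-cuts divide the tube into \<open>M\<close>
pieces, one around each semicircle, and the maximum of \<open>v\<close> over the closure of a piece is attained
inside it. This gives \<open>M\<close> local maxima. The two sides of the comparison are \<open>strip_upper_bound\<close> and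
\<open>annulus_lower_bound\<close>, and \<open>bend_beats_strip\<close> is the numerical gap between them.

The distance to the boundary, by contrast, only sees the radius, which strictly decreases along the
curve. For small \<open>\<epsilon>\<close> every boundary point of the tube is touched by a single disc of the family, and
there the condition of tangency makes \<open>\<bar>w - z(s)\<bar>\<^sup>2 - r(s)\<^sup>2\<close> grow at least quadratically away from the
parameter of contact (\<open>thin_tube_exists\<close>). All the geometry follows from this one inequality. The
maximiser of \<open>r(s) - \<bar>p - z(s)\<bar>\<close> over \<open>s\<close> is unique and depends continuously on \<open>p\<close>, so the tube
retracts onto its axis and is contractible; the maximum equals the distance from \<open>p\<close> to the boundary,
which can be increased by moving towards the axis and then along the axis to \<open>z(0)\<close>
(\<open>local_max_depth\<close>); and every boundary point has an exterior tangent disc (\<open>exterior_ball\<close>).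

The torsion function has to be constructed (\<open>torsion_function_representation\<close>). With a Riemann map \<open>f\<close>
from the unit disc it is \<open>(h - \<bar>f\<bar>\<^sup>2) / 2\<close>, where \<open>h\<close> is harmonic in the disc with boundary values
\<open>\<bar>f\<bar>\<^sup>2\<close>. For a polynomial instead of \<open>f\<close> such an \<open>h\<close> is the real part of an explicit polynomial;
Montel's theorem then yields \<open>h\<close> as a limit, and the exterior discs supply the barriers that force the
boundary values to be zero.

The smoothed curve (\<open>snake\<close>) replaces the part of each arc next to a junction by a convex
combination of the arc and its tangent line. Both are parametrised by arclength from the junction, so
that the combination is regular, and it rises strictly, which makes the curve injective. It is
reparametrised by arclength afterwards.
\<close>

section \<open>Curves of class \<open>C\<^sup>k\<close> and arclength\<close>

lemma Ck_on_SucI: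
  assumes "\<And>x. x \<in> S \<Longrightarrow> (f has_vector_derivative f' x) (at x within S)" "Ck_on n S f'"
  shows "Ck_on (Suc n) S f"
  using assms by auto

lemma Ck_on_subset: "Ck_on n S f \<Longrightarrow> T \<subseteq> S \<Longrightarrow> Ck_on n T f"
proof (induction n arbitrary: f)
  case 0
  then show ?case using continuous_on_subset by auto
next
  case (Suc n)
  then obtain f' where "\<forall>x\<in>S. (f has_vector_derivative f' x) (at x within S)" "Ck_on n S f'"
    by auto
  then show ?case
    using Suc by (intro Ck_on_SucI[of _ _ f']) (auto intro: has_vector_derivative_within_subset)
qed

lemma Ck_on_imp_continuous_on: "Ck_on n S f \<Longrightarrow> continuous_on S f"
  by (cases n)
    (auto simp: continuous_on_eq_continuous_within intro: has_vector_derivative_continuous)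

lemma Ck_on_SucD: "Ck_on (Suc n) S f \<Longrightarrow> Ck_on n S f"
proof (induction n arbitrary: f)
  case 0
  then show ?case using Ck_on_imp_continuous_on[OF 0] by simp
next
  case (Suc n)
  then show ?case by (metis Ck_on.simps(2))
qed

lemma Ck_on_const: "Ck_on n S (\<lambda>x. c)"
proof (induction n arbitrary: c)
  case (Suc n)
  show ?case by (rule Ck_on_SucI[of _ _ "\<lambda>x. 0"]) (auto intro!: Suc)
qed simp

lemma Ck_on_ident: "Ck_on n S (\<lambda>x. x)"
proof (cases n)
  case (Suc k)
  show ?thesis unfolding Suc
    by (rule Ck_on_SucI[of _ _ "\<lambda>x. 1"]) (auto intro!: Ck_on_const derivative_eq_intros)
qed simp

lemma Ck_on_add: "Ck_on n S f \<Longrightarrow> Ck_on n S g \<Longrightarrow> Ck_on n S (\<lambda>x. f x + g x)"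
proof (induction n arbitrary: f g)
  case 0
  then show ?case by (auto intro: continuous_intros)
next
  case (Suc n)
  then obtain f' g' where
    "\<forall>x\<in>S. (f has_vector_derivative f' x) (at x within S)" "Ck_on n S f'"
    "\<forall>x\<in>S. (g has_vector_derivative g' x) (at x within S)" "Ck_on n S g'"
    by auto
  then show ?case
    using Suc.IH by (intro Ck_on_SucI[of _ _ "\<lambda>x. f' x + g' x"]) (auto intro!: derivative_eq_intros)
qed

lemma (in bounded_bilinear) Ck_on: "Ck_on n S f \<Longrightarrow> Ck_on n S g \<Longrightarrow> Ck_on n S (\<lambda>x. prod (f x) (g x))"
proof (induction n arbitrary: f g)
  case 0
  then show ?case by (auto intro: continuous_on)
next
  case (Suc n)
  then obtain f' g' where *:
    "\<forall>x\<in>S. (f has_vector_derivative f' x) (at x within S)" "Ck_on n S f'"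
    "\<forall>x\<in>S. (g has_vector_derivative g' x) (at x within S)" "Ck_on n S g'"
    by auto
  have "Ck_on n S f" "Ck_on n S g"
    using Suc.prems Ck_on_SucD by blast+
  then have "Ck_on n S (\<lambda>x. prod (f x) (g' x) + prod (f' x) (g x))"
    using Suc.IH * by (intro Ck_on_add) auto
  moreover have "\<forall>x\<in>S. ((\<lambda>x. prod (f x) (g x)) has_vector_derivative
      prod (f x) (g' x) + prod (f' x) (g x)) (at x within S)"
    using * has_vector_derivative by blast
  ultimately show ?case by (intro Ck_on_SucI[of _ _ "\<lambda>x. prod (f x) (g' x) + prod (f' x) (g x)"])
      auto
qed

lemma (in bounded_linear) Ck_on: "Ck_on n S g \<Longrightarrow> Ck_on n S (\<lambda>x. f (g x))"
proof (induction n arbitrary: g)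
  case 0
  then show ?case by (auto intro: continuous_on)
next
  case (Suc n)
  then obtain g' where
    "\<forall>x\<in>S. (g has_vector_derivative g' x) (at x within S)" "Ck_on n S g'"
    by auto
  then show ?case
    using Suc.IH has_vector_derivative by (intro Ck_on_SucI[of _ _ "\<lambda>x. f (g' x)"]) auto
qed

lemmas Ck_on_scaleR = bounded_bilinear.Ck_on[OF bounded_bilinear_scaleR]
lemmas Ck_on_mult = bounded_bilinear.Ck_on[OF bounded_bilinear_mult]

lemma Ck_on_uminus: "Ck_on n S f \<Longrightarrow> Ck_on n S (\<lambda>x. - f x)"
  using bounded_linear.Ck_on[OF bounded_linear_minus[OF bounded_linear_ident]] .

lemma Ck_on_diff: "Ck_on n S f \<Longrightarrow> Ck_on n S g \<Longrightarrow> Ck_on n S (\<lambda>x. f x - g x)"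
  using Ck_on_add[of n S f "\<lambda>x. - g x"] Ck_on_uminus[of n S g] by simp

lemma Ck_on_compose:
  fixes g :: "real \<Rightarrow> real"
  shows "Ck_on n S g \<Longrightarrow> Ck_on n T f \<Longrightarrow> g ` S \<subseteq> T \<Longrightarrow> Ck_on n S (\<lambda>x. f (g x))"
proof (induction n arbitrary: f)
  case 0
  then show ?case by (auto intro: continuous_on_compose2)
next
  case (Suc n)
  then obtain f' g' where *:
    "\<forall>x\<in>T. (f has_vector_derivative f' x) (at x within T)" "Ck_on n T f'"
    "\<forall>x\<in>S. (g has_vector_derivative g' x) (at x within S)" "Ck_on n S g'"
    by auto
  have "((\<lambda>x. f (g x)) has_vector_derivative g' x *\<^sub>R f' (g x)) (at x within S)" if "x \<in> S" for x
  proof -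
    have "(f has_vector_derivative f' (g x)) (at (g x) within g ` S)"
      using * that Suc.prems by (blast intro: has_vector_derivative_within_subset)
    then show ?thesis
      using vector_diff_chain_within[of g "g' x" x S f] * that by (simp add: o_def)
  qed
  moreover have "Ck_on n S (\<lambda>x. g' x *\<^sub>R f' (g x))"
    using * Suc.IH[of f'] Suc.prems(1,3) Ck_on_SucD[OF Suc.prems(1)] by (intro Ck_on_scaleR) blast+
  ultimately show ?case by (intro Ck_on_SucI[of _ _ "\<lambda>x. g' x *\<^sub>R f' (g x)"]) auto
qed

lemma Ck_on_powr: "Ck_on n {0<..} (\<lambda>x::real. x powr a)"
proof (induction n arbitrary: a)
  case 0
  then show ?case by (auto intro!: continuous_intros)
next
  case (Suc n)
  have "Ck_on n {0<..} (\<lambda>x::real. a * x powr (a - 1))"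
    by (intro Ck_on_mult Ck_on_const Suc)
  moreover have "((\<lambda>x::real. x powr a) has_vector_derivative a * x powr (a - 1)) (at x within
      {0<..})"
    if "x \<in> {0<..}" for x
    using has_real_derivative_powr[of x a] that
    by (auto simp flip: has_real_derivative_iff_has_vector_derivative intro:
        has_field_derivative_at_within)
  ultimately show ?case by (intro Ck_on_SucI[of _ _ "\<lambda>x::real. a * x powr (a - 1)"]) auto
qed

lemma Ck_on_sin_cos: "Ck_on n S (sin :: real \<Rightarrow> real) \<and> Ck_on n S (cos :: real \<Rightarrow> real)"
proof (induction n)
  case 0
  then show ?case by (auto intro!: continuous_intros)
next
  case (Suc n)
  have "(sin has_vector_derivative cos x) (at x within S)"
    and "(cos has_vector_derivative - sin x) (at x within S)" for x :: real
    by (auto simp flip: has_real_derivative_iff_has_vector_derivative intro!: derivative_eq_intros)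
  then show ?case
    using Suc by (auto intro!: Ck_on_SucI[of S sin cos] Ck_on_SucI[of S cos "\<lambda>x. - sin x"]
        Ck_on_uminus
      simp del: Ck_on.simps)
qed

text \<open>The powers of the positive part are the building blocks of the cutoff function: \<open>k + 1\<close> is
the smallest exponent for which the \<open>k\<close>-th derivative is still continuous at \<open>0\<close>.\<close>

lemma Ck_on_positive_part_power: "Ck_on n UNIV (\<lambda>y::real. max 0 y ^ Suc n)"
proof (induction n)
  case 0
  then show ?case by (auto intro!: continuous_intros)
next
  case (Suc n)
  have "((\<lambda>y::real. max 0 y ^ Suc (Suc n)) has_real_derivative real (Suc (Suc n)) * max 0 x ^ Suc
      n) (at x)"
    for x :: real
  proof -
    consider "x < 0" | "x = 0" | "x > 0" by linarith
    then show ?thesis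
    proof cases
      case 1
      have "((\<lambda>y::real. 0) has_real_derivative 0) (at x)" by simp
      then have "((\<lambda>y::real. max 0 y ^ Suc (Suc n)) has_real_derivative 0) (at x)"
        by (rule has_field_derivative_transform_within_open[of _ _ _ "{..<0}"]) (use 1 in auto)
      then show ?thesis using 1 by simp
    next
      case 2
      have "((\<lambda>y::real. max 0 y ^ Suc (Suc n)) has_real_derivative 0) (at 0)"
        unfolding CARAT_DERIV
      proof (intro exI[of _ "\<lambda>y. max 0 y ^ Suc n"] conjI)
        show "\<forall>z::real. max 0 z ^ Suc (Suc n) - max 0 0 ^ Suc (Suc n) = max 0 z ^ Suc n * (z - 0)"
          by (auto simp: max_def)
        show "isCont (\<lambda>y::real. max 0 y ^ Suc n) 0"
          by (intro continuous_intros)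
      qed simp
      then show ?thesis using 2 by simp
    next
      case 3
      have "((\<lambda>y::real. y ^ Suc (Suc n)) has_real_derivative real (Suc (Suc n)) * x ^ Suc n) (at x)"
        by (rule derivative_eq_intros refl)+ simp
      then have "((\<lambda>y::real. max 0 y ^ Suc (Suc n)) has_real_derivative real (Suc (Suc n)) * x ^
          Suc n) (at x)"
        by (rule has_field_derivative_transform_within_open[of _ _ _ "{0<..}"]) (use 3 in auto)
      then show ?thesis using 3 by (simp add: max_def)
    qed
  qed
  moreover have "Ck_on n UNIV (\<lambda>x::real. real (Suc (Suc n)) * max 0 x ^ Suc n)"
    by (intro Ck_on_mult Ck_on_const Suc)
  ultimately show ?case
    unfolding has_real_derivative_iff_has_vector_derivative by (rule Ck_on_SucI)
qed

lemma Ck_on_glue: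
  fixes f g :: "real \<Rightarrow> 'a::real_normed_vector"
  assumes "Ck_on n UNIV f" "Ck_on n UNIV g" "e > 0" "\<And>t. \<bar>t - m\<bar> < e \<Longrightarrow> f t = g t"
  shows "Ck_on n UNIV (\<lambda>t. if t \<le> m then f t else g t)"
  using assms
proof (induction n arbitrary: f g)
  case 0
  have "continuous_on ({..m} \<union> {m..}) (\<lambda>t. if t \<le> m then f t else g t)"
    by (rule continuous_on_If)
       (use 0 in \<open>auto intro: continuous_on_subset simp: antisym\<close>)
  moreover have "{..m} \<union> {m..} = (UNIV::real set)" by auto
  ultimately show ?case by simp
next
  case (Suc n)
  then obtain f' g' where *:
    "\<And>x. (f has_vector_derivative f' x) (at x)" "Ck_on n UNIV f'"
    "\<And>x. (g has_vector_derivative g' x) (at x)" "Ck_on n UNIV g'"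
    by auto
  let ?I = "{m - e<..<m + e}"
  have eq: "f' t = g' t" if "\<bar>t - m\<bar> < e" for t
  proof -
    have "(g has_vector_derivative f' t) (at t)"
      by (rule has_vector_derivative_transform_within_open[OF *(1), of ?I])
         (use that Suc.prems in \<open>auto simp: abs_less_iff\<close>)
    then show ?thesis using *(3) vector_derivative_unique_at by blast
  qed
  have "((\<lambda>t. if t \<le> m then f t else g t) has_vector_derivative (if t
      \<le> m then f' t else g' t)) (at t)"
    for t
  proof -
    consider "t < m" | "t > m" | "t = m" by linarith
    then show ?thesis
    proof cases
      case 1
      then show ?thesis
        using has_vector_derivative_transform_within_open[OF *(1), of "{..<m}" t] by auto
    next
      case 2
      then show ?thesis
        using has_vector_derivative_transform_within_open[OF *(3), of "{m<..}" t] by auto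
    next
      case 3
      have "((\<lambda>t. if t \<le> m then f t else g t) has_vector_derivative f' m) (at m)"
        by (rule has_vector_derivative_transform_within_open[OF *(1), of ?I])
           (use Suc.prems in \<open>auto simp: abs_less_iff\<close>)
      then show ?thesis using 3 by simp
    qed
  qed
  moreover have "Ck_on n UNIV (\<lambda>t. if t \<le> m then f' t else g' t)"
    using Suc.IH[OF *(2,4) Suc.prems(3) eq] .
  ultimately show ?case by (intro Ck_on_SucI[of _ _ "\<lambda>t. if t \<le> m then f' t else g' t"]) auto
qed

lemma Ck_on_deriv:
  assumes "Ck_on (Suc n) UNIV f" "\<And>t. (f has_vector_derivative f1 t) (at t)"
  shows "Ck_on n UNIV f1"
proof -
  obtain f' where f': "\<And>x. (f has_vector_derivative f' x) (at x)" "Ck_on n UNIV f'"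
    using assms by auto
  then have "f' = f1" using assms(2) vector_derivative_unique_at by blast
  then show ?thesis using f' by simp
qed

text \<open>Bootstrapping: as soon as \<open>\<tau>\<close> has \<open>k\<close> continuous derivatives, so has \<open>\<tau>' = W \<circ> \<tau>\<close>. It
applies to the inverse of the arclength function, whose derivative is the reciprocal speed at
the inverse.\<close>

lemma Ck_on_autonomous_ode:
  fixes \<tau> :: "real \<Rightarrow> real"
  assumes W: "Ck_on n UNIV W" and \<tau>: "\<And>s. (\<tau> has_vector_derivative W (\<tau> s)) (at s)"
  shows "Ck_on (Suc n) UNIV \<tau>"
  using W
proof (induction n)
  case 0
  have "continuous_on UNIV \<tau>"
    using has_vector_derivative_continuous[OF \<tau>] by (auto simp: continuous_on_eq_continuous_at)
  then have "continuous_on UNIV (\<lambda>s. W (\<tau> s))"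
    using 0 by (auto intro: continuous_on_compose2)
  then show ?case using \<tau> by (intro Ck_on_SucI[of _ _ "\<lambda>s. W (\<tau> s)"]) auto
next
  case (Suc n)
  have "Ck_on (Suc n) UNIV (\<lambda>s. W (\<tau> s))"
    by (rule Ck_on_compose[OF Suc.IH[OF Ck_on_SucD[OF Suc.prems]] Suc.prems]) simp
  then show ?case by (rule Ck_on_SucI[OF \<tau>])
qed

text \<open>The new curve is defined on the whole line, not just on \<open>{0..L}\<close>, so that later arguments
need no one-sided derivatives. The lower bound on the speed makes arclength a bijection of the
line.\<close>

lemma unit_speed_reparametrization:
  fixes f f1 :: "real \<Rightarrow> 'a::real_inner"
  assumes f: "Ck_on (Suc n) UNIV f" and f1: "\<And>t. (f has_vector_derivative f1 t) (at t)"
    and m: "m > 0" "\<And>t. m \<le> norm (f1 t)" and ab: "a < b"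
  obtains z z1 L where "0 < L" "Ck_on (Suc n) UNIV z"
    "\<And>s. (z has_vector_derivative z1 s) (at s)" "\<And>s. norm (z1 s) = 1"
    "z ` {0..L} = f ` {a..b}" "inj_on f {a..b} \<Longrightarrow> inj_on z {0..L}"
proof -
  have f1C: "Ck_on n UNIV f1" by (rule Ck_on_deriv[OF f f1])
  have cont: "continuous_on UNIV (\<lambda>t. norm (f1 t))"
    using Ck_on_imp_continuous_on[OF f1C] by (rule continuous_on_norm)
  \<comment> \<open>arclength is an antiderivative of the speed\<close>
  have "\<exists>F. \<forall>x. -\<infinity> < ereal x \<longrightarrow> ereal x < \<infinity> \<longrightarrow> (F has_vector_derivative norm (f1 x)) (at x)"
    by (rule einterval_antiderivative) (use cont in \<open>auto simp: continuous_on_eq_continuous_at\<close>)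
  then obtain F where F: "\<And>x. (F has_real_derivative norm (f1 x)) (at x)"
    by (auto simp: has_real_derivative_iff_has_vector_derivative)
  define \<sigma> where "\<sigma> t = F t - F a" for t
  have \<sigma>: "(\<sigma> has_real_derivative norm (f1 x)) (at x)" for x
    unfolding \<sigma>_def using F[of x] by (auto intro!: derivative_eq_intros)
  have grow: "m * (t - s) \<le> \<sigma> t - \<sigma> s" if "s \<le> t" for s t
  proof (cases "s = t")
    case False
    then obtain x where "\<sigma> t - \<sigma> s = (t - s) * norm (f1 x)"
      using MVT2[of s t \<sigma> "\<lambda>x. norm (f1 x)"] \<sigma> \<open>s \<le> t\<close> by auto
    then show ?thesis using m(2)[of x] that by (simp add: mult.commute[of m] mult_left_mono)
  qed auto
  have contS: "continuous_on S \<sigma>" for S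
    using \<sigma> DERIV_isCont by (auto intro!: continuous_at_imp_continuous_on)
  have surj: "\<exists>t. \<sigma> t = y" for y
  proof -
    define T where "T = \<bar>y\<bar> / m"
    have T: "0 \<le> T" "m * T = \<bar>y\<bar>" using m by (auto simp: T_def)
    have "\<sigma> a = 0" by (simp add: \<sigma>_def)
    have "\<sigma> (a - T) \<le> y" "y \<le> \<sigma> (a + T)"
      using grow[of a "a + T"] grow[of "a - T" a] T \<open>\<sigma> a = 0\<close> by auto
    then have "\<exists>t\<ge>a - T. t \<le> a + T \<and> \<sigma> t = y"
      using T(1) contS by (intro IVT') auto
    then show ?thesis by blast
  qed
  define \<tau> where "\<tau> = inv \<sigma>"
  have \<sigma>\<tau>: "\<sigma> (\<tau> y) = y" for y
  proof -
    have "surj \<sigma>" unfolding surj_def by (intro allI, metis surj)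
    then show ?thesis unfolding \<tau>_def by (rule surj_f_inv_f)
  qed
  have expand: "m * \<bar>t - s\<bar> \<le> \<bar>\<sigma> t - \<sigma> s\<bar>" for s t
    using grow[of s t] grow[of t s] by (cases "s \<le> t") auto
  have inj: "inj \<sigma>"
  proof (rule injI)
    fix x y assume "\<sigma> x = \<sigma> y"
    then have "m * \<bar>x - y\<bar> \<le> 0" using expand[of x y] by simp
    then show "x = y" using m by (simp add: mult_le_0_iff)
  qed
  have \<tau>\<sigma>: "\<tau> (\<sigma> t) = t" for t
    unfolding \<tau>_def using inj by simp
  have cont\<tau>: "isCont \<tau> x" for x
  proof -
    have "(1/m)-lipschitz_on UNIV \<tau>"
      using expand[of "\<tau> _" "\<tau> _"] m
      by (auto intro!: lipschitz_onI simp: \<sigma>\<tau> dist_real_def field_simps)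
    then have "continuous_on UNIV \<tau>" by (rule lipschitz_on_continuous_on)
    then show ?thesis by (simp add: continuous_on_eq_continuous_at)
  qed
  have ne: "norm (f1 t) \<noteq> 0" for t using m(2)[of t] m(1) by linarith
  have \<tau>d: "(\<tau> has_real_derivative inverse (norm (f1 (\<tau> s)))) (at s)" for s
    by (rule DERIV_inverse_function[where f=\<sigma> and a="s-1" and b="s+1"])
       (use \<sigma> ne cont\<tau> \<sigma>\<tau> in auto)
  have "Ck_on n UNIV (\<lambda>t. (f1 t \<bullet> f1 t) powr (-1/2))"
  proof (rule Ck_on_compose[OF _ Ck_on_powr])
    show "Ck_on n UNIV (\<lambda>t. f1 t \<bullet> f1 t)"
      by (rule bounded_bilinear.Ck_on[OF bounded_bilinear_inner f1C f1C])
    show "range (\<lambda>t. f1 t \<bullet> f1 t) \<subseteq> {0<..}" using ne by auto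
  qed
  moreover have "(f1 t \<bullet> f1 t) powr (-1/2) = inverse (norm (f1 t))" for t
  proof -
    have "(f1 t \<bullet> f1 t) = norm (f1 t) powr 2"
      using ne[of t] by (simp add: power2_norm_eq_inner)
    then show ?thesis using ne[of t] by (simp add: powr_powr powr_minus)
  qed
  ultimately have W: "Ck_on n UNIV (\<lambda>t. inverse (norm (f1 t)))" by simp
  have \<tau>C: "Ck_on (Suc n) UNIV \<tau>"
    by (rule Ck_on_autonomous_ode[OF W])
       (use \<tau>d in \<open>auto simp: has_real_derivative_iff_has_vector_derivative\<close>)
  define z where "z s = f (\<tau> s)" for s
  define z1 where "z1 s = inverse (norm (f1 (\<tau> s))) *\<^sub>R f1 (\<tau> s)" for s
  show thesis
  proof (rule that)
    show "0 < \<sigma> b"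
    proof -
      have "0 < m * (b - a)" using m ab by simp
      then show ?thesis using grow[of a b] ab by (simp add: \<sigma>_def)
    qed
    show "Ck_on (Suc n) UNIV z"
      unfolding z_def by (rule Ck_on_compose[OF \<tau>C f]) auto
    show "(z has_vector_derivative z1 s) (at s)" for s
      unfolding z_def z1_def
      using vector_diff_chain_at[OF \<tau>d[unfolded has_real_derivative_iff_has_vector_derivative] f1]
      by (simp add: o_def)
    show "norm (z1 s) = 1" for s using ne[of "\<tau> s"] by (simp add: z1_def)
    have mono: "\<sigma> s \<le> \<sigma> t \<longleftrightarrow> s \<le> t" for s t
    proof (cases "s \<le> t")
      case True
      then have "0 \<le> m * (t - s)" using m by simp
      then show ?thesis using grow[OF True] True by simp
    next
      case False
      then have "0 < m * (s - t)" using m by simp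
      then show ?thesis using grow[of t s] False by simp
    qed
    have im: "\<tau> ` {0..\<sigma> b} = {a..b}"
    proof -
      have "{0..\<sigma> b} = \<sigma> ` {a..b}"
      proof -
        have "\<sigma> a = 0" by (simp add: \<sigma>_def)
        show ?thesis
        proof (intro equalityI subsetI)
          fix y assume y: "y \<in> {0..\<sigma> b}"
          then have "\<sigma> a \<le> \<sigma> (\<tau> y)" "\<sigma> (\<tau> y) \<le> \<sigma> b" using \<open>\<sigma> a = 0\<close> by (auto simp: \<sigma>\<tau>)
          then have "a \<le> \<tau> y" "\<tau> y \<le> b" unfolding mono .
          then show "y \<in> \<sigma> ` {a..b}"
            using \<sigma>\<tau>[of y] by (intro image_eqI[of _ _ "\<tau> y"]) (simp_all add: mono)
        qed (use mono[of a] mono[of _ b] \<open>\<sigma> a = 0\<close> in auto)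
      qed
      then have "\<tau> ` {0..\<sigma> b} = (\<lambda>t. \<tau> (\<sigma> t)) ` {a..b}" by (simp only: image_image)
      then show ?thesis by (simp add: \<tau>\<sigma>)
    qed
    show "z ` {0..\<sigma> b} = f ` {a..b}"
      unfolding z_def im[symmetric] by (simp add: image_image)
    show "inj_on z {0..\<sigma> b}" if "inj_on f {a..b}"
    proof (rule inj_onI)
      fix x y assume xy: "x \<in> {0..\<sigma> b}" "y \<in> {0..\<sigma> b}" "z x = z y"
      then have "\<tau> x \<in> {a..b}" "\<tau> y \<in> {a..b}" using im by blast+
      then have "\<tau> x = \<tau> y" using that xy unfolding z_def inj_on_def by blast
      then show "x = y" using \<sigma>\<tau> by metis
    qed
  qed
qed

section \<open>The smoothed meandering curve\<close>

text \<open>With \<open>P y = y\<^sub>+\<^sup>4\<close> this is \<open>1 - P (1 - P (u / \<eta>))\<close>, a function of class \<open>C\<^sup>3\<close> that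
increases from \<open>0\<close> on \<open>u \<le> 0\<close> to \<open>1\<close> on \<open>u \<ge> \<eta>\<close>.\<close>

definition cutoff :: "real \<Rightarrow> real \<Rightarrow> real" where
  "cutoff \<eta> u = 1 - max 0 (1 - max 0 (u / \<eta>) ^ 4) ^ 4"

text \<open>The difference between a unit circle and its tangent line, both at arclength \<open>u\<close> from the
point of contact, switched on gradually.\<close>

definition bend :: "real \<Rightarrow> real \<Rightarrow> complex" where
  "bend \<eta> u = cutoff \<eta> u *\<^sub>R Complex (u - sin u) (1 - cos u)"

text \<open>One segment together with the two semicircles attached to it, as a curve odd about the
midpoint of the segment and running in the direction \<open>-1\<close> there. The formula extends both
circles indefinitely.\<close>

definition s_curve :: "real \<Rightarrow> real \<Rightarrow> complex" where
  "s_curve \<eta> t = of_real (- t) + bend \<eta> (t - 1) - bend \<eta> (- t - 1)"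

definition mirror :: "nat \<Rightarrow> complex \<Rightarrow> complex" where
  "mirror k w = (if odd k then w else - cnj w)"

text \<open>The time at which the curve passes the midpoint of the \<open>k\<close>-th segment: consecutive
midpoints are separated by half a segment, a semicircle and half a segment.\<close>

definition mid_time :: "nat \<Rightarrow> real" where
  "mid_time k = real k * (pi + 2)"

definition chart :: "real \<Rightarrow> nat \<Rightarrow> real \<Rightarrow> complex" where
  "chart \<eta> k t = Complex 0 (2 * real k) + mirror k (s_curve \<eta> (t - mid_time k))"

text \<open>Consecutive charts agree on the unsmoothed part of the semicircle that they share, and one
changes from one to the next at the middle of that semicircle. \<open>snake \<eta> K\<close> has \<open>K + 1\<close> segments.\<close>

fun snake :: "real \<Rightarrow> nat \<Rightarrow> real \<Rightarrow> complex" where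
  "snake \<eta> 0 t = chart \<eta> 1 t"
| "snake \<eta> (Suc K) t =
     (if t \<le> mid_time (Suc K) + (pi + 2) / 2 then snake \<eta> K t else chart \<eta> (K + 2) t)"

definition rise :: "real \<Rightarrow> real \<Rightarrow> real" where
  "rise \<eta> u = cutoff \<eta> u * (1 - cos u)"

definition snake_start :: real where
  "snake_start = mid_time 1 - 1 - pi"

definition snake_end :: "nat \<Rightarrow> real" where
  "snake_end K = mid_time (Suc K) + 1 + pi"

definition trace :: "real \<Rightarrow> nat \<Rightarrow> complex set" where
  "trace \<eta> K = snake \<eta> K ` {snake_start..snake_end K}"

definition side :: "nat \<Rightarrow> real" where
  "side i = (if even i then 1 else -1)"

text \<open>The \<open>i\<close>-th semicircle (counted from \<open>0\<close>), at angle \<open>u\<close> from its lower end.\<close>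

definition arc :: "nat \<Rightarrow> real \<Rightarrow> complex" where
  "arc i u = Complex (side i * (1 + sin u)) (2 * real i + 1 - cos u)"

lemma mid_time_Suc: "mid_time (Suc k) = mid_time k + (pi + 2)"
  by (simp add: mid_time_def algebra_simps)

lemma mid_time_mono: "j \<le> k \<Longrightarrow> mid_time j \<le> mid_time k"
  unfolding mid_time_def by (intro mult_right_mono) auto

lemma snake_start_less_end: "snake_start < snake_end K"
  using pi_gt3 by (simp add: snake_start_def snake_end_def mid_time_def algebra_simps
      add_pos_nonneg)

lemma chord_le_arc: "0 \<le> u \<Longrightarrow> sqrt ((sin u)\<^sup>2 + (1 - cos u)\<^sup>2) \<le> (u::real)"
proof -
  assume u: "0 \<le> u"
  have "(sin u)\<^sup>2 + (1 - cos u)\<^sup>2 = 2 - 2 * cos u"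
    using sin_cos_squared_add[of u] by (simp add: power2_eq_square algebra_simps)
  also have "\<dots> = (2 * sin (u / 2))\<^sup>2"
    using cos_double_sin[of "u / 2"] by (simp add: power2_eq_square)
  also have "\<dots> \<le> u\<^sup>2"
    using abs_sin_x_le_abs_x[of "u / 2"] u by (intro power2_le_iff_abs_le[THEN iffD2]) auto
  finally show ?thesis using u by (simp add: real_le_lsqrt)
qed

lemma Ck_on_cutoff: "Ck_on 3 UNIV (cutoff \<eta>)"
proof -
  have P: "Ck_on 3 UNIV (\<lambda>y::real. max 0 y ^ 4)"
    using Ck_on_positive_part_power[of 3] by (simp add: eval_nat_numeral)
  have "Ck_on 3 UNIV (\<lambda>u. (1/\<eta>) * u)"
    by (intro Ck_on_mult Ck_on_const Ck_on_ident)
  then have "Ck_on 3 UNIV (\<lambda>u. max 0 ((1/\<eta>) * u) ^ 4)"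
    by (rule Ck_on_compose[OF _ P]) simp
  then have "Ck_on 3 UNIV (\<lambda>u. 1 - max 0 ((1/\<eta>) * u) ^ 4)"
    by (intro Ck_on_diff Ck_on_const)
  then have "Ck_on 3 UNIV (\<lambda>u. max 0 (1 - max 0 ((1/\<eta>) * u) ^ 4) ^ 4)"
    by (rule Ck_on_compose[OF _ P]) simp
  then have "Ck_on 3 UNIV (\<lambda>u. 1 - max 0 (1 - max 0 ((1/\<eta>) * u) ^ 4) ^ 4)"
    by (intro Ck_on_diff Ck_on_const)
  then show ?thesis by (simp add: cutoff_def[abs_def])
qed

lemma Ck_on_Complex:
  assumes "Ck_on n S f" "Ck_on n S g"
  shows "Ck_on n S (\<lambda>x. Complex (f x) (g x))"
proof -
  have "(\<lambda>x. Complex (f x) (g x)) = (\<lambda>x. f x *\<^sub>R 1 + g x *\<^sub>R \<i>)"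
    by (auto simp: complex_eq_iff)
  then show ?thesis
    using assms by (auto intro!: Ck_on_add Ck_on_scaleR Ck_on_const)
qed

lemma Ck_on_bend: "Ck_on 3 UNIV (bend \<eta>)"
proof -
  have "Ck_on 3 UNIV (sin::real\<Rightarrow>real)" "Ck_on 3 UNIV (cos::real\<Rightarrow>real)"
    using Ck_on_sin_cos by blast+
  then show ?thesis
    unfolding bend_def[abs_def]
    by (intro Ck_on_scaleR Ck_on_cutoff Ck_on_Complex Ck_on_diff Ck_on_ident Ck_on_const)
qed

lemma Ck_on_s_curve: "Ck_on 3 UNIV (s_curve \<eta>)"
  unfolding s_curve_def[abs_def]
  by (intro Ck_on_add Ck_on_diff bounded_linear.Ck_on[OF bounded_linear_of_real] Ck_on_uminus
      Ck_on_ident Ck_on_const Ck_on_compose[OF _ Ck_on_bend] subset_UNIV)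

lemma bounded_linear_mirror: "bounded_linear (mirror k)"
proof -
  have "bounded_linear (\<lambda>w. - cnj w)"
    by (intro bounded_linear_minus bounded_linear_cnj)
  then show ?thesis by (cases "odd k") (auto simp: mirror_def[abs_def])
qed

lemma Ck_on_chart: "Ck_on 3 UNIV (chart \<eta> k)"
  unfolding chart_def[abs_def]
  by (intro Ck_on_add Ck_on_const bounded_linear.Ck_on[OF bounded_linear_mirror]
      Ck_on_compose[OF _ Ck_on_s_curve] Ck_on_diff Ck_on_ident subset_UNIV)

lemma Im_mirror [simp]: "Im (mirror k w) = Im w"
  and norm_mirror [simp]: "norm (mirror k w) = norm w"
  and Re_mirror: "Re (mirror k w) = (if odd k then Re w else - Re w)"
  by (auto simp: mirror_def)

context
  fixes \<eta> :: real
  assumes \<eta>: "0 < \<eta>" "\<eta> \<le> 1 / 2"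
begin

lemma cutoff_nonpos: "u \<le> 0 \<Longrightarrow> cutoff \<eta> u = 0"
  using \<eta> divide_nonpos_pos[of u \<eta>] by (simp add: cutoff_def max_absorb1)

lemma cutoff_ge: "\<eta> \<le> u \<Longrightarrow> cutoff \<eta> u = 1"
proof -
  assume "\<eta> \<le> u"
  then have "1 \<le> u / \<eta>" using \<eta> by simp
  then have "1 \<le> max 0 (u / \<eta>) ^ 4" by (intro one_le_power) auto
  then show ?thesis by (simp add: cutoff_def)
qed

lemma cutoff_pos: "0 < u \<Longrightarrow> 0 < cutoff \<eta> u"
proof -
  assume "0 < u"
  then have "0 < max 0 (u / \<eta>) ^ 4" using \<eta> by (simp add: max_def)
  then have "max 0 (1 - max 0 (u / \<eta>) ^ 4) ^ 4 < (1::real) ^ 4"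
    by (intro power_strict_mono) auto
  then show ?thesis by (simp add: cutoff_def)
qed

lemma cutoff_bounds: "0 \<le> cutoff \<eta> u" "cutoff \<eta> u \<le> 1"
  using cutoff_nonpos[of u] cutoff_pos[of u] by (cases "u \<le> 0"; force) (simp add: cutoff_def)

lemma cutoff_mono: "u \<le> v \<Longrightarrow> cutoff \<eta> u \<le> cutoff \<eta> v"
proof -
  assume "u \<le> v"
  then have "max 0 (u / \<eta>) ^ 4 \<le> max 0 (v / \<eta>) ^ 4"
    using \<eta> by (intro power_mono max.mono divide_right_mono) auto
  then have "max 0 (1 - max 0 (v / \<eta>) ^ 4) ^ 4 \<le> max 0 (1 - max 0 (u / \<eta>) ^ 4) ^ 4"
    by (intro power_mono max.mono) auto
  then show ?thesis by (simp add: cutoff_def)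
qed

lemma Im_bend: "Im (bend \<eta> u) = rise \<eta> u"
  by (simp add: bend_def rise_def)

lemma rise_nonpos: "u \<le> 0 \<Longrightarrow> rise \<eta> u = 0"
  by (simp add: rise_def cutoff_nonpos)

lemma rise_nonneg: "0 \<le> rise \<eta> u"
  by (simp add: rise_def cutoff_bounds)

lemma rise_strict: "0 \<le> u \<Longrightarrow> u < v \<Longrightarrow> v \<le> pi \<Longrightarrow> rise \<eta> u < rise \<eta> v"
proof -
  assume *: "0 \<le> u" "u < v" "v \<le> pi"
  have "cos v < cos u" using * by (intro cos_monotone_0_pi) auto
  then have "cutoff \<eta> v * (1 - cos u) < cutoff \<eta> v * (1 - cos v)"
    using cutoff_pos[of v] * by simp
  moreover have "cutoff \<eta> u * (1 - cos u) \<le> cutoff \<eta> v * (1 - cos u)"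
    using cutoff_mono[of u v] * by (intro mult_right_mono) auto
  ultimately show ?thesis by (simp add: rise_def)
qed

lemma rise_le: "u \<le> pi \<Longrightarrow> rise \<eta> u \<le> 2"
  using mult_mono[OF cutoff_bounds(2), of "1 - cos u" 2 u] cos_ge_minus_one[of u]
  by (simp add: rise_def)

lemma rise_pi_half: "rise \<eta> (pi / 2) = 1"
  using \<eta> pi_gt3 by (simp add: rise_def cutoff_ge)

lemma bend_nonpos: "u \<le> 0 \<Longrightarrow> bend \<eta> u = 0"
  by (simp add: bend_def cutoff_nonpos)

lemma bend_ge: "\<eta> \<le> u \<Longrightarrow> bend \<eta> u = Complex (u - sin u) (1 - cos u)"
  by (simp add: bend_def cutoff_ge)

lemma s_curve_minus: "s_curve \<eta> (- t) = - s_curve \<eta> t"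
  by (simp add: s_curve_def)

lemma s_curve_mid: "\<bar>t\<bar> \<le> 1 \<Longrightarrow> s_curve \<eta> t = of_real (- t)"
  by (simp add: s_curve_def bend_nonpos abs_le_iff)

lemma s_curve_right: "-1 \<le> t \<Longrightarrow> s_curve \<eta> t = of_real (- t) + bend \<eta> (t - 1)"
  by (simp add: s_curve_def bend_nonpos)

lemma s_curve_arc: "\<eta> \<le> u \<Longrightarrow> s_curve \<eta> (1 + u) = Complex (- 1 - sin u) (1 - cos u)"
  using \<eta> by (simp add: s_curve_right bend_ge complex_eq_iff)

lemma Im_s_curve: "Im (s_curve \<eta> t) = rise \<eta> (t - 1) - rise \<eta> (- t - 1)"
  by (simp add: s_curve_def Im_bend)

lemma Re_s_curve_le: "1 \<le> t \<Longrightarrow> t \<le> 1 + pi \<Longrightarrow> Re (s_curve \<eta> t) \<le> -1"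
proof -
  assume t: "1 \<le> t" "t \<le> 1 + pi"
  define u where "u = t - 1"
  have u: "0 \<le> u" "u \<le> pi" using t by (auto simp: u_def)
  have "Re (s_curve \<eta> t) = - 1 - ((1 - cutoff \<eta> u) * u + cutoff \<eta> u * sin u)"
    using t by (simp add: s_curve_right bend_def u_def algebra_simps)
  moreover have "0 \<le> (1 - cutoff \<eta> u) * u + cutoff \<eta> u * sin u"
    using u cutoff_bounds[of u] by (intro add_nonneg_nonneg mult_nonneg_nonneg sin_ge_zero) auto
  ultimately show ?thesis by linarith
qed

lemma s_curve_cases:
  assumes "\<bar>t\<bar> \<le> 1 + pi"
  obtains "\<bar>t\<bar> \<le> 1" "s_curve \<eta> t = of_real (- t)"
    | "1 < t" "Re (s_curve \<eta> t) \<le> - 1" "0 \<le> Im (s_curve \<eta> t)" "Im (s_curve \<eta> t) \<le> 2"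
    | "t < -1" "1 \<le> Re (s_curve \<eta> t)" "Im (s_curve \<eta> t) \<le> 0" "- 2 \<le> Im (s_curve \<eta> t)"
proof -
  consider "\<bar>t\<bar> \<le> 1" | "1 < t" | "t < -1" by linarith
  then show thesis
  proof cases
    case 1
    then show ?thesis using that(1) s_curve_mid by blast
  next
    case 2
    then show ?thesis
      using that(2) Re_s_curve_le[of t] assms rise_nonneg[of "t - 1"] rise_le[of "t - 1"]
      by (simp add: Im_s_curve rise_nonpos)
  next
    case 3
    then show ?thesis
      using that(3) Re_s_curve_le[of "- t"] assms rise_nonneg[of "- t - 1"] rise_le[of "- t - 1"]
      by (simp add: Im_s_curve rise_nonpos s_curve_minus)
  qed
qed

text \<open>The height is strictly increasing along the two arcs, and constant only on the segment.\<close>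

lemma s_curve_inj: "inj_on (s_curve \<eta>) {- 1 - pi..1 + pi}"
proof -
  have lt: "s_curve \<eta> s \<noteq> s_curve \<eta> t" if "s < t" "- 1 - pi \<le> s" "t \<le> 1 + pi" for s t
  proof (cases "- 1 \<le> s \<and> t \<le> 1")
    case True
    then show ?thesis using that by (auto simp: s_curve_mid)
  next
    case False
    have mono: "rise \<eta> u \<le> rise \<eta> v" if "u \<le> v" "v \<le> pi" for u v
      using rise_strict[of u v] rise_nonpos[of u] rise_nonneg[of v] that
      by (cases "u \<le> 0"; cases "u = v") auto
    have strict: "rise \<eta> u < rise \<eta> v" if "u < v" "v \<le> pi" "0 < v" for u v
      using rise_strict[of u v] rise_strict[of 0 v] rise_nonpos[of u] rise_nonpos[of 0] that
          by (cases "u \<le> 0") auto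
    have "Im (s_curve \<eta> s) < Im (s_curve \<eta> t)"
      using False strict[of "s - 1" "t - 1"] mono[of "s - 1" "t - 1"] that
        strict[of "- t - 1" "- s - 1"] mono[of "- t - 1" "- s - 1"]
      by (auto simp: Im_s_curve)
    then show ?thesis by auto
  qed
  show ?thesis
  proof (rule inj_onI)
    fix x y assume "x \<in> {- 1 - pi..1 + pi}" "y \<in> {- 1 - pi..1 + pi}" "s_curve \<eta> x = s_curve \<eta> y"
    then show "x = y"
      using lt[of x y] lt[of y x] by (cases x y rule: linorder_cases) auto
  qed
qed

lemma chart_centre: "chart \<eta> k (mid_time k + t) = Complex 0 (2 * real k) + mirror k (s_curve \<eta>
    t)"
  by (simp add: chart_def)

text \<open>Between the two smoothed parts both charts run along the same unit circle, in the same
direction.\<close>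

lemma chart_overlap:
  assumes "\<eta> \<le> u" "u \<le> pi - \<eta>"
  shows "chart \<eta> k (mid_time k + (1 + u)) = chart \<eta> (Suc k) (mid_time k + (1 + u))"
proof -
  have t: "mid_time k + (1 + u) = mid_time (Suc k) + - (1 + (pi - u))"
    by (simp add: mid_time_def algebra_simps)
  have e: "s_curve \<eta> (- (1 + (pi - u))) = Complex (1 + sin u) (- 1 - cos u)"
    using assms unfolding s_curve_minus by (subst s_curve_arc) (auto simp: complex_eq_iff)
  have "chart \<eta> (Suc k) (mid_time k + (1 + u)) =
      Complex 0 (2 * real (Suc k)) + mirror (Suc k) (Complex (1 + sin u) (- 1 - cos u))"
    unfolding t chart_centre e ..
  moreover have "chart \<eta> k (mid_time k + (1 + u)) =
      Complex 0 (2 * real k) + mirror k (Complex (- 1 - sin u) (1 - cos u))"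
    unfolding chart_centre s_curve_arc[OF assms(1)] ..
  ultimately show ?thesis by (auto simp: mirror_def complex_eq_iff)
qed

lemma snake_last:
  "mid_time K + (pi + 2) / 2 < t \<Longrightarrow> snake \<eta> K t = chart \<eta> (Suc K) t"
  by (cases K) auto

lemma snake_overlap:
  assumes "\<bar>t - (mid_time (Suc K) + (pi + 2) / 2)\<bar> < 1"
  shows "snake \<eta> K t = chart \<eta> (K + 2) t"
proof -
  have "snake \<eta> K t = chart \<eta> (Suc K) t"
    using assms pi_gt3 by (intro snake_last) (auto simp: mid_time_Suc abs_less_iff field_simps)
  also have "\<dots> = chart \<eta> (K + 2) t"
    using chart_overlap[of "t - mid_time (Suc K) - 1" "Suc K"] assms \<eta> pi_gt3
    by (auto simp: abs_less_iff field_simps)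
  finally show ?thesis .
qed

lemma Ck_on_snake: "Ck_on 3 UNIV (snake \<eta> K)"
proof (induction K)
  case 0
  have "snake \<eta> 0 = chart \<eta> 1" by (simp add: fun_eq_iff)
  then show ?case by (simp add: Ck_on_chart)
next
  case (Suc K)
  let ?m = "mid_time (Suc K) + (pi + 2) / 2"
  have "Ck_on 3 UNIV (\<lambda>t. if t \<le> ?m then snake \<eta> K t else chart \<eta> (K + 2) t)"
    by (intro Ck_on_glue[of _ _ _ 1] Suc Ck_on_chart snake_overlap) auto
  moreover have "snake \<eta> (Suc K) = (\<lambda>t. if t \<le> ?m then snake \<eta> K t else chart \<eta> (K + 2) t)"
    by (simp add: fun_eq_iff)
  ultimately show ?case by (simp only:)
qed

lemma snake_eq_chart:
  assumes "1 \<le> k" "k \<le> Suc K"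
    "k = 1 \<or> mid_time k - (pi + 2) / 2 \<le> t" "k = Suc K \<or> t \<le> mid_time k + (pi + 2) / 2"
  shows "snake \<eta> K t = chart \<eta> k t"
  using assms
proof (induction K)
  case 0
  then show ?case by (simp add: le_antisym)
next
  case (Suc K)
  show ?case
  proof (cases "k = Suc (Suc K)")
    case True
    then have le: "mid_time (Suc K) + (pi + 2) / 2 \<le> t"
      using Suc.prems by (simp add: mid_time_Suc field_simps)
    show ?thesis
    proof (cases "t = mid_time (Suc K) + (pi + 2) / 2")
      case t: True
      have "snake \<eta> (Suc K) t = snake \<eta> K t" using t by simp
      also have "\<dots> = chart \<eta> (Suc K) t"
        using t pi_gt3 by (intro snake_last) (auto simp: mid_time_Suc field_simps)
      also have "\<dots> = chart \<eta> k t"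
        using chart_overlap[of "pi / 2" "Suc K"] \<eta> pi_gt3 True unfolding t
        by (simp add: field_simps)
      finally show ?thesis .
    next
      case False
      then show ?thesis using le True by simp
    qed
  next
    case False
    then have k: "k \<le> Suc K" and t: "t \<le> mid_time k + (pi + 2) / 2" using Suc.prems by auto
    have "mid_time k \<le> mid_time (Suc K)"
      using k by (rule mid_time_mono)
    then show ?thesis using Suc k t by simp
  qed
qed

lemma snake_covered:
  assumes "snake_start \<le> t" "t \<le> snake_end K"
  obtains k \<tau> where "1 \<le> k" "k \<le> Suc K" "\<bar>\<tau>\<bar> \<le> 1 + pi" "t = mid_time k + \<tau>"
    "snake \<eta> K t = chart \<eta> k t"
    "k = 1 \<or> - (pi + 2) / 2 \<le> \<tau>" "k = Suc K \<or> \<tau> \<le> (pi + 2) / 2"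
proof -
  define k where "k = (LEAST k. 1 \<le> k \<and> (k = Suc K \<or> t \<le> mid_time k + (pi + 2) / 2))"
  have ex: "1 \<le> Suc K \<and> (Suc K = Suc K \<or> t \<le> mid_time (Suc K) + (pi + 2) / 2)" by simp
  have k: "1 \<le> k" "k = Suc K \<or> t \<le> mid_time k + (pi + 2) / 2"
    using LeastI[of "\<lambda>k. 1 \<le> k \<and> (k = Suc K \<or> t \<le> mid_time k + (pi + 2) / 2)", OF ex]
    unfolding k_def by blast+
  have kK: "k \<le> Suc K" unfolding k_def using ex by (rule Least_le)
  have low: "k = 1 \<or> mid_time k - (pi + 2) / 2 \<le> t"
  proof (rule disjCI)
    assume "\<not> mid_time k - (pi + 2) / 2 \<le> t"
    show "k = 1"
    proof (rule ccontr)
      assume "k \<noteq> 1"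
      then obtain j where j: "k = Suc j" "1 \<le> j" using k by (cases k) auto
      have "t \<le> mid_time j + (pi + 2) / 2"
        using \<open>\<not> mid_time k - (pi + 2) / 2 \<le> t\<close> unfolding j mid_time_Suc
            by (simp add: field_simps)
      then have "k \<le> j" unfolding k_def using j by (intro Least_le) auto
      then show False using j by simp
    qed
  qed
  have lo: "\<bar>t - mid_time k\<bar> \<le> 1 + pi"
  proof -
    have "- (1 + pi) \<le> t - mid_time k" using low assms pi_gt3
        by (auto simp: snake_start_def field_simps)
    moreover have "t - mid_time k \<le> 1 + pi" using k assms pi_gt3
        by (auto simp: snake_end_def field_simps)
    ultimately show ?thesis by simp
  qed
  show thesis
    by (rule that[of k "t - mid_time k"])
       (use k kK low lo snake_eq_chart[of k K t] in \<open>auto simp: field_simps\<close>)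
qed

lemma chart_inj: "inj_on (chart \<eta> k) {mid_time k - 1 - pi..mid_time k + 1 + pi}"
proof (rule inj_onI)
  fix x y assume *: "x \<in> {mid_time k - 1 - pi..mid_time k + 1 + pi}"
    "y \<in> {mid_time k - 1 - pi..mid_time k + 1 + pi}" "chart \<eta> k x = chart \<eta> k y"
  then have "s_curve \<eta> (x - mid_time k) = s_curve \<eta> (y - mid_time k)"
    by (auto simp: chart_def mirror_def split: if_splits)
  then have "x - mid_time k = y - mid_time k"
    by (rule inj_onD[OF s_curve_inj]) (use * in auto)
  then show "x = y" by simp
qed

text \<open>The semicircle shared by two charts has its middle at odd height; the part of the curve
before it stays below, the part after it stays above.\<close>

lemma snake_inj: "inj_on (snake \<eta> K) {snake_start..snake_end K}"
proof (induction K)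
  case 0
  have "snake \<eta> 0 = chart \<eta> 1" by (simp add: fun_eq_iff)
  then show ?case
    using chart_inj[of 1] by (simp add: snake_start_def snake_end_def)
next
  case (Suc K)
  let ?m = "mid_time (Suc K) + (pi + 2) / 2"
  have below: "Im (snake \<eta> K t) \<le> 2 * real K + 3" if "snake_start \<le> t" "t \<le> ?m" for t
  proof -
    have "t \<le> snake_end K" using that pi_gt3 by (auto simp: snake_end_def field_simps)
    obtain k \<tau> where k: "1 \<le> k" "k \<le> Suc K" "\<bar>\<tau>\<bar> \<le> 1 + pi" "t = mid_time k + \<tau>"
      "snake \<eta> K t = chart \<eta> k t" "k = 1 \<or> - (pi + 2) / 2 \<le> \<tau>" "k = Suc K \<or> \<tau> \<le> (pi + 2) / 2"
      by (rule snake_covered[OF \<open>snake_start \<le> t\<close> \<open>t \<le> snake_end K\<close>])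
    have \<tau>: "\<tau> \<le> (pi + 2) / 2" using k that by auto
    have "rise \<eta> (\<tau> - 1) \<le> 1"
    proof (cases "0 \<le> \<tau> - 1")
      case True
      then show ?thesis
        using rise_strict[of "\<tau> - 1" "pi / 2"] \<tau> pi_gt3 rise_pi_half
        by (cases "\<tau> - 1 < pi / 2") (auto dest: antisym simp: not_less add_divide_distrib)
    qed (simp add: rise_nonpos)
    then have "Im (snake \<eta> K t) \<le> 2 * real k + 1"
      using rise_nonneg[of "- \<tau> - 1"] k by (simp add: chart_centre Im_s_curve)
    also have "\<dots> \<le> 2 * real K + 3" using k(2) by simp
    finally show ?thesis .
  qed
  have above: "2 * real K + 3 < Im (chart \<eta> (K + 2) t)" if "?m < t" "t \<le> snake_end (Suc K)" for t
  proof -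
    define \<tau> where "\<tau> = t - mid_time (K + 2)"
    have \<tau>: "- \<tau> - 1 < pi / 2" using that by (simp add: \<tau>_def mid_time_Suc field_simps)
    have "rise \<eta> (- \<tau> - 1) < 1"
      using rise_strict[of "- \<tau> - 1" "pi / 2"] \<tau> pi_gt3 rise_pi_half
      by (cases "0 \<le> - \<tau> - 1") (auto simp: rise_nonpos)
    then show ?thesis
      using rise_nonneg[of "\<tau> - 1"] chart_centre[of "K + 2" \<tau>] by (simp add: \<tau>_def Im_s_curve)
  qed
  show ?case
  proof (rule inj_onI)
    fix x y assume xy: "x \<in> {snake_start..snake_end (Suc K)}" "y \<in> {snake_start..snake_end (Suc K)}"
      "snake \<eta> (Suc K) x = snake \<eta> (Suc K) y"
    have mK: "?m \<le> snake_end K" using pi_gt3 by (simp add: snake_end_def field_simps)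
    consider "x \<le> ?m" "y \<le> ?m" | "x \<le> ?m" "y > ?m" | "x > ?m" "y \<le> ?m" | "x > ?m" "y > ?m"
      by linarith
    then show "x = y"
    proof cases
      case 1
      then show ?thesis using xy mK by (intro inj_onD[OF Suc.IH]) auto
    next
      case 2
      then show ?thesis using xy below[of x] above[of y] by auto
    next
      case 3
      then show ?thesis using xy below[of y] above[of x] by auto
    next
      case 4
      then have "chart \<eta> (K + 2) x = chart \<eta> (K + 2) y" using xy by simp
      then show ?thesis
        by (rule inj_onD[OF chart_inj])
           (use 4 xy pi_gt3 in \<open>auto simp: snake_end_def mid_time_Suc field_simps\<close>)
    qed
  qed
qed

lemma chart_after: "\<eta> \<le> u \<Longrightarrow> chart \<eta> k (mid_time k + (1 + u)) = arc k u"
  by (simp only: chart_centre s_curve_arc) (simp add: mirror_def arc_def side_def complex_eq_iff)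

lemma chart_before: "\<eta> \<le> u \<Longrightarrow> chart \<eta> (Suc i) (mid_time (Suc i) - (1 + u)) = arc i (pi - u)"
proof -
  assume u: "\<eta> \<le> u"
  have "s_curve \<eta> (- (1 + u)) = Complex (1 + sin u) (cos u - 1)"
    unfolding s_curve_minus s_curve_arc[OF u] by (simp add: complex_eq_iff)
  then show ?thesis
    using chart_centre[of "Suc i" "- (1 + u)"] unfolding add_uminus_conv_diff
    by (simp only:) (simp add: mirror_def arc_def side_def complex_eq_iff)
qed

lemma arc_in_trace:
  assumes "i \<le> Suc K" "0 \<le> u" "u \<le> pi" "i = 0 \<or> \<eta> \<le> u" "i = Suc K \<or> u \<le> pi - \<eta>"
  shows "arc i u \<in> trace \<eta> K"
proof -
  have mono: "mid_time 1 \<le> mid_time k" "mid_time k \<le> mid_time (Suc K)" if "1 \<le> k"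
      "k \<le> Suc K" for k
    using that by (auto intro!: mid_time_mono)
  consider "1 \<le> i" "i = Suc K \<or> u \<le> pi / 2" | "i \<le> K" "i = 0 \<or> pi / 2 \<le> u"
    using assms by linarith
  then show ?thesis
  proof cases
    case 1
    define t where "t = mid_time i + (1 + u)"
    have "snake \<eta> K t = chart \<eta> i t"
      using 1 assms pi_gt3 by (intro snake_eq_chart) (auto simp: t_def field_simps)
    moreover have "chart \<eta> i t = arc i u"
      unfolding t_def using 1 assms by (intro chart_after) auto
    moreover have "t \<in> {snake_start..snake_end K}"
      using mono[of i] 1 assms pi_gt3 by (auto simp: t_def snake_start_def snake_end_def)
    ultimately show ?thesis unfolding trace_def by (metis image_eqI)
  next
    case 2
    define t where "t = mid_time (Suc i) - (1 + (pi - u))"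
    have "snake \<eta> K t = chart \<eta> (Suc i) t"
      using 2 assms pi_gt3 by (intro snake_eq_chart) (auto simp: t_def field_simps)
    moreover have "chart \<eta> (Suc i) t = arc i u"
      using chart_before[of "pi - u" i] 2 assms unfolding t_def by auto
    moreover have "t \<in> {snake_start..snake_end K}"
      using mono[of "Suc i"] 2 assms pi_gt3 by (auto simp: t_def snake_start_def snake_end_def)
    ultimately show ?thesis unfolding trace_def by (metis image_eqI)
  qed
qed

lemma trace_on_chart:
  assumes "w \<in> trace \<eta> K"
  obtains k \<tau> where "1 \<le> k" "k \<le> Suc K" "\<bar>\<tau>\<bar> \<le> 1 + pi" "w = chart \<eta> k (mid_time k + \<tau>)"
proof -
  obtain t where t: "snake_start \<le> t" "t \<le> snake_end K" and w: "w = snake \<eta> K t"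
    using assms by (auto simp: trace_def)
  obtain k \<tau> where k: "1 \<le> k" "k \<le> Suc K" "\<bar>\<tau>\<bar> \<le> 1 + pi" "t = mid_time k + \<tau>"
    "snake \<eta> K t = chart \<eta> k t" "k = 1 \<or> - (pi + 2) / 2 \<le> \<tau>" "k = Suc K \<or> \<tau> \<le> (pi + 2) / 2"
    by (rule snake_covered[OF t])
  show thesis by (rule that[OF k(1-3)]) (use w k(4,5) in simp)
qed

text \<open>The three kinds of points: on a segment, in a smoothed part, where the curve lies between
a unit circle and its tangent line and is therefore as close to the junction as they are, or on
an original arc.\<close>

lemma trace_cases:
  assumes "w \<in> trace \<eta> K"
  obtains k x where "1 \<le> k" "k \<le> Suc K" "\<bar>x\<bar> \<le> 1" "w = Complex x (2 * real k)"
    | k where "1 \<le> k" "k \<le> Suc K"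
       "norm (w - Complex (side k) (2 * real k)) < \<eta> \<or> norm (w - Complex (- side k) (2 * real k))
           < \<eta>"
    | i u where "i \<le> Suc K" "0 \<le> u" "u \<le> pi" "w = arc i u"
proof -
  obtain k \<tau> where k: "1 \<le> k" "k \<le> Suc K" "\<bar>\<tau>\<bar> \<le> 1 + pi"
    and w: "w = chart \<eta> k (mid_time k + \<tau>)"
    by (rule trace_on_chart[OF assms])
  have near: "norm (s_curve \<eta> (1 + u) - (-1)) < \<eta>" if "0 < u" "u < \<eta>" for u
  proof -
    have e: "s_curve \<eta> (1 + u) - (-1) = (1 - cutoff \<eta> u) *\<^sub>R Complex (- u) 0
        + cutoff \<eta> u *\<^sub>R Complex (- sin u) (1 - cos u)"
      using that by (simp add: s_curve_right bend_def complex_eq_iff algebra_simps)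
    have "norm (Complex (- sin u) (1 - cos u)) \<le> u"
      using chord_le_arc[of u] that by (simp add: cmod_def)
    then have "norm (s_curve \<eta> (1 + u) - (-1)) \<le> (1 - cutoff \<eta> u) * u + cutoff \<eta> u * u"
      unfolding e using cutoff_bounds[of u] that
      by (intro norm_triangle_le add_mono) (auto simp: cmod_def[of "Complex (- u) 0"] intro!:
          mult_left_mono simp del: complex_scaleR)
    also have "\<dots> < \<eta>" using that by (simp add: algebra_simps)
    finally show ?thesis .
  qed
  have J: "w = Complex 0 (2 * real k) + mirror k (s_curve \<eta> \<tau>)"
    using w chart_centre by simp
  consider "\<bar>\<tau>\<bar> \<le> 1" | "1 < \<tau>" "\<tau> < 1 + \<eta>" | "\<tau> < -1" "- 1 - \<eta> < \<tau>" | "1 + \<eta> \<le> \<tau>" | "\<tau> \<le> - 1 - \<eta>"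
    by linarith
  then show thesis
  proof cases
    case 1
    then show ?thesis
      using that(1)[of k "if odd k then - \<tau> else \<tau>"] k J
          by (auto simp: s_curve_mid mirror_def complex_eq_iff)
  next
    case 2
    have "norm (w - Complex (side k) (2 * real k)) = norm (mirror k (s_curve \<eta> (1 + (\<tau> - 1)) -
        (-1)))"
      unfolding J by (rule arg_cong[of _ _ norm]) (simp add: mirror_def side_def complex_eq_iff)
    then show ?thesis using that(2)[of k] k near[of "\<tau> - 1"] 2 by simp
  next
    case 3
    have "norm (w - Complex (- side k) (2 * real k)) = norm (mirror k (s_curve \<eta> (1 + (- \<tau> - 1)) -
        (-1)))"
      using s_curve_minus[of "- \<tau>"]
      unfolding J norm_mirror by (subst norm_minus_cancel[symmetric], subst
          norm_mirror[of k, symmetric])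
        (rule arg_cong[of _ _ norm], simp add: mirror_def side_def complex_eq_iff)
    then show ?thesis using that(2)[of k] k near[of "- \<tau> - 1"] 3 by simp
  next
    case 4
    then have "0 \<le> \<tau> - 1" "\<tau> - 1 \<le> pi" "w = arc k (\<tau> - 1)"
      using \<eta> k(3) chart_after[of "\<tau> - 1" k] w by auto
    then show ?thesis by (rule that(3)[OF k(2)])
  next
    case 5
    obtain i where i: "k = Suc i" using k by (cases k) auto
    have "0 \<le> pi - (- \<tau> - 1)" "pi - (- \<tau> - 1) \<le> pi" "w = arc i (pi - (- \<tau> - 1))" "i \<le> Suc K"
      using 5 \<eta> k chart_before[of "- \<tau> - 1" i] w i by auto
    then show ?thesis using that(3) by blast
  qed
qed

lemma semicircles_eq_arcs: "semicircles (K + 2) = (\<Union>i\<le>Suc K. arc i ` {0..pi})"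
proof -
  have even: "right_semicircle (Complex 1 (1 + 4 * real l)) = arc (2 * l) ` {0..pi}" for l
  proof (intro equalityI subsetI)
    fix w assume "w \<in> right_semicircle (Complex 1 (1 + 4 * real l))"
    then have n: "norm (w - Complex 1 (1 + 4 * real l)) = 1" and r: "1 \<le> Re w"
      by (auto simp: right_semicircle_def dist_norm norm_minus_commute)
    have "(1 + 4 * real l - Im w)\<^sup>2 + (Re w - 1)\<^sup>2 = 1"
      using n by (simp add: cmod_def power2_commute add.commute)
    then obtain u where "0 \<le> u" "u \<le> pi" "1 + 4 * real l - Im w = cos u" "Re w - 1 = sin u"
      using sincos_total_pi[of "Re w - 1" "1 + 4 * real l - Im w"] r by auto
    then show "w \<in> arc (2 * l) ` {0..pi}"
      by (intro image_eqI[of _ _ u]) (auto simp: arc_def side_def complex_eq_iff)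
  qed (auto simp: right_semicircle_def arc_def side_def dist_norm cmod_def sin_ge_zero)
  have odd: "left_semicircle (Complex (-1) (3 + 4 * real l)) = arc (2 * l + 1) ` {0..pi}" for l
  proof (intro equalityI subsetI)
    fix w assume "w \<in> left_semicircle (Complex (-1) (3 + 4 * real l))"
    then have n: "norm (w - Complex (-1) (3 + 4 * real l)) = 1" and r: "Re w \<le> -1"
      by (auto simp: left_semicircle_def dist_norm norm_minus_commute)
    have "(3 + 4 * real l - Im w)\<^sup>2 + (- 1 - Re w)\<^sup>2 = 1"
      using n by (simp add: cmod_def power2_eq_square algebra_simps)
    then obtain u where "0 \<le> u" "u \<le> pi" "3 + 4 * real l - Im w = cos u" "- 1 - Re w = sin u"
      using sincos_total_pi[of "- 1 - Re w" "3 + 4 * real l - Im w"] r by auto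
    then show "w \<in> arc (2 * l + 1) ` {0..pi}"
      by (intro image_eqI[of _ _ u]) (auto simp: arc_def side_def complex_eq_iff)
  qed (auto simp: left_semicircle_def arc_def side_def dist_norm cmod_def sin_ge_zero)
  have idx: "{..Suc K} = (\<lambda>l. 2 * l) ` {0..(K + 2 - 1) div 2} \<union> (\<lambda>l. 2 * l + 1) ` {0..(K + 2 - 2)
      div 2}"
  proof (intro equalityI subsetI)
    fix i assume "i \<in> {..Suc K}"
    then show "i \<in> (\<lambda>l. 2 * l) ` {0..(K + 2 - 1) div 2} \<union> (\<lambda>l. 2 * l + 1) ` {0..(K + 2 - 2) div 2}"
      by (cases "even i") (auto elim!: evenE oddE)
  qed auto
  show ?thesis
    unfolding semicircles_def even odd idx by simp
qed

lemma segments_subset_trace: "segments (K + 2) \<subseteq> trace \<eta> K"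
proof
  fix w assume "w \<in> segments (K + 2)"
  then obtain k where k: "1 \<le> k" "k \<le> Suc K"
    and w: "w \<in> closed_segment (Complex (-1) (2 * real k)) (Complex 1 (2 * real k))"
    by (auto simp: segments_def)
  obtain u where u: "0 \<le> u" "u \<le> 1" "w = (1 - u) *\<^sub>R Complex (-1) (2 * real k) + u *\<^sub>R Complex 1
      (2 * real k)"
    using w by (auto simp: closed_segment_def)
  define x where "x = 2 * u - 1"
  have x: "\<bar>x\<bar> \<le> 1" and wx: "w = Complex x (2 * real k)"
    using u by (auto simp: x_def complex_eq_iff algebra_simps)
  define \<tau> where "\<tau> = (if odd k then - x else x)"
  have \<tau>: "\<bar>\<tau>\<bar> \<le> 1" using x by (simp add: \<tau>_def)
  have mono: "mid_time 1 \<le> mid_time k" "mid_time k \<le> mid_time (Suc K)"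
    using k by (auto intro!: mid_time_mono)
  have "snake \<eta> K (mid_time k + \<tau>) = chart \<eta> k (mid_time k + \<tau>)"
    using k \<tau> pi_gt3 by (intro snake_eq_chart) (auto simp: field_simps)
  also have "\<dots> = w"
    unfolding chart_centre s_curve_mid[OF \<tau>] wx by (simp add: mirror_def \<tau>_def complex_eq_iff)
  finally show "w \<in> trace \<eta> K"
    unfolding trace_def using mono \<tau> pi_gt3
    by (intro image_eqI[of _ _ "mid_time k + \<tau>"]) (auto simp: snake_start_def snake_end_def)
qed

lemma arc_near_junction:
  assumes "0 \<le> u" "u < \<eta>"
  shows "norm (arc i u - Complex (side i) (2 * real i)) < \<eta>"
    "norm (arc i (pi - u) - Complex (side i) (2 * real (Suc i))) < \<eta>"
proof -
  have *: "sqrt ((sin u)\<^sup>2 + (1 - cos u)\<^sup>2) \<le> u" using chord_le_arc assms by blast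
  show "norm (arc i u - Complex (side i) (2 * real i)) < \<eta>"
    using * assms by (simp add: arc_def side_def cmod_def)
  have "(cos u - 1)\<^sup>2 = (1 - cos u)\<^sup>2" by (rule power2_commute)
  then show "norm (arc i (pi - u) - Complex (side i) (2 * real (Suc i))) < \<eta>"
    using * assms by (simp add: arc_def side_def cmod_def algebra_simps)
qed

lemma trace_alters_arcs:
  assumes "\<eta> \<le> \<eta>'"
  shows "alters_arcs_near_junctions (K + 2) \<eta>' (trace \<eta> K)"
proof -
  let ?B = "\<lambda>r. \<Union>p\<in>junctions (K + 2). ball p r"
  have junction: "Complex s (2 * real k) \<in> junctions (K + 2)" if "1 \<le> k" "k \<le> Suc K"
      "s = 1 \<or> s = -1" for k s
    using that by (auto simp: junctions_def)
  have seg: "Complex x (2 * real k) \<in> segments (K + 2)" if "1 \<le> k" "k \<le> Suc K" "\<bar>x\<bar> \<le> 1" for k x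
  proof -
    have "Complex x (2 * real k) \<in> closed_segment (Complex (-1) (2 * real k)) (Complex 1 (2 * real
        k))"
      unfolding closed_segment_def using that
      by (intro CollectI exI[of _ "(x + 1) / 2"]) (auto simp: complex_eq_iff field_simps)
    then show ?thesis using that by (auto simp: segments_def)
  qed
  have eq: "trace \<eta> K - ?B \<eta> = (segments (K + 2) \<union> semicircles (K + 2)) - ?B \<eta>"
  proof (intro equalityI subsetI)
    fix w assume w: "w \<in> trace \<eta> K - ?B \<eta>"
    then have "w \<in> trace \<eta> K" by simp
    then show "w \<in> (segments (K + 2) \<union> semicircles (K + 2)) - ?B \<eta>"
    proof (cases rule: trace_cases)
      case (1 k x)
      then show ?thesis using seg w by auto
    next
      case (2 k)
      then have "w \<in> ?B \<eta>"
        using junction[of k "side k"] junction[of k "- side k"]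
        by (auto simp: side_def dist_norm norm_minus_commute)
      then show ?thesis using w by simp
    next
      case (3 i u)
      then have "w \<in> semicircles (K + 2)" unfolding semicircles_eq_arcs
          by (auto intro!: bexI[of _ i])
      then show ?thesis using w by simp
    qed
  next
    fix w assume w: "w \<in> (segments (K + 2) \<union> semicircles (K + 2)) - ?B \<eta>"
    show "w \<in> trace \<eta> K - ?B \<eta>"
    proof (cases "w \<in> segments (K + 2)")
      case True
      then show ?thesis using segments_subset_trace w by auto
    next
      case False
      then obtain i u where iu: "i \<le> Suc K" "0 \<le> u" "u \<le> pi" "w = arc i u"
        using w unfolding semicircles_eq_arcs by auto
      have side: "side i = 1 \<or> side i = -1" by (simp add: side_def)
      have "i = 0 \<or> \<eta> \<le> u"
      proof (rule ccontr)
        assume "\<not> ?thesis"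
        then have "w \<in> ?B \<eta>"
          using junction[of i, OF _ _ side] arc_near_junction(1)[of u i] iu
          by (intro UN_I[of "Complex (side i) (2 * real i)"]) (auto simp: dist_norm
              norm_minus_commute)
        then show False using w by simp
      qed
      moreover have "i = Suc K \<or> u \<le> pi - \<eta>"
      proof (rule ccontr)
        assume "\<not> ?thesis"
        then have "w \<in> ?B \<eta>"
          using junction[of "Suc i", OF _ _ side] arc_near_junction(2)[of "pi - u" i] iu
          by (intro UN_I[of "Complex (side i) (2 * real (Suc i))"])
             (auto simp: dist_norm norm_minus_commute simp del: of_nat_Suc)
        then show False using w by simp
      qed
      ultimately show ?thesis using arc_in_trace iu w by auto
    qed
  qed
  have sub: "?B \<eta> \<subseteq> ?B \<eta>'" using assms by (intro UN_mono) auto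
  have "X - B' = Y - B'" if "X - B = Y - B" "B \<subseteq> B'" for X Y B B' :: "complex set"
    using that by blast
  from this[OF eq sub]
  show ?thesis
    unfolding alters_arcs_near_junctions_def using segments_subset_trace by (intro conjI)
qed

lemma trace_inner_height:
  assumes "w \<in> trace \<eta> K" "\<bar>Re w\<bar> < 1"
  shows "\<exists>k\<in>{1..Suc K}. Im w = 2 * real k"
proof -
  obtain k \<tau> where k: "1 \<le> k" "k \<le> Suc K" "\<bar>\<tau>\<bar> \<le> 1 + pi"
    and w: "w = chart \<eta> k (mid_time k + \<tau>)"
    by (rule trace_on_chart[OF assms(1)])
  have J: "w = Complex 0 (2 * real k) + mirror k (s_curve \<eta> \<tau>)"
    using w chart_centre by simp
  have "\<bar>Re (s_curve \<eta> \<tau>)\<bar> < 1" using assms unfolding J by (simp add: Re_mirror split: if_splits)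
  then have "Im (s_curve \<eta> \<tau>) = 0"
    by - (rule s_curve_cases[OF k(3)]; simp)
  then show ?thesis using k unfolding J by auto
qed

text \<open>On either side of the imaginary axis only the semicircles of one parity occur; the gaps
between them separate the pieces of the tube that carry the different local maxima.\<close>

lemma trace_side_height:
  assumes "w \<in> trace \<eta> K" "- 1 < side i * Re w"
  shows "\<exists>j. side j = side i \<and> \<bar>Im w - (2 * real j + 1)\<bar> \<le> 1"
proof -
  obtain k \<tau> where k: "1 \<le> k" "k \<le> Suc K" "\<bar>\<tau>\<bar> \<le> 1 + pi"
    and w: "w = chart \<eta> k (mid_time k + \<tau>)"
    by (rule trace_on_chart[OF assms(1)])
  have J: "w = Complex 0 (2 * real k) + mirror k (s_curve \<eta> \<tau>)"
    using w chart_centre by simp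
  obtain i' where i': "k = Suc i'" using k by (cases k) auto
  have R: "Re w = - side k * Re (s_curve \<eta> \<tau>)" unfolding J by (simp add: Re_mirror side_def)
  have I: "Im w = 2 * real k + Im (s_curve \<eta> \<tau>)" unfolding J by simp
  show ?thesis
  proof (cases "side i = side k")
    case True
    then have "Re (s_curve \<eta> \<tau>) < 1" using assms(2) unfolding R
        by (simp add: side_def split: if_splits)
    then have "0 \<le> Im (s_curve \<eta> \<tau>) \<and> Im (s_curve \<eta> \<tau>) \<le> 2"
      by - (rule s_curve_cases[OF k(3)]; simp)
    then show ?thesis using True I by (intro exI[of _ k]) auto
  next
    case False
    then have "- 1 < Re (s_curve \<eta> \<tau>)" using assms(2) unfolding R
        by (simp add: side_def split: if_splits)
    then have "Im (s_curve \<eta> \<tau>) \<le> 0 \<and> - 2 \<le> Im (s_curve \<eta> \<tau>)"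
      by - (rule s_curve_cases[OF k(3)]; simp)
    then show ?thesis using False I i' by (intro exI[of _ i']) (auto simp: side_def split:
        if_splits)
  qed
qed

lemma tip_arc_in_trace:
  assumes "i \<le> Suc K" "\<bar>\<theta>\<bar> \<le> 1 / 2"
  shows "Complex (side i) (2 * real i + 1) + side i *\<^sub>R cis \<theta> \<in> trace \<eta> K"
proof -
  have "Complex (side i) (2 * real i + 1) + side i *\<^sub>R cis \<theta> = arc i (pi / 2 + side i * \<theta>)"
    by (auto simp: arc_def side_def complex_eq_iff sin_add cos_add sin_diff cos_diff)
  moreover have "\<bar>side i * \<theta>\<bar> \<le> 1 / 2" using assms by (simp add: side_def)
  ultimately show ?thesis
    using assms(1) \<eta> pi_gt3 unfolding abs_le_iff
    by (simp only:) (intro arc_in_trace; linarith)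
qed

text \<open>The only danger is the smoothed part, and there the derivative of the height, \<open>c' (1 - cos
u) + c sin u\<close> with a nondecreasing cutoff \<open>c\<close>, is positive.\<close>

lemma s_curve_speed:
  assumes e1: "\<And>t. (s_curve \<eta> has_vector_derivative e1 t) (at t)"
  obtains m where "m > 0" "\<And>t. m \<le> norm (e1 t)"
proof -
  have Ck: "Ck_on 2 UNIV e1"
    using Ck_on_deriv[of 2 "s_curve \<eta>" e1] Ck_on_s_curve[of \<eta>] e1 by (simp add: eval_nat_numeral)
  then have cont: "continuous_on UNIV e1" by (rule Ck_on_imp_continuous_on)
  have even: "e1 (- t) = e1 t" for t
  proof -
    have "((\<lambda>t. - s_curve \<eta> (- t)) has_vector_derivative e1 (- t)) (at t)"
    proof -
      have "((\<lambda>t. - t) has_vector_derivative -1) (at t)"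
        by (auto intro!: derivative_eq_intros)
      from vector_diff_chain_at[OF this e1[of "- t"]]
      have "((\<lambda>t. s_curve \<eta> (- t)) has_vector_derivative - e1 (- t)) (at t)" by (simp add: o_def)
      from has_vector_derivative_minus[OF this] show ?thesis by simp
    qed
    then have "(s_curve \<eta> has_vector_derivative e1 (- t)) (at t)" by (simp add: s_curve_minus)
    then show ?thesis using e1 vector_derivative_unique_at by blast
  qed
  have mid: "e1 t = -1" if "\<bar>t\<bar> < 1" for t
  proof -
    have "((\<lambda>t. of_real (- t)) has_vector_derivative (-1::complex)) (at t)"
      by (auto intro!: derivative_eq_intros simp: has_vector_derivative_def scaleR_conv_of_real)
    then have "(s_curve \<eta> has_vector_derivative -1) (at t)"
      by (rule has_vector_derivative_transform_within_open[of _ _ _ "{-1<..<1}"])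
         (use that in \<open>auto simp: s_curve_mid abs_less_iff\<close>)
    then show ?thesis using e1 vector_derivative_unique_at by blast
  qed
  have far: "norm (e1 (1 + u)) = 1" if "\<eta> < u" for u
  proof -
    have "((\<lambda>t. Complex (- 1 - sin (t - 1)) (1 - cos (t - 1))) has_vector_derivative
        Complex (- cos u) (sin u)) (at (1 + u))"
      by (auto simp: has_vector_derivative_complex_iff intro!: derivative_eq_intros)
    then have "(s_curve \<eta> has_vector_derivative Complex (- cos u) (sin u)) (at (1 + u))"
      by (rule has_vector_derivative_transform_within_open[of _ _ _ "{1 + \<eta><..}"])
         (use that s_curve_arc[of "_ - 1"] in auto)
    then have "e1 (1 + u) = Complex (- cos u) (sin u)" using e1 vector_derivative_unique_at by blast
    then show ?thesis by (simp add: cmod_def)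
  qed
  obtain c' where c': "\<And>u. (cutoff \<eta> has_real_derivative c' u) (at u)"
    using Ck_on_cutoff[of \<eta>]
        by (auto simp: eval_nat_numeral has_real_derivative_iff_has_vector_derivative)
  have c'0: "0 \<le> c' u" for u
  proof (rule ccontr)
    assume "\<not> 0 \<le> c' u"
    then obtain d where "0 < d" "\<And>h. 0 < h \<Longrightarrow> h < d \<Longrightarrow> cutoff \<eta> (u + h) < cutoff \<eta> u"
      using DERIV_neg_dec_right[OF c'[of u]] by auto
    then have "cutoff \<eta> (u + d / 2) < cutoff \<eta> u" by simp
    then show False using cutoff_mono[of u "u + d / 2"] \<open>0 < d\<close> by simp
  qed
  have near: "e1 (1 + u) \<noteq> 0" if "0 \<le> u" "u \<le> \<eta>" for u
  proof (cases "u = 0")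
    case True
    have "continuous_on (closure {-1<..<1}) e1"
      using cont continuous_on_subset by blast
    then have "e1 1 = -1"
      by (rule continuous_constant_on_closure) (use mid in \<open>auto simp: abs_less_iff\<close>)
    then show ?thesis using True by simp
  next
    case False
    have "((\<lambda>t. Im (s_curve \<eta> t)) has_real_derivative Im (e1 (1 + u))) (at (1 + u))"
      using e1[of "1 + u"] by (simp add: has_vector_derivative_complex_iff)
    moreover have "((\<lambda>t. Im (s_curve \<eta> t)) has_real_derivative
        c' u * (1 - cos u) + cutoff \<eta> u * sin u) (at (1 + u))"
    proof -
      have "((\<lambda>t. cutoff \<eta> (t - 1)) has_real_derivative c' u) (at (1 + u))"
        using DERIV_shift[of "cutoff \<eta>" "c' u" "1 + u" "-1"] c'[of u] by simp
      then have "((\<lambda>t. cutoff \<eta> (t - 1) * (1 - cos (t - 1))) has_real_derivative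
          c' u * (1 - cos u) + cutoff \<eta> u * sin u) (at (1 + u))"
        by (auto intro!: derivative_eq_intros)
      then show ?thesis
        by (rule has_field_derivative_transform_within_open[of _ _ _ "{-1<..}"])
           (use that in \<open>auto simp: s_curve_right Im_bend rise_def\<close>)
    qed
    ultimately have "Im (e1 (1 + u)) = c' u * (1 - cos u) + cutoff \<eta> u * sin u"
      by (rule DERIV_unique)
    moreover have "0 < cutoff \<eta> u * sin u"
      using False that \<eta> pi_gt3 by (intro mult_pos_pos cutoff_pos sin_gt_zero) auto
    moreover have "0 \<le> c' u * (1 - cos u)" using c'0 by simp
    ultimately show ?thesis by auto
  qed
  have "continuous_on {0..\<eta>} (\<lambda>u. norm (e1 (1 + u)))"
    by (intro continuous_intros continuous_on_compose2[OF cont]) auto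
  then obtain u0 where u0: "u0 \<in> {0..\<eta>}" "\<And>u. u \<in> {0..\<eta>} \<Longrightarrow> norm (e1 (1 + u0)) \<le> norm (e1 (1 + u))"
    using continuous_attains_inf[of "{0..\<eta>}" "\<lambda>u. norm (e1 (1 + u))"] \<eta> by auto
  define m where "m = min 1 (norm (e1 (1 + u0)))"
  have half: "m \<le> norm (e1 t)" if t: "0 \<le> t" for t
  proof -
    consider "\<bar>t\<bar> < 1" | "1 \<le> t" "t \<le> 1 + \<eta>" | "1 + \<eta> < t" using t by linarith
    then show ?thesis
    proof cases
      case 1 then show ?thesis by (simp add: mid m_def)
    next
      case 2 then show ?thesis using u0(2)[of "t - 1"] by (simp add: m_def)
    next
      case 3 then show ?thesis using far[of "t - 1"] by (simp add: m_def)
    qed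
  qed
  show thesis
  proof (rule that)
    show "0 < m" using near u0(1) by (simp add: m_def)
    show "m \<le> norm (e1 t)" for t
      using half[of t] half[of "- t"] even[of t] by (cases "0 \<le> t") auto
  qed
qed

lemma snake_speed:
  obtains f1 m where "\<And>t. (snake \<eta> K has_vector_derivative f1 t) (at t)" "m > 0"
      "\<And>t. m \<le> norm (f1 t)"
proof -
  obtain e1 where e1: "\<And>t. (s_curve \<eta> has_vector_derivative e1 t) (at t)"
    using Ck_on_s_curve[of \<eta>] by (auto simp: eval_nat_numeral)
  obtain m where m: "m > 0" "\<And>t. m \<le> norm (e1 t)" by (rule s_curve_speed[of e1, OF e1]) (rule that)
  have chart: "(chart \<eta> k has_vector_derivative mirror k (e1 (t - mid_time k))) (at t)" for k t
  proof -
    have "((\<lambda>t. t - mid_time k) has_vector_derivative 1) (at t)"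
      using has_vector_derivative_diff[OF has_vector_derivative_id
          has_vector_derivative_const[of "mid_time k"]]
      by simp
    from vector_diff_chain_at[OF this e1]
    have "((\<lambda>t. s_curve \<eta> (t - mid_time k)) has_vector_derivative e1 (t - mid_time k)) (at t)"
      by (simp add: o_def)
    from has_vector_derivative_add[OF has_vector_derivative_const[of "Complex 0 (2 * real k)"]
        bounded_linear.has_vector_derivative[OF bounded_linear_mirror this]]
    show ?thesis unfolding chart_def[abs_def] by simp
  qed
  have "\<exists>D. (snake \<eta> K has_vector_derivative D) (at t) \<and> m \<le> norm D" for t
  proof (induction K)
    case 0
    have "snake \<eta> 0 = chart \<eta> 1" by (simp add: fun_eq_iff)
    then show ?case using chart[of 1 t] m(2)[of "t - mid_time 1"]
      by (intro exI[of _ "mirror 1 (e1 (t - mid_time 1))"]) simp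
  next
    case (Suc K)
    let ?c = "mid_time (Suc K) + (pi + 2) / 2"
    have same: "snake \<eta> (Suc K) s = snake \<eta> K s" if "s < ?c + 1" for s
    proof (cases "s \<le> ?c")
      case False
      then have "\<bar>s - ?c\<bar> < 1" using that by simp
      from snake_overlap[OF this] show ?thesis using False by simp
    qed simp
    show ?case
    proof (cases "t < ?c + 1")
      case True
      obtain D where D: "(snake \<eta> K has_vector_derivative D) (at t)" "m \<le> norm D"
        using Suc.IH by (elim exE conjE)
      have "(snake \<eta> (Suc K) has_vector_derivative D) (at t)"
        by (rule has_vector_derivative_transform_within_open[OF D(1), of "{..<?c + 1}"])
           (use True same in auto)
      then show ?thesis using D(2) by (intro exI conjI)
    next
      case False
      have "(snake \<eta> (Suc K) has_vector_derivative mirror (K + 2) (e1 (t - mid_time (K + 2))))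
          (at t)"
        by (rule has_vector_derivative_transform_within_open[OF chart, of "{?c<..}"])
           (use False in auto)
      moreover have "m \<le> norm (mirror (K + 2) (e1 (t - mid_time (K + 2))))"
        using m(2)[of "t - mid_time (K + 2)"] by simp
      ultimately show ?thesis by (intro exI conjI)
    qed
  qed
  then have "\<forall>t. \<exists>D. (snake \<eta> K has_vector_derivative D) (at t) \<and> m \<le> norm D"
    by blast
  from choice[OF this] obtain f1
    where f1: "\<forall>t. (snake \<eta> K has_vector_derivative f1 t) (at t) \<and> m \<le> norm (f1 t)" ..
  show thesis
  proof (rule that[of f1 m])
    show "(snake \<eta> K has_vector_derivative f1 t) (at t)" for t using f1
        by (rule allE) (rule conjunct1)
    show "m \<le> norm (f1 t)" for t using f1 by (rule allE) (rule conjunct2)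
  qed (rule m(1))
qed

end

section \<open>Geometry of thin tapered tubes\<close>

text \<open>Taylor's inequality with the linear term dropped, since it is assumed to point in the
right direction. At an interior minimum of \<open>f\<close> that term vanishes; at an end point of the
parameter interval it need not.\<close>

lemma quadratic_lower_bound:
  fixes f f1 f2 :: "real \<Rightarrow> real"
  assumes f: "\<And>x. (f has_real_derivative f1 x) (at x)"
    and f1: "\<And>x. (f1 has_real_derivative f2 x) (at x)"
    and c: "\<And>x. x \<in> closed_segment a b \<Longrightarrow> c \<le> f2 x"
    and init: "0 \<le> f1 a * (b - a)"
  shows "f a + c / 2 * (b - a)\<^sup>2 \<le> f b"
proof -
  define h where "h t = f (a + t * (b - a)) - c / 2 * (b - a)\<^sup>2 * t\<^sup>2" for t
  define h1 where "h1 t = f1 (a + t * (b - a)) * (b - a) - c * (b - a)\<^sup>2 * t" for t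
  have aff: "((\<lambda>t. a + t * (b - a)) has_real_derivative (b - a)) (at t)" for t
    by (auto intro!: derivative_eq_intros)
  have dh: "(h has_real_derivative h1 t) (at t)" for t
    unfolding h_def[abs_def] h1_def
    using DERIV_chain'[OF aff f] by (auto intro!: derivative_eq_intros simp: algebra_simps
        power2_eq_square)
  have dh1: "(h1 has_real_derivative f2 (a + t * (b - a)) * (b - a) * (b - a) - c * (b - a)\<^sup>2) (at
      t)" for t
    unfolding h1_def[abs_def]
    using DERIV_chain'[OF aff f1] by (auto intro!: derivative_eq_intros)
  have h1: "0 \<le> h1 t" if t: "0 \<le> t" "t \<le> 1" for t
  proof -
    have "h1 0 \<le> h1 t"
    proof (rule DERIV_nonneg_imp_nondecreasing[OF t(1)])
      fix x assume x: "0 \<le> x" "x \<le> t"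
      have "a + x * (b - a) \<in> closed_segment a b"
        using x t by (auto simp: closed_segment_def algebra_simps intro!: exI[of _ x])
      then have "c * (b - a)\<^sup>2 \<le> f2 (a + x * (b - a)) * (b - a)\<^sup>2"
        using c by (intro mult_right_mono) auto
      then show "\<exists>y. (h1 has_real_derivative y) (at x) \<and> 0 \<le> y"
        using dh1[of x] by (intro exI conjI) (auto simp: power2_eq_square algebra_simps)
    qed
    then show ?thesis using init by (simp add: h1_def)
  qed
  have "h 0 \<le> h 1"
    by (rule DERIV_nonneg_imp_nondecreasing) (use dh h1 in auto)
  then show ?thesis by (simp add: h_def)
qed

locale unit_speed_arc =
  fixes z z1 z2 :: "real \<Rightarrow> complex" and L :: real
  assumes L_pos: "0 < L"
    and z_deriv: "\<And>s. (z has_vector_derivative z1 s) (at s)"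
    and z1_deriv: "\<And>s. (z1 has_vector_derivative z2 s) (at s)"
    and z2_cont: "continuous_on UNIV z2"
    and unit_speed: "\<And>s. norm (z1 s) = 1"
    and inj: "inj_on z {0..L}"
begin

lemma z_cont: "continuous_on S z"
  by (meson continuous_at_imp_continuous_on has_vector_derivative_continuous z_deriv)

lemma z_lipschitz: "norm (z s - z t) \<le> \<bar>s - t\<bar>"
proof -
  have "norm (z s - z t) \<le> 1 * norm (s - t)"
  proof (rule differentiable_bound[of UNIV z "\<lambda>x h. h *\<^sub>R z1 x"])
    show "(z has_derivative (\<lambda>h. h *\<^sub>R z1 x)) (at x within UNIV)" for x
      using z_deriv[of x] by (simp add: has_vector_derivative_def)
    show "onorm (\<lambda>h. h *\<^sub>R z1 x) \<le> 1" for x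
      by (rule onorm_le) (simp add: unit_speed)
  qed auto
  then show ?thesis by simp
qed

lemma curvature_bound:
  obtains K where "0 \<le> K" "\<And>s. s \<in> {0..L} \<Longrightarrow> norm (z2 s) \<le> K"
proof -
  have "compact (z2 ` {0..L})"
    using z2_cont by (intro compact_continuous_image) (auto intro: continuous_on_subset)
  then obtain K where "\<forall>x\<in>z2 ` {0..L}. norm x \<le> K"
    using compact_imp_bounded bounded_iff by metis
  then show thesis by (intro that[of "max 0 K"]) (auto intro: le_max_iff_disj[THEN iffD2])
qed

lemma offset_deriv: "((\<lambda>s. w - z s) has_vector_derivative - z1 s) (at s)"
  using has_vector_derivative_diff[OF has_vector_derivative_const[of w] z_deriv[of s]] by simp

lemma inner_deriv:
  "((\<lambda>s. (w - z s) \<bullet> n) has_real_derivative - (z1 s \<bullet> n)) (at s)"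
  using bounded_linear.has_vector_derivative[OF bounded_linear_inner_left[of n] offset_deriv[of w s]]
  by (simp add: has_real_derivative_iff_has_vector_derivative)

lemma inner_z1_deriv:
  "((\<lambda>s. z1 s \<bullet> n) has_real_derivative z2 s \<bullet> n) (at s)"
  using bounded_linear.has_vector_derivative[OF bounded_linear_inner_left z1_deriv[of s], of n]
  by (simp add: has_real_derivative_iff_has_vector_derivative)

lemma square_dist_deriv:
  "((\<lambda>s. (norm (w - z s))\<^sup>2) has_real_derivative - 2 * ((w - z s) \<bullet> z1 s)) (at s)"
proof -
  from bounded_bilinear.has_vector_derivative[OF bounded_bilinear_inner offset_deriv[of w s] offset_deriv[of w s]]
  show ?thesis
    by (simp add: has_real_derivative_iff_has_vector_derivative power2_norm_eq_inner inner_commute)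
qed

lemma square_dist_deriv2:
  "((\<lambda>s. (w - z s) \<bullet> z1 s) has_real_derivative (w - z s) \<bullet> z2 s - 1) (at s)"
proof -
  have "z1 s \<bullet> z1 s = 1" using unit_speed[of s] by (simp add: norm_eq_1)
  with bounded_bilinear.has_vector_derivative[OF bounded_bilinear_inner offset_deriv[of w s] z1_deriv[of s]]
  show ?thesis
    by (simp add: has_real_derivative_iff_has_vector_derivative)
qed

text \<open>The first-order condition for the disc around \<open>z s\<close> to be, among all discs of the family,
the one that touches the boundary at its point in direction \<open>n\<close>: the envelope satisfies \<open>n \<bullet> z'
= - r' = \<delta>\<close>, and at the two ends, where a full cap of the disc is exposed, this becomes an
inequality.\<close>

definition contact :: "real \<Rightarrow> real \<Rightarrow> complex \<Rightarrow> bool" where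
  "contact \<delta> s n \<longleftrightarrow> norm n = 1 \<and> (s < L \<longrightarrow> n \<bullet> z1 s \<le> \<delta>) \<and> (0 < s \<longrightarrow> \<delta> \<le> n \<bullet> z1 s)"

text \<open>Injectivity made quantitative by compactness.\<close>

lemma separation:
  assumes "0 < \<sigma>"
  obtains m where "0 < m" "\<And>s t. s \<in> {0..L} \<Longrightarrow> t \<in> {0..L} \<Longrightarrow> \<sigma> \<le> \<bar>s - t\<bar> \<Longrightarrow> m \<le> norm (z s - z t)"
proof -
  define T where "T = {p \<in> {0..L} \<times> {0..L}. \<sigma> \<le> \<bar>fst p - snd p\<bar>}"
  have "compact T"
  proof -
    have "T = ({0..L} \<times> {0..L}) \<inter> {p. \<sigma> \<le> \<bar>fst p - snd p\<bar>}" by (auto simp: T_def)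
    moreover have "closed {p::real\<times>real. \<sigma> \<le> \<bar>fst p - snd p\<bar>}"
      by (intro closed_Collect_le continuous_intros)
    ultimately show ?thesis by (simp add: compact_Times compact_Int_closed)
  qed
  have cont: "continuous_on T (\<lambda>p. norm (z (fst p) - z (snd p)))"
    by (intro continuous_intros continuous_on_compose2[OF z_cont[of UNIV]]) auto
  show thesis
  proof (cases "T = {}")
    case True
    then show ?thesis by (intro that[of 1]) (auto simp: T_def)
  next
    case False
    have "\<exists>p\<in>T. \<forall>q\<in>T. norm (z (fst p) - z (snd p)) \<le> norm (z (fst q) - z (snd q))"
      by (rule continuous_attains_inf[OF \<open>compact T\<close> False cont])
    then obtain p where p: "p \<in> T" "\<forall>q\<in>T. norm (z (fst p) - z (snd p))
        \<le> norm (z (fst q) - z (snd q))"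
      by (rule bexE)
    show ?thesis
    proof (rule that)
      show "0 < norm (z (fst p) - z (snd p))"
      proof -
        have "fst p \<in> {0..L}" "snd p \<in> {0..L}" "fst p \<noteq> snd p"
          using p(1) assms by (auto simp: T_def)
        then have "z (fst p) \<noteq> z (snd p)" using inj_onD[OF inj] by blast
        then show ?thesis by simp
      qed
      show "norm (z (fst p) - z (snd p)) \<le> norm (z s - z t)"
        if "s \<in> {0..L}" "t \<in> {0..L}" "\<sigma> \<le> \<bar>s - t\<bar>" for s t
      proof -
        have "(s, t) \<in> T" using that by (simp add: T_def)
        from bspec[OF p(2) this] show ?thesis by simp
      qed
    qed
  qed
qed

end

text \<open>The last assumption says that a point of first-order contact lies outside all the other
discs, with a margin. Everything about the tube is derived from it.\<close>

locale thin_tube = unit_speed_arc +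
  fixes \<epsilon> \<delta> \<mu> :: real
  assumes delta: "0 < \<delta>" "\<delta> < 1" and taper: "\<delta> * L < \<epsilon>" and mu: "0 < \<mu>"
    and quad: "\<And>s0 n s. s0 \<in> {0..L} \<Longrightarrow> contact \<delta> s0 n \<Longrightarrow> s \<in> {0..L} \<Longrightarrow>
       (\<epsilon> - \<delta> * s)\<^sup>2 + \<mu> * (s - s0)\<^sup>2 \<le> (norm (z s0 + (\<epsilon> - \<delta> * s0) *\<^sub>R n - z s))\<^sup>2"

text \<open>Near the parameter of contact the second derivative of \<open>\<bar>w - z(s)\<bar>\<^sup>2 - r(s)\<^sup>2\<close> is close to
\<open>2 (1 - \<delta>\<^sup>2)\<close> as long as \<open>\<epsilon>\<close> is small compared with the radius of curvature, and function and
first derivative have the right sign at the contact. Away from it the curve has moved off by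
more than \<open>2 \<epsilon>\<close>.\<close>

lemma (in unit_speed_arc) thin_tube_exists:
  obtains \<epsilon>0 \<mu> where "0 < \<epsilon>0" "0 < \<mu>"
    "\<And>\<epsilon> \<delta>. \<epsilon> < \<epsilon>0 \<Longrightarrow> 0 < \<delta> \<Longrightarrow> \<delta> \<le> 1 / 2 \<Longrightarrow> \<delta> * L < \<epsilon> \<Longrightarrow> thin_tube z z1 z2 L \<epsilon> \<delta> \<mu>"
proof -
  obtain K where K: "0 \<le> K" "\<And>s. s \<in> {0..L} \<Longrightarrow> norm (z2 s) \<le> K"
    by (rule curvature_bound) (rule that)
  define \<sigma> where "\<sigma> = 1 / (8 * (K + 1))"
  have \<sigma>: "0 < \<sigma>" "2 * \<sigma> * K \<le> 1 / 4"
    using K(1) by (auto simp: \<sigma>_def field_simps)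
  obtain m where m: "0 < m" "\<And>s t. s \<in> {0..L} \<Longrightarrow> t \<in> {0..L} \<Longrightarrow> \<sigma> \<le> \<bar>s - t\<bar> \<Longrightarrow> m \<le> norm (z s - z t)"
    by (rule separation[OF \<sigma>(1)]) (rule that)
  define \<epsilon>0 where "\<epsilon>0 = min \<sigma> (m / 4)"
  define \<mu> where "\<mu> = min (1 / 2) (m\<^sup>2 / (2 * L\<^sup>2))"
  show thesis
  proof (rule that)
    show "0 < \<epsilon>0" "0 < \<mu>" using \<sigma> m L_pos by (auto simp: \<epsilon>0_def \<mu>_def)
    fix \<epsilon> \<delta> assume \<epsilon>: "\<epsilon> < \<epsilon>0" and \<delta>: "0 < \<delta>" "\<delta> \<le> 1 / 2" and taper: "\<delta> * L < \<epsilon>"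
    have quad: "(\<epsilon> - \<delta> * s)\<^sup>2 + \<mu> * (s - s0)\<^sup>2 \<le> (norm (z s0 + (\<epsilon> - \<delta> * s0) *\<^sub>R n - z s))\<^sup>2"
      if s0: "s0 \<in> {0..L}" and n: "contact \<delta> s0 n" and s: "s \<in> {0..L}" for s0 n s
    proof -
      define w where "w = z s0 + (\<epsilon> - \<delta> * s0) *\<^sub>R n"
      have bounds: "0 < \<epsilon> - \<delta> * t \<and> \<epsilon> - \<delta> * t \<le> \<epsilon>" if "t \<in> {0..L}" for t
      proof -
        have "\<delta> * t \<le> \<delta> * L" "0 \<le> \<delta> * t" using that \<delta> by auto
        then show ?thesis using taper by linarith
      qed
      note r0 = bounds[OF s0, THEN conjunct1] bounds[OF s0, THEN conjunct2]
      note rs = bounds[OF s, THEN conjunct1] bounds[OF s, THEN conjunct2]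
      have wz0: "norm (w - z s0) \<le> \<epsilon>"
        using n r0 by (simp add: w_def contact_def)
      show ?thesis
      proof (cases "\<bar>s - s0\<bar> \<le> \<sigma>")
        case True
        define f where "f s = (norm (w - z s))\<^sup>2 - (\<epsilon> - \<delta> * s)\<^sup>2" for s
        define f1 where "f1 s = - 2 * ((w - z s) \<bullet> z1 s) + 2 * \<delta> * (\<epsilon> - \<delta> * s)" for s
        define f2 where "f2 s = - 2 * ((w - z s) \<bullet> z2 s - 1) - 2 * \<delta>\<^sup>2" for s
        have "f s0 + 1 / 2 * (s - s0)\<^sup>2 \<le> f s"
        proof (rule quadratic_lower_bound)
          show "(f has_real_derivative f1 x) (at x)" for x
          proof -
            have "((\<lambda>s. (\<epsilon> - \<delta> * s)\<^sup>2) has_real_derivative - 2 * \<delta> * (\<epsilon> - \<delta> * x)) (at x)"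
              by (auto intro!: derivative_eq_intros)
            from DERIV_diff[OF square_dist_deriv[of w x] this]
            show ?thesis unfolding f_def[abs_def] f1_def by simp
          qed
          show "(f1 has_real_derivative f2 x) (at x)" for x
          proof -
            have "((\<lambda>s. 2 * \<delta> * (\<epsilon> - \<delta> * s)) has_real_derivative - 2 * \<delta>\<^sup>2) (at x)"
              by (auto intro!: derivative_eq_intros simp: power2_eq_square)
            from DERIV_add[OF DERIV_cmult[OF square_dist_deriv2[of w x], of "-2"] this]
            show ?thesis unfolding f1_def[abs_def] f2_def by simp
          qed
          show "1 \<le> f2 x" if x: "x \<in> closed_segment s0 s" for x
          proof -
            have xL: "x \<in> {0..L}" "\<bar>x - s0\<bar> \<le> \<sigma>"
              using x s s0 True by (auto simp: closed_segment_eq_real_ivl split: if_splits)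
            have "norm (w - z x) \<le> norm (w - z s0) + norm (z s0 - z x)"
              using norm_triangle_ineq[of "w - z s0" "z s0 - z x"] by simp
            also have "\<dots> \<le> 2 * \<sigma>"
              using wz0 z_lipschitz[of s0 x] xL \<epsilon> by (auto simp: \<epsilon>0_def abs_minus_commute)
            finally have "norm (w - z x) * norm (z2 x) \<le> (2 * \<sigma>) * K"
              using K(2)[OF xL(1)] \<sigma>(1) by (intro mult_mono) auto
            then have "(w - z x) \<bullet> z2 x \<le> 1 / 4"
              using norm_cauchy_schwarz[of "w - z x" "z2 x"] \<sigma> by linarith
            moreover have "\<delta>\<^sup>2 \<le> (1/2)\<^sup>2" using \<delta> by (intro power_mono) auto
            ultimately show ?thesis by (simp add: f2_def power2_eq_square)
          qed
          have "f1 s0 = 2 * (\<epsilon> - \<delta> * s0) * (\<delta> - n \<bullet> z1 s0)"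
            by (simp add: f1_def w_def algebra_simps)
          moreover have "0 \<le> (\<delta> - n \<bullet> z1 s0) * (s - s0)"
            using n s s0 by (auto simp: contact_def zero_le_mult_iff not_le)
          ultimately show "0 \<le> f1 s0 * (s - s0)"
            using r0 by (simp add: mult.assoc)
        qed
        moreover have "f s0 = 0"
          using n r0 by (simp add: f_def w_def contact_def)
        moreover have "\<mu> * (s - s0)\<^sup>2 \<le> 1 / 2 * (s - s0)\<^sup>2"
          by (intro mult_right_mono) (auto simp: \<mu>_def)
        ultimately show ?thesis by (simp add: f_def w_def)
      next
        case False
        have "m \<le> norm (z s0 - z s)"
          using m(2)[OF s0 s] False by (simp add: abs_minus_commute)
        also have "\<dots> \<le> norm (w - z s) + norm (w - z s0)"
          using norm_triangle_ineq4[of "w - z s" "w - z s0"] by (simp add: norm_minus_commute)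
        finally have far: "m - \<epsilon> \<le> norm (w - z s)" using wz0 by simp
        have em: "0 < \<epsilon>" "4 * \<epsilon> \<le> m" using \<epsilon> r0 by (auto simp: \<epsilon>0_def)
        have "\<epsilon>\<^sup>2 + m\<^sup>2 / 2 \<le> (m - \<epsilon>)\<^sup>2"
        proof -
          have "4 * (\<epsilon> * m) \<le> m * m" using em m mult_right_mono[of "4 * \<epsilon>" m m] by simp
          then show ?thesis by (simp add: power2_eq_square algebra_simps)
        qed
        also have "\<dots> \<le> (norm (w - z s))\<^sup>2"
          using far em by (intro power_mono) auto
        finally have "\<epsilon>\<^sup>2 + m\<^sup>2 / 2 \<le> (norm (w - z s))\<^sup>2" .
        moreover have "(\<epsilon> - \<delta> * s)\<^sup>2 \<le> \<epsilon>\<^sup>2" using rs by (intro power_mono) auto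
        moreover have "\<mu> * (s - s0)\<^sup>2 \<le> m\<^sup>2 / 2"
        proof -
          have "(s - s0)\<^sup>2 \<le> L\<^sup>2" using s s0 by (intro power2_le_iff_abs_le[THEN iffD2]) auto
          then have "\<mu> * (s - s0)\<^sup>2 \<le> m\<^sup>2 / (2 * L\<^sup>2) * L\<^sup>2"
            by (intro mult_mono) (auto simp: \<mu>_def)
          then show ?thesis using L_pos by simp
        qed
        ultimately show ?thesis by (simp add: w_def)
      qed
    qed
    have "0 < \<mu>" using m L_pos by (auto simp: \<mu>_def)
    then show "thin_tube z z1 z2 L \<epsilon> \<delta> \<mu>"
      using \<delta> taper quad by unfold_locales auto
  qed
qed

context thin_tube
begin

definition r :: "real \<Rightarrow> real" where "r s = \<epsilon> - \<delta> * s"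

abbreviation \<Omega> :: "complex set" where "\<Omega> \<equiv> tapered_tube z L \<epsilon> \<delta>"

lemma r_le: "s \<in> {0..L} \<Longrightarrow> r s \<le> \<epsilon>"
  using delta by (simp add: r_def)

lemma r_ge: "s \<in> {0..L} \<Longrightarrow> \<epsilon> - \<delta> * L \<le> r s"
  using delta by (simp add: r_def)

lemma r_pos: "s \<in> {0..L} \<Longrightarrow> 0 < r s"
  using r_ge[of s] taper by simp

lemma tube_iff: "p \<in> \<Omega> \<longleftrightarrow> (\<exists>s\<in>{0..L}. norm (p - z s) < r s)"
  by (auto simp: tapered_tube_def r_def dist_norm norm_minus_commute)

lemma axis_in_tube: "s \<in> {0..L} \<Longrightarrow> z s \<in> \<Omega>"
  unfolding tube_iff using r_pos by (intro bexI[of _ s]) auto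

lemma open_tube: "open \<Omega>"
  by (auto simp: tapered_tube_def)

lemma tube_near_axis: "p \<in> \<Omega> \<Longrightarrow> \<exists>q \<in> z ` {0..L}. norm (p - q) < \<epsilon>"
  using r_le by (force simp: tube_iff)

lemma bounded_tube: "bounded \<Omega>"
proof -
  have "norm p \<le> norm (z 0) + L + \<epsilon>" if p: "p \<in> \<Omega>" for p
  proof -
    obtain s where s: "s \<in> {0..L}" "norm (p - z s) < r s" using p unfolding tube_iff by (rule bexE)
    have "norm p \<le> norm (z 0) + norm (z s - z 0) + norm (p - z s)"
      using norm_triangle_ineq[of "z 0 + (z s - z 0)" "p - z s"]
          norm_triangle_ineq[of "z 0" "z s - z 0"] by simp
    then show ?thesis using s r_le[OF s(1)] z_lipschitz[of s 0] by auto
  qed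
  then show ?thesis by (auto simp: bounded_iff)
qed

text \<open>A parameter whose disc contains \<open>p\<close> most deeply; for \<open>p\<close> in the tube there is only one.\<close>

definition foot :: "complex \<Rightarrow> real" where
  "foot p = (SOME t. t \<in> {0..L} \<and> (\<forall>s\<in>{0..L}. r s - norm (p - z s) \<le> r t - norm (p - z t)))"

definition depth :: "complex \<Rightarrow> real" where
  "depth p = r (foot p) - norm (p - z (foot p))"

lemma foot: "foot p \<in> {0..L}" and depth_max: "s \<in> {0..L} \<Longrightarrow> r s - norm (p - z s) \<le> depth p"
proof -
  have "continuous_on {0..L} (\<lambda>s. r s - norm (p - z s))"
    unfolding r_def by (intro continuous_intros z_cont)
  then have "\<exists>t. t \<in> {0..L} \<and> (\<forall>s\<in>{0..L}. r s - norm (p - z s) \<le> r t - norm (p - z t))"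
    using continuous_attains_sup[of "{0..L}" "\<lambda>s. r s - norm (p - z s)"] L_pos by auto
  from someI_ex[OF this] show "foot p \<in> {0..L}" "s \<in> {0..L} \<Longrightarrow> r s - norm (p - z s) \<le> depth p"
    unfolding depth_def foot_def by blast+
qed

lemma tube_iff_depth: "p \<in> \<Omega> \<longleftrightarrow> 0 < depth p"
  using foot[of p] depth_max[of _ p] by (force simp: tube_iff depth_def)

lemma depth_lipschitz: "depth p \<le> depth q + norm (p - q)"
proof -
  have "norm (q - z (foot p)) \<le> norm (p - z (foot p)) + norm (p - q)"
    using norm_triangle_ineq4[of "p - z (foot p)" "p - q"] by simp
  then show ?thesis using depth_max[OF foot[of p], of q] by (simp add: depth_def)
qed

text \<open>A unit normal leaning forward by the half-angle of the taper, the direction of contact at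
axis points, where the direction from the axis is undetermined.\<close>

lemma tilted_normal:
  obtains n where "norm n = 1" "n \<bullet> z1 s = \<delta>"
proof
  define n where "n = z1 s * Complex \<delta> (sqrt (1 - \<delta>\<^sup>2))"
  have "0 \<le> 1 - \<delta>\<^sup>2" using delta by (simp add: power_le_one)
  then have "norm (Complex \<delta> (sqrt (1 - \<delta>\<^sup>2))) = 1" by (simp add: cmod_def)
  then show "norm n = 1" by (simp add: n_def norm_mult unit_speed)
  have "(Re (z1 s))\<^sup>2 + (Im (z1 s))\<^sup>2 = 1" using unit_speed[of s] by (simp add: cmod_def)
  then have "\<delta> * ((Re (z1 s))\<^sup>2 + (Im (z1 s))\<^sup>2) = \<delta>" by simp
  then show "n \<bullet> z1 s = \<delta>" by (simp add: n_def inner_complex_def algebra_simps power2_eq_square)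
qed

text \<open>The contact conditions are the first-order conditions for a maximum of \<open>r s - \<bar>p - z s\<bar>\<close>
on \<open>{0..L}\<close>.\<close>

lemma foot_normal:
  obtains n where "contact \<delta> (foot p) n" "p = z (foot p) + norm (p - z (foot p)) *\<^sub>R n"
proof (cases "p = z (foot p)")
  case True
  obtain n where "norm n = 1" "n \<bullet> z1 (foot p) = \<delta>" by (rule tilted_normal)
  then show ?thesis using True by (intro that[of n]) (auto simp: contact_def)
next
  case False
  define s n where "s = foot p" and "n = (p - z s) /\<^sub>R norm (p - z s)"
  have np: "norm (p - z s) > 0" using False by (simp add: s_def)
  have pn: "p = z s + norm (p - z s) *\<^sub>R n" using np by (simp add: n_def)
  have nn: "norm n = 1" using np by (simp add: n_def)
  have D: "((\<lambda>s. r s - norm (p - z s)) has_real_derivative - \<delta> + n \<bullet> z1 s) (at s)"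
  proof -
    have "((\<lambda>s. sqrt ((norm (p - z s))\<^sup>2)) has_real_derivative
        (- 2 * ((p - z s) \<bullet> z1 s)) * (inverse (sqrt ((norm (p - z s))\<^sup>2)) / 2)) (at s)"
      using np by (intro DERIV_chain2[OF DERIV_real_sqrt square_dist_deriv, THEN DERIV_cong]) auto
    then have "((\<lambda>s. norm (p - z s)) has_real_derivative - (n \<bullet> z1 s)) (at s)"
      using np by (simp add: n_def mult.commute)
    then show ?thesis unfolding r_def[abs_def] by (auto intro!: derivative_eq_intros)
  qed
  have sL: "s \<in> {0..L}" using foot by (simp add: s_def)
  have mx: "r t - norm (p - z t) \<le> r s - norm (p - z s)" if "t \<in> {0..L}" for t
    using depth_max[OF that, of p] by (simp add: depth_def s_def)
  have "n \<bullet> z1 s \<le> \<delta>" if "s < L"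
  proof (rule ccontr)
    assume "\<not> ?thesis"
    then obtain d where d: "0 < d" "\<And>h. 0 < h \<Longrightarrow> h < d \<Longrightarrow> r s - norm (p - z s)
        < r (s + h) - norm (p - z (s + h))"
      using DERIV_pos_inc_right[OF D] by auto
    \<comment> \<open>stay inside \<open>{0..L}\<close>; at \<open>s = L\<close> there is no condition\<close>
    define h where "h = min (d / 2) (L - s)"
    have "0 < h" "h < d" "s + h \<in> {0..L}" using d(1) that sL by (auto simp: h_def)
    then show False using d(2)[of h] mx[of "s + h"] by simp
  qed
  moreover have "\<delta> \<le> n \<bullet> z1 s" if "0 < s"
  proof (rule ccontr)
    assume "\<not> ?thesis"
    then obtain d where d: "0 < d" "\<And>h. 0 < h \<Longrightarrow> h < d \<Longrightarrow> r s - norm (p - z s)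
        < r (s - h) - norm (p - z (s - h))"
      using DERIV_neg_dec_left[OF D] by auto
    define h where "h = min (d / 2) s"
    have "0 < h" "h < d" "s - h \<in> {0..L}" using d(1) that sL by (auto simp: h_def)
    then show False using d(2)[of h] mx[of "s - h"] by simp
  qed
  ultimately show ?thesis using pn nn by (intro that[of n]) (auto simp: contact_def s_def)
qed

lemma contact_point_notin_tube:
  assumes "s0 \<in> {0..L}" "contact \<delta> s0 n"
  shows "z s0 + r s0 *\<^sub>R n \<notin> \<Omega>"
proof -
  have "r s \<le> norm (z s0 + r s0 *\<^sub>R n - z s)" if s: "s \<in> {0..L}" for s
  proof (rule power2_le_imp_le)
    show "(r s)\<^sup>2 \<le> (norm (z s0 + r s0 *\<^sub>R n - z s))\<^sup>2"
      using quad[OF assms s] mu by (auto simp: r_def intro: order_trans[rotated])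
  qed simp
  then show ?thesis by (force simp: tube_iff)
qed

text \<open>The boundary point \<open>w\<close> seen from the foot through \<open>p\<close> is outside every other disc with a
quadratic margin, and \<open>p\<close> is at distance \<open>depth p\<close> from \<open>w\<close>; the triangle inequality carries the
margin over.\<close>

lemma foot_unique_quantitatively:
  assumes p: "0 \<le> depth p" and s: "s \<in> {0..L}"
  shows "r s - norm (p - z s) + \<mu> / (2 * \<epsilon> + L) * (s - foot p)\<^sup>2 \<le> depth p"
proof -
  obtain n where n: "contact \<delta> (foot p) n" "p = z (foot p) + norm (p - z (foot p)) *\<^sub>R n"
    by (rule foot_normal)
  define t w where "t = foot p" and "w = z t + r t *\<^sub>R n"
  have t: "t \<in> {0..L}" using foot by (simp add: t_def)
  have "w - p = depth p *\<^sub>R n"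
    by (subst n(2)) (simp add: w_def depth_def t_def algebra_simps)
  then have wp: "norm (w - p) = depth p" using n(1) p by (simp add: contact_def)
  have wz: "norm (w - z s) \<le> \<epsilon> + L"
  proof -
    have "norm (w - z s) \<le> norm (w - z t) + norm (z t - z s)"
      using norm_triangle_ineq[of "w - z t" "z t - z s"] by simp
    moreover have "norm (w - z t) \<le> \<epsilon>" using n(1) r_le[OF t] r_pos[OF t]
        by (simp add: w_def contact_def)
    moreover have "norm (z t - z s) \<le> L" using z_lipschitz[of t s] s t by auto
    ultimately show ?thesis by linarith
  qed
  have q: "(r s)\<^sup>2 + \<mu> * (s - t)\<^sup>2 \<le> (norm (w - z s))\<^sup>2"
    using quad[of t n s] n(1) s t by (simp add: w_def r_def t_def)
  have rs: "0 < r s" "r s \<le> \<epsilon>" using r_pos r_le s by auto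
  have ge: "r s \<le> norm (w - z s)"
    by (rule power2_le_imp_le) (use q mu in \<open>auto intro: order_trans[rotated]\<close>)
  have "\<mu> * (s - t)\<^sup>2 \<le> (norm (w - z s) - r s) * (norm (w - z s) + r s)"
    using q by (simp add: power2_eq_square algebra_simps)
  also have "\<dots> \<le> (norm (w - z s) - r s) * (2 * \<epsilon> + L)"
    using ge wz rs by (intro mult_left_mono) auto
  finally have "\<mu> / (2 * \<epsilon> + L) * (s - t)\<^sup>2 \<le> norm (w - z s) - r s"
    using rs L_pos by (simp add: divide_le_eq mult.commute)
  also have "\<dots> \<le> norm (p - z s) + depth p - r s"
    using norm_triangle_ineq[of "w - p" "p - z s"] wp by simp
  finally show ?thesis by (simp add: t_def)
qed

text \<open>The quadratic margin makes the maximiser Hoelder continuous with exponent \<open>1 / 2\<close>.\<close>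

lemma foot_continuous: "continuous_on \<Omega> foot"
proof -
  define c where "c = \<mu> / (2 * \<epsilon> + L)"
  have "0 < \<epsilon>" using r_pos[of 0] L_pos by (simp add: r_def)
  then have c: "0 < c" using mu L_pos by (simp add: c_def)
  have hoelder: "c * (foot q - foot p)\<^sup>2 \<le> 2 * norm (p - q)" if "p \<in> \<Omega>" for p q
  proof -
    have "r (foot q) - norm (p - z (foot q)) + c * (foot q - foot p)\<^sup>2 \<le> depth p"
      unfolding c_def using foot_unique_quantitatively[of p "foot q"] foot that tube_iff_depth
          by auto
    moreover have "depth q - norm (p - q) \<le> r (foot q) - norm (p - z (foot q))"
      using norm_triangle_ineq[of "p - q" "q - z (foot q)"] by (simp add: depth_def)
    ultimately show ?thesis using depth_lipschitz[of p q] by linarith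
  qed
  show ?thesis
    unfolding continuous_on_iff
  proof (intro ballI allI impI)
    fix p e :: _ assume p: "p \<in> \<Omega>" and e: "0 < (e::real)"
    show "\<exists>d>0. \<forall>q\<in>\<Omega>. dist q p < d \<longrightarrow> dist (foot q) (foot p) < e"
    proof (intro exI[of _ "c * e\<^sup>2 / 2"] conjI ballI impI)
      show "0 < c * e\<^sup>2 / 2" using c e by simp
      fix q assume "q \<in> \<Omega>" "dist q p < c * e\<^sup>2 / 2"
      then have "c * (foot q - foot p)\<^sup>2 < c * e\<^sup>2"
        using hoelder[OF p, of q] by (simp add: dist_norm norm_minus_commute)
      then have "\<bar>foot q - foot p\<bar>\<^sup>2 < e\<^sup>2" using c by simp
      then show "dist (foot q) (foot p) < e"
        using e power2_less_imp_less by (fastforce simp: dist_real_def)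
    qed
  qed
qed

text \<open>First every point moves straight to its foot, within a single disc, then the axis
contracts to \<open>z 0\<close>.\<close>

lemma contractible_tube: "contractible \<Omega>"
proof -
  have zf: "continuous_on \<Omega> (\<lambda>p. z (foot p))"
    by (intro continuous_on_compose2[OF z_cont[of UNIV] foot_continuous]) auto
  have 1: "homotopic_with_canon (\<lambda>x. True) \<Omega> \<Omega> id (\<lambda>p. z (foot p))"
  proof (rule homotopic_with_linear)
    show "closed_segment (id p) (z (foot p)) \<subseteq> \<Omega>" if "p \<in> \<Omega>" for p
    proof -
      have "closed_segment p (z (foot p)) \<subseteq> ball (z (foot p)) (r (foot p))"
        using that foot[of p] r_pos[OF foot[of p]]
        by (intro closed_segment_subset) (auto simp: tube_iff_depth depth_def dist_norm
            norm_minus_commute)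
      then show ?thesis using foot[of p] by (force simp: tapered_tube_def r_def)
    qed
  qed (use zf in auto)
  have 2: "homotopic_with_canon (\<lambda>x. True) \<Omega> \<Omega> (\<lambda>p. z (foot p)) (\<lambda>p. z 0)"
    unfolding homotopic_with
  proof (subst homotopic_with; (intro exI[of _ "\<lambda>x. z ((1 - fst x) * foot (snd x))"] conjI)?)
    show "continuous_map (prod_topology (top_of_set {0..1}) (top_of_set \<Omega>)) (top_of_set \<Omega>)
        (\<lambda>x. z ((1 - fst x) * foot (snd x)))"
      unfolding prod_topology_subtopology_eu continuous_map_subtopology_eu
    proof (intro conjI)
      show "continuous_on ({0..1} \<times> \<Omega>) (\<lambda>x. z ((1 - fst x) * foot (snd x)))"
        by (intro continuous_on_compose2[OF z_cont[of UNIV]] continuous_intros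
            continuous_on_compose2[OF foot_continuous]) auto
      show "(\<lambda>x. z ((1 - fst x) * foot (snd x))) \<in> {0..1} \<times> \<Omega> \<rightarrow> \<Omega>"
      proof
        fix x :: "real \<times> complex" assume "x \<in> {0..1} \<times> \<Omega>"
        then have "(1 - fst x) * foot (snd x) \<in> {0..L}"
          using foot[of "snd x"] mult_mono[of "1 - fst x" 1 "foot (snd x)" L] by auto
        then show "z ((1 - fst x) * foot (snd x)) \<in> \<Omega>" by (rule axis_in_tube)
      qed
    qed
  qed auto
  show ?thesis
    unfolding contractible_def using homotopic_with_trans[OF 1 2] by blast
qed

lemma connected_tube: "connected \<Omega>" and simply_connected_tube: "simply_connected \<Omega>"
  using contractible_tube contractible_imp_connected contractible_imp_simply_connected by blast+

lemma frontier_tube_nonempty: "frontier \<Omega> \<noteq> {}"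
  using axis_in_tube[of 0] L_pos bounded_tube
  by (intro frontier_not_empty) (auto simp: not_bounded_UNIV)

text \<open>The disc of radius \<open>depth p\<close> around \<open>p\<close> lies in the tube, and the point of contact, which
does not, is at exactly this distance.\<close>

lemma infdist_frontier: "p \<in> \<Omega> \<Longrightarrow> infdist p (frontier \<Omega>) = depth p"
proof (rule antisym)
  assume p: "p \<in> \<Omega>"
  obtain n where n: "contact \<delta> (foot p) n" "p = z (foot p) + norm (p - z (foot p)) *\<^sub>R n"
    by (rule foot_normal)
  define w where "w = z (foot p) + r (foot p) *\<^sub>R n"
  have "w \<notin> \<Omega>" unfolding w_def by (rule contact_point_notin_tube[OF foot n(1)])
  have "w - p = depth p *\<^sub>R n"
    by (subst n(2)) (simp add: w_def depth_def algebra_simps)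
  then have wp: "norm (w - p) = depth p"
    using n(1) p tube_iff_depth by (simp add: contact_def)
  have "closed_segment p w \<inter> frontier \<Omega> \<noteq> {}"
    using p \<open>w \<notin> \<Omega>\<close> by (intro connected_Int_frontier) auto
  then obtain y where y: "y \<in> closed_segment p w" "y \<in> frontier \<Omega>" by blast
  have "infdist p (frontier \<Omega>) \<le> dist p y" by (rule infdist_le[OF y(2)])
  also have "\<dots> \<le> norm (w - p)"
    using dist_in_closed_segment[OF y(1)] by (simp add: dist_commute dist_norm norm_minus_commute)
  finally show "infdist p (frontier \<Omega>) \<le> depth p" using wp by simp
  show "depth p \<le> infdist p (frontier \<Omega>)"
    unfolding infdist_notempty[OF frontier_tube_nonempty]
  proof (rule cINF_greatest[OF frontier_tube_nonempty])
    fix x assume "x \<in> frontier \<Omega>"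
    then have "x \<notin> \<Omega>" using open_tube frontier_disjoint_eq
        by (auto simp: frontier_def interior_open)
    then have "depth x \<le> 0" using tube_iff_depth by force
    then show "depth p \<le> dist p x" using depth_lipschitz[of p x] by (simp add: dist_norm)
  qed
qed

lemma depth_axis:
  assumes s: "s \<in> {0..L}"
  shows "depth (z s) = r s"
proof (rule antisym)
  obtain n where n: "norm n = 1" "n \<bullet> z1 s = \<delta>" by (rule tilted_normal)
  define w where "w = z s + r s *\<^sub>R n"
  have "w \<notin> \<Omega>"
    unfolding w_def by (intro contact_point_notin_tube s) (use n in \<open>auto simp: contact_def\<close>)
  then have "depth w \<le> 0" using tube_iff_depth[of w] by simp
  moreover have "norm (z s - w) = r s" using n r_pos[OF s] by (simp add: w_def)
  ultimately show "depth (z s) \<le> r s" using depth_lipschitz[of "z s" w] by simp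
  show "r s \<le> depth (z s)" using depth_max[OF s, of "z s"] by simp
qed

text \<open>Off the axis, moving towards the foot increases the depth at unit rate. On the axis the
depth is the radius \<open>r\<close>, which decreases strictly away from \<open>z 0\<close>.\<close>

lemma local_max_depth: "local_max_points \<Omega> (\<lambda>p. infdist p (frontier \<Omega>)) = {z 0}"
proof -
  let ?d = "\<lambda>p. infdist p (frontier \<Omega>)"
  have 0: "0 \<in> {0..L}" using L_pos by simp
  have "?d p \<le> ?d (z 0)" if "p \<in> \<Omega>" for p
  proof -
    have "depth p \<le> r (foot p)" by (simp add: depth_def)
    also have "\<dots> \<le> r 0" using foot[of p] delta by (simp add: r_def)
    finally show ?thesis
      using that axis_in_tube[OF 0] depth_axis[OF 0] by (simp add: infdist_frontier)
  qed
  then have "z 0 \<in> local_max_points \<Omega> ?d"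
    using axis_in_tube[OF 0] by (auto simp: local_max_points_def eventually_at intro!: exI[of _ 1])
  moreover have "p = z 0" if lm: "p \<in> local_max_points \<Omega> ?d" for p
  proof -
    have p: "p \<in> \<Omega>" using lm by (simp add: local_max_points_def)
    have "\<forall>\<^sub>F q in at p within \<Omega>. ?d q \<le> ?d p" using lm by (simp add: local_max_points_def)
    then obtain d where d: "0 < d" "\<forall>q\<in>\<Omega>. q \<noteq> p \<and> dist q p < d \<longrightarrow> ?d q \<le> ?d p"
      unfolding eventually_at by (elim exE conjE)
    have mx: "depth q \<le> depth p" if "q \<in> \<Omega>" "dist q p < d" for q
      using d(2) that p by (cases "q = p") (auto simp: infdist_frontier)
    show ?thesis
    proof (cases "p = z (foot p)")
      case True
      define s where "s = foot p"
      have s: "s \<in> {0..L}" using foot by (simp add: s_def)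
      have "s = 0"
      proof (rule ccontr)
        assume "s \<noteq> 0"
        define t where "t = s - min s (d / 2)"
        have t: "t \<in> {0..L}" "t < s" "\<bar>t - s\<bar> < d" using s \<open>s \<noteq> 0\<close> d(1)
            by (auto simp: t_def min_def)
        have "dist (z t) p < d"
          using z_lipschitz[of t s] t True by (simp add: dist_norm s_def)
        then have "depth (z t) \<le> depth p" by (intro mx axis_in_tube t)
        then have "r t \<le> r s" using True depth_axis[OF t(1)] depth_axis[OF s] by (simp add: s_def)
        then show False using t delta by (simp add: r_def)
      qed
      then show ?thesis using True by (simp add: s_def)
    next
      case False
      define \<rho> where "\<rho> = norm (p - z (foot p))"
      have \<rho>: "0 < \<rho>" using False by (simp add: \<rho>_def)
      \<comment> \<open>the fraction of the way from \<open>p\<close> to its foot: small enough to stay within \<open>d\<close> of \<open>p\<close>\<close>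
      define h where "h = min 1 (d / (2 * \<rho>))"
      have h: "0 < h" "h \<le> 1" "h * \<rho> < d"
      proof -
        show "0 < h" "h \<le> 1" using d(1) \<rho> by (auto simp: h_def)
        have "h * \<rho> \<le> d / (2 * \<rho>) * \<rho>" using \<rho> by (intro mult_right_mono) (auto simp: h_def)
        also have "\<dots> = d / 2" using \<rho> by simp
        also have "\<dots> < d" using d(1) by simp
        finally show "h * \<rho> < d" .
      qed
      define q where "q = p + h *\<^sub>R (z (foot p) - p)"
      have "norm (q - z (foot p)) = (1 - h) * \<rho>"
      proof -
        have "q - z (foot p) = (1 - h) *\<^sub>R (p - z (foot p))" by (simp add: q_def algebra_simps)
        then show ?thesis using h by (simp add: \<rho>_def)
      qed
      then have "depth p + h * \<rho> \<le> depth q"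
        using depth_max[OF foot[of p], of q] by (simp add: depth_def \<rho>_def algebra_simps)
      moreover have "depth q \<le> depth p"
      proof (rule mx)
        show "dist q p < d" using h by (simp add: q_def dist_norm \<rho>_def norm_minus_commute)
        show "q \<in> \<Omega>" using calculation p mult_pos_pos[OF h(1) \<rho>] unfolding tube_iff_depth
            by linarith
      qed
      ultimately show ?thesis using mult_pos_pos[OF h(1) \<rho>] by linarith
    qed
  qed
  ultimately show ?thesis by blast
qed

text \<open>The disc touching at \<open>w\<close> from outside has centre \<open>w + \<rho> n\<close>, with \<open>n\<close> the direction of
contact. Replacing \<open>w\<close> by this centre and \<open>r(s)\<close> by \<open>r(s) + \<rho>\<close> lowers \<open>\<bar>w - z(s)\<bar>\<^sup>2 - r(s)\<^sup>2\<close> by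
at most \<open>\<rho> K\<close> times \<open>(s - foot w)\<^sup>2\<close>, where \<open>K\<close> bounds the curvature: again the first-order
terms vanish or help. For small \<open>\<rho>\<close> the quadratic margin absorbs this.\<close>

lemma exterior_ball:
  assumes w: "w \<in> frontier \<Omega>"
  obtains c \<rho> where "0 < \<rho>" "norm (w - c) = \<rho>" "\<And>p. p \<in> \<Omega> \<Longrightarrow> \<rho> \<le> norm (p - c)"
proof -
  have "w \<notin> \<Omega>" using w open_tube by (auto simp: frontier_def interior_open)
  then have "depth w \<le> 0" using tube_iff_depth by force
  moreover have "0 \<le> depth w"
  proof (rule field_le_epsilon)
    fix e :: real assume "0 < e"
    then obtain p where "p \<in> \<Omega>" "dist p w < e"
      using w closure_approachable[of w \<Omega>] by (auto simp: frontier_def)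
    then show "0 \<le> depth w + e"
      using depth_lipschitz[of p w] tube_iff_depth by (simp add: dist_norm)
  qed
  ultimately have d0: "depth w = 0" by simp
  obtain n where n: "contact \<delta> (foot w) n" "w = z (foot w) + norm (w - z (foot w)) *\<^sub>R n"
    by (rule foot_normal)
  define t where "t = foot w"
  have t: "t \<in> {0..L}" using foot by (simp add: t_def)
  have ct: "contact \<delta> t n" using n(1) by (simp add: t_def)
  then have nn: "norm n = 1" by (simp add: contact_def)
  have "norm (w - z t) = r t" using d0 by (simp add: depth_def t_def)
  then have wt: "w = z t + r t *\<^sub>R n" using n(2) unfolding t_def[symmetric] by simp
  obtain K where K: "0 \<le> K" "\<And>s. s \<in> {0..L} \<Longrightarrow> norm (z2 s) \<le> K"
    by (rule curvature_bound) (rule that)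
  define \<rho> where "\<rho> = \<mu> / (K + 1)"
  have \<rho>: "0 < \<rho>" "\<rho> * K \<le> \<mu>" using mu K by (auto simp: \<rho>_def field_simps)
  have E: "- (K / 2) * (s - t)\<^sup>2 \<le> (w - z s) \<bullet> n - r s" if s: "s \<in> {0..L}" for s
  proof -
    define f where "f s = (w - z s) \<bullet> n - r s" for s
    have "f t + (- K) / 2 * (s - t)\<^sup>2 \<le> f s"
    proof (rule quadratic_lower_bound[of f "\<lambda>s. \<delta> - z1 s \<bullet> n" "\<lambda>s. - (z2 s \<bullet> n)"])
      show "(f has_real_derivative \<delta> - z1 x \<bullet> n) (at x)" for x
        unfolding f_def[abs_def] r_def using inner_deriv[of w n x]
        by (auto intro!: derivative_eq_intros)
      show "((\<lambda>s. \<delta> - z1 s \<bullet> n) has_real_derivative - (z2 x \<bullet> n)) (at x)" for x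
        using inner_z1_deriv[of n x] by (auto intro!: derivative_eq_intros)
      show "- K \<le> - (z2 x \<bullet> n)" if "x \<in> closed_segment t s" for x
      proof -
        have "x \<in> {0..L}"
          using that s t by (auto simp: closed_segment_eq_real_ivl split: if_splits)
        then show ?thesis using K(2)[of x] norm_cauchy_schwarz[of "z2 x" n] nn by simp
      qed
      show "0 \<le> (\<delta> - z1 t \<bullet> n) * (s - t)"
        using ct s t by (auto simp: contact_def zero_le_mult_iff not_le inner_commute)
    qed
    moreover have "f t = 0"
    proof -
      have "w - z t = r t *\<^sub>R n" using wt by simp
      then show ?thesis using nn by (simp add: f_def norm_eq_1)
    qed
    ultimately show ?thesis by (simp add: f_def)
  qed
  show thesis
  proof (rule that)
    show "0 < \<rho>" by (rule \<rho>)
    show "norm (w - (w + \<rho> *\<^sub>R n)) = \<rho>" using nn \<rho> by simp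
    fix p assume "p \<in> \<Omega>"
    then obtain s where s: "s \<in> {0..L}" "norm (p - z s) < r s" unfolding tube_iff by (rule bexE)
    have q: "(r s)\<^sup>2 + \<mu> * (s - t)\<^sup>2 \<le> (norm (w - z s))\<^sup>2"
      using quad[OF t ct s(1)] unfolding r_def[symmetric] wt[symmetric] .
    have "\<rho> + r s \<le> norm (w + \<rho> *\<^sub>R n - z s)"
    proof (rule power2_le_imp_le)
      have "2 * \<rho> * (- (K / 2) * (s - t)\<^sup>2) \<le> 2 * \<rho> * ((w - z s) \<bullet> n - r s)"
        using E[OF s(1)] \<rho> by (intro mult_left_mono) auto
      moreover have "\<rho> * K * (s - t)\<^sup>2 \<le> \<mu> * (s - t)\<^sup>2"
        using \<rho> by (intro mult_right_mono) auto
      ultimately have "(\<rho> + r s)\<^sup>2 \<le> (norm (w - z s))\<^sup>2 + \<rho>\<^sup>2 + 2 * \<rho> * ((w - z s) \<bullet> n)"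
        using q by (simp add: power2_eq_square algebra_simps)
      also have "\<dots> = (norm (w + \<rho> *\<^sub>R n - z s))\<^sup>2"
      proof -
        have "w + \<rho> *\<^sub>R n - z s = (w - z s) + \<rho> *\<^sub>R n" by simp
        moreover have "n \<bullet> n = 1" using nn by (simp add: norm_eq_1)
        ultimately show ?thesis
          by (simp only: power2_norm_eq_inner inner_add_left inner_add_right inner_scaleR_left
              inner_scaleR_right)
             (simp add: power2_eq_square inner_commute algebra_simps)
      qed
      finally show "(\<rho> + r s)\<^sup>2 \<le> (norm (w + \<rho> *\<^sub>R n - z s))\<^sup>2" .
    qed simp
    then show "\<rho> \<le> norm (p - (w + \<rho> *\<^sub>R n))"
      using s(2) norm_triangle_ineq4[of "p - z s" "p - (w + \<rho> *\<^sub>R n)"] by simp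
  qed
qed

end

section \<open>Existence of the torsion function\<close>

text \<open>Being locally the real part of a holomorphic function is the form in which harmonicity
enters here; on domains that are not simply connected, as for \<open>ln \<bar>z\<bar>\<close>, there need not be a
global one.\<close>

definition harmonic_on :: "complex set \<Rightarrow> (complex \<Rightarrow> real) \<Rightarrow> bool" where
  "harmonic_on U u \<longleftrightarrow>
     (\<forall>z\<in>U. \<exists>e>0. \<exists>F. F holomorphic_on ball z e \<and> (\<forall>w\<in>ball z e. u w = Re (F w)))"

lemma harmonic_on_Re:
  assumes "open U" "F holomorphic_on U"
  shows "harmonic_on U (\<lambda>z. Re (F z))"
  unfolding harmonic_on_def
proof
  fix z assume "z \<in> U"
  then obtain e where "e > 0" "ball z e \<subseteq> U" using assms open_contains_ball by blast
  then show "\<exists>e>0. \<exists>G. G holomorphic_on ball z e \<and> (\<forall>w\<in>ball z e. Re (F w) = Re (G w))"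
    using assms holomorphic_on_subset by blast
qed

lemma harmonic_on_ln_norm:
  assumes "open U" "F holomorphic_on U" "\<And>z. z \<in> U \<Longrightarrow> F z \<noteq> 0"
  shows "harmonic_on U (\<lambda>z. ln (norm (F z)))"
  unfolding harmonic_on_def
proof
  fix z assume "z \<in> U"
  then obtain e where e: "e > 0" "ball z e \<subseteq> U" using assms open_contains_ball by blast
  have "F holomorphic_on ball z e" using assms(2) e holomorphic_on_subset by blast
  then obtain g where g: "g holomorphic_on ball z e" "\<And>w. w \<in> ball z e \<Longrightarrow> F w = exp (g w)"
    using contractible_imp_holomorphic_log[of F "ball z e"] assms(3) e
    by (metis convex_ball convex_imp_contractible subsetD)
  then have "\<forall>w\<in>ball z e. ln (norm (F w)) = Re (g w)" by simp
  then show "\<exists>e>0. \<exists>G. G holomorphic_on ball z e \<and> (\<forall>w\<in>ball z e. ln (norm (F w)) = Re (G w))"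
    using e g by blast
qed

lemma harmonic_on_add:
  assumes "harmonic_on U u" "harmonic_on U v"
  shows "harmonic_on U (\<lambda>z. u z + v z)"
  unfolding harmonic_on_def
proof
  fix z assume z: "z \<in> U"
  obtain d F where F: "d > 0" "F holomorphic_on ball z d" "\<forall>w\<in>ball z d. u w = Re (F w)"
    using assms(1) z unfolding harmonic_on_def by blast
  obtain e G where G: "e > 0" "G holomorphic_on ball z e" "\<forall>w\<in>ball z e. v w = Re (G w)"
    using assms(2) z unfolding harmonic_on_def by blast
  have "(\<lambda>w. F w + G w) holomorphic_on ball z (min d e)"
    by (intro holomorphic_on_add holomorphic_on_subset[OF F(2)] holomorphic_on_subset[OF G(2)]) auto
  then show "\<exists>e>0. \<exists>H. H holomorphic_on ball z e \<and> (\<forall>w\<in>ball z e. u w + v w = Re (H w))"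
    using F G by (intro exI[of _ "min d e"] conjI exI[of _ "\<lambda>w. F w + G w"]) auto
qed

lemma harmonic_on_cmul:
  assumes "harmonic_on U u"
  shows "harmonic_on U (\<lambda>z. a * u z)"
  unfolding harmonic_on_def
proof
  fix z assume z: "z \<in> U"
  obtain d F where F: "d > 0" "F holomorphic_on ball z d" "\<forall>w\<in>ball z d. u w = Re (F w)"
    using assms(1) z unfolding harmonic_on_def by blast
  have "(\<lambda>w. of_real a * F w) holomorphic_on ball z d"
    by (intro holomorphic_intros F)
  then show "\<exists>e>0. \<exists>H. H holomorphic_on ball z e \<and> (\<forall>w\<in>ball z e. a * u w = Re (H w))"
    using F by (intro exI[of _ d] conjI exI[of _ "\<lambda>w. of_real a * F w"]) auto
qed

lemma harmonic_on_cong: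
  assumes "harmonic_on U u" "open U" "\<And>z. z \<in> U \<Longrightarrow> v z = u z"
  shows "harmonic_on U v"
  unfolding harmonic_on_def
proof
  fix z assume z: "z \<in> U"
  obtain d F where F: "d > 0" "F holomorphic_on ball z d" "\<forall>w\<in>ball z d. u w = Re (F w)"
    using assms(1) z unfolding harmonic_on_def by blast
  obtain e where e: "e > 0" "ball z e \<subseteq> U" using assms(2) z open_contains_ball by blast
  have sub: "ball z (min d e) \<subseteq> ball z d" "ball z (min d e) \<subseteq> ball z e" by auto
  show "\<exists>e>0. \<exists>F. F holomorphic_on ball z e \<and> (\<forall>w\<in>ball z e. v w = Re (F w))"
  proof (intro exI[of _ "min d e"] conjI exI[of _ F] ballI)
    show "F holomorphic_on ball z (min d e)" using F(2) sub(1) by (rule holomorphic_on_subset)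
    fix w assume w: "w \<in> ball z (min d e)"
    then have "w \<in> U" "w \<in> ball z d" using sub e by blast+
    then show "v w = Re (F w)" using assms(3) F(3) by simp
  qed (use F e in simp)
qed

text \<open>The set where the maximum is attained is closed, and by the maximum modulus principle for
\<open>exp F\<close> it is open as well; it cannot be the whole plane, so it reaches the boundary.\<close>

lemma harmonic_max_principle:
  assumes U: "open U" "bounded U" and cont: "continuous_on (closure U) u"
      and harm: "harmonic_on U u"
    and B: "\<And>z. z \<in> frontier U \<Longrightarrow> u z \<le> B" and x: "x \<in> U"
  shows "u x \<le> B"
proof (rule ccontr)
  assume "\<not> u x \<le> B"
  have cpt: "compact (closure U)" using U by (simp add: compact_closure)
  obtain y where y: "y \<in> closure U" "\<forall>z\<in>closure U. u z \<le> u y"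
    using continuous_attains_sup[OF cpt _ cont] x closure_subset by blast
  have "u x \<le> u y" using y x closure_subset by blast
  define K where "K = {z \<in> closure U. u z = u y}"
  have KU: "K \<subseteq> U"
  proof
    fix z assume "z \<in> K"
    then have "z \<notin> frontier U" "z \<in> closure U"
      using B[of z] \<open>u x \<le> u y\<close> \<open>\<not> u x \<le> B\<close> by (auto simp: K_def)
    then show "z \<in> U" using U by (simp add: frontier_def interior_open)
  qed
  have "closed K"
    unfolding K_def using continuous_closed_preimage_constant[OF cont closed_closure] by simp
  moreover have "open K"
    unfolding open_contains_ball
  proof
    fix z assume "z \<in> K"
    then have z: "z \<in> U" "u z = u y" using KU by (auto simp: K_def)
    obtain d F where F: "d > 0" "F holomorphic_on ball z d" "\<forall>w\<in>ball z d. u w = Re (F w)"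
      using harm z unfolding harmonic_on_def by blast
    obtain e where e: "e > 0" "ball z e \<subseteq> U" using U z open_contains_ball by blast
    define b where "b = min d e"
    have b: "b > 0" "ball z b \<subseteq> ball z d" "ball z b \<subseteq> U" using F e by (auto simp: b_def)
    have "(\<lambda>w. exp (F w)) constant_on ball z b"
    proof (rule maximum_modulus_principle[where U = "ball z b" and \<xi> = z])
      show "(\<lambda>w. exp (F w)) holomorphic_on ball z b"
        by (intro holomorphic_intros holomorphic_on_subset[OF F(2)] b)
      fix w assume w: "w \<in> ball z b"
      then have "u w \<le> u z" using y(2) z(2) b(3) closure_subset by (metis subsetD)
      then show "norm (exp (F w)) \<le> norm (exp (F z))" using F b w by auto
    qed (use b in auto)
    then obtain k where k: "\<And>w. w \<in> ball z b \<Longrightarrow> exp (F w) = k" unfolding constant_on_def by blast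
    have "u w = u z" if "w \<in> ball z b" for w
    proof -
      have "exp (F w) = exp (F z)" using k[OF that] k[of z] b by simp
      then have "exp (Re (F w)) = exp (Re (F z))" by (metis norm_exp_eq_Re)
      then show ?thesis using F b that by auto
    qed
    then have "ball z b \<subseteq> K" using b(3) z closure_subset by (auto simp: K_def)
    then show "\<exists>e>0. ball z e \<subseteq> K" using b by blast
  qed
  ultimately have "K = {} \<or> K = UNIV" using clopen by blast
  moreover have "y \<in> K" using y by (simp add: K_def)
  ultimately have "U = UNIV" using KU by auto
  then show False using U by (simp add: not_bounded_UNIV)
qed

text \<open>On the unit circle \<open>\<bar>a + \<zeta> p\<bar>\<^sup>2 = \<bar>a\<bar>\<^sup>2 + 2 Re (cnj a \<zeta> p) + \<bar>p\<bar>\<^sup>2\<close>, which solves the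
Dirichlet problem with data \<open>\<bar>p\<bar>\<^sup>2\<close> by recursion on the polynomial.\<close>

lemma square_norm_poly_eq_Re:
  "\<exists>H. H holomorphic_on UNIV \<and> (\<forall>\<zeta>. norm \<zeta> = 1 \<longrightarrow> (norm (poly p \<zeta>))\<^sup>2 = Re (H \<zeta>))"
proof (induction p)
  case 0
  then show ?case by (intro exI[of _ "\<lambda>_. 0"]) auto
next
  case (pCons a p)
  then obtain H where H: "H holomorphic_on UNIV" "\<And>\<zeta>. norm \<zeta> = 1 \<Longrightarrow> (norm (poly p \<zeta>))\<^sup>2 = Re (H \<zeta>)"
    by blast
  show ?case
  proof (intro exI conjI allI impI)
    show "(\<lambda>\<zeta>. of_real ((norm a)\<^sup>2) + 2 * cnj a * (\<zeta> * poly p \<zeta>) + H \<zeta>) holomorphic_on UNIV"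
      by (intro holomorphic_intros H)
    fix \<zeta> :: complex assume "norm \<zeta> = 1"
    then have "(norm (\<zeta> * poly p \<zeta>))\<^sup>2 = Re (H \<zeta>)" using H by (simp add: norm_mult)
    moreover have "(norm (a + w))\<^sup>2 = (norm a)\<^sup>2 + Re (2 * cnj a * w) + (norm w)\<^sup>2" for w
      unfolding cmod_power2 by (simp add: power2_eq_square algebra_simps)
    ultimately show "(norm (poly (pCons a p) \<zeta>))\<^sup>2 =
        Re (of_real ((norm a)\<^sup>2) + 2 * cnj a * (\<zeta> * poly p \<zeta>) + H \<zeta>)"
      by simp
  qed
qed

lemma polynomial_approx_dilation:
  assumes f: "f holomorphic_on ball 0 1" and r: "0 \<le> r" "r < 1" and e: "0 < e"
  shows "\<exists>p. \<forall>\<zeta>\<in>cball 0 1. norm (poly p \<zeta> - f (of_real r * \<zeta>)) < e"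
proof -
  define a where "a n = (deriv ^^ n) f 0 / fact n" for n
  have sums: "(\<lambda>n. a n * w ^ n) sums f w" if "w \<in> ball 0 1" for w
    using holomorphic_power_series[OF f that] by (simp add: a_def)
  define \<rho> where "\<rho> = (1 + r) / 2"
  have \<rho>: "r < \<rho>" "\<rho> < 1" "0 < \<rho>" using r by (auto simp: \<rho>_def)
  have "summable (\<lambda>n. a n * of_real \<rho> ^ n)"
    using sums[of "of_real \<rho>"] \<rho> sums_summable by force
  then have sm: "summable (\<lambda>n. norm (a n * of_real r ^ n))"
    by (rule powser_insidea) (use r \<rho> in auto)
  have "uniform_limit (cball 0 1) (\<lambda>n \<zeta>. \<Sum>i<n. a i * (of_real r * \<zeta>) ^ i)
      (\<lambda>\<zeta>. \<Sum>i. a i * (of_real r * \<zeta>) ^ i) sequentially"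
  proof (rule Weierstrass_m_test[OF _ sm])
    fix n and \<zeta> :: complex assume "\<zeta> \<in> cball 0 1"
    then have "norm \<zeta> ^ n \<le> 1" by (simp add: power_le_one)
    then have "norm (a n * of_real r ^ n) * norm \<zeta> ^ n \<le> norm (a n * of_real r ^ n) * 1"
      by (intro mult_left_mono) auto
    then show "norm (a n * (of_real r * \<zeta>) ^ n) \<le> norm (a n * of_real r ^ n)"
      by (simp add: norm_mult norm_power power_mult_distrib mult.assoc)
  qed
  from uniform_limitD[OF this e] obtain n where
    n: "\<forall>\<zeta>\<in>cball 0 1. dist (\<Sum>i<n. a i * (of_real r * \<zeta>) ^ i) (\<Sum>i. a i * (of_real r * \<zeta>) ^ i) < e"
    by (auto simp: eventually_sequentially)
  define p where "p = (\<Sum>i<n. monom (a i * of_real r ^ i) i)"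
  have "norm (poly p \<zeta> - f (of_real r * \<zeta>)) < e" if "\<zeta> \<in> cball 0 1" for \<zeta>
  proof -
    have "norm (of_real r * \<zeta>) \<le> r * 1"
      using that r by (simp add: norm_mult mult_left_le)
    then have "of_real r * \<zeta> \<in> ball (0::complex) 1" using r by simp
    then have "(\<Sum>i. a i * (of_real r * \<zeta>) ^ i) = f (of_real r * \<zeta>)"
      using sums sums_unique by metis
    moreover have "poly p \<zeta> = (\<Sum>i<n. a i * (of_real r * \<zeta>) ^ i)"
      by (simp add: p_def poly_sum poly_monom power_mult_distrib mult.assoc)
    ultimately show ?thesis using bspec[OF n that] by (simp add: dist_norm)
  qed
  then show ?thesis by blast
qed

lemma circle_data_approx:
  assumes f: "f holomorphic_on ball 0 1" and R: "\<And>w. w \<in> ball 0 1 \<Longrightarrow> norm (f w) \<le> R"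
    and r: "0 \<le> r" "r < 1" and e: "0 < e"
  shows "\<exists>H. H holomorphic_on UNIV \<and>
    (\<forall>\<zeta>. norm \<zeta> = 1 \<longrightarrow> \<bar>Re (H \<zeta>) - (norm (f (of_real r * \<zeta>)))\<^sup>2\<bar> \<le> e)"
proof -
  have R0: "0 \<le> R" using order_trans[OF norm_ge_zero R[of 0]] by simp
  define d where "d = min 1 (e / (2 * R + 1))"
  have d: "0 < d" "d \<le> 1" "d * (2 * R + 1) \<le> e"
  proof -
    show "0 < d" "d \<le> 1" using e R0 by (auto simp: d_def)
    have "d \<le> e / (2 * R + 1)" by (simp add: d_def)
    then show "d * (2 * R + 1) \<le> e" using R0 by (simp add: pos_le_divide_eq)
  qed
  obtain p where p: "\<And>\<zeta>. \<zeta> \<in> cball 0 1 \<Longrightarrow> norm (poly p \<zeta> - f (of_real r * \<zeta>)) < d"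
    using polynomial_approx_dilation[OF f r d(1)] by blast
  obtain H where H: "H holomorphic_on UNIV" "\<And>\<zeta>. norm \<zeta> = 1 \<Longrightarrow> (norm (poly p \<zeta>))\<^sup>2 = Re (H \<zeta>)"
    using square_norm_poly_eq_Re[of p] by blast
  have "\<bar>Re (H \<zeta>) - (norm (f (of_real r * \<zeta>)))\<^sup>2\<bar> \<le> e" if "norm \<zeta> = 1" for \<zeta>
  proof -
    define x y where "x = norm (poly p \<zeta>)" and "y = norm (f (of_real r * \<zeta>))"
    have "\<bar>x - y\<bar> \<le> d"
      using p[of \<zeta>] that norm_triangle_ineq3[of "poly p \<zeta>" "f (of_real r * \<zeta>)"]
          by (simp add: x_def y_def)
    moreover have y: "0 \<le> y" "y \<le> R"
      using R[of "of_real r * \<zeta>"] that r by (auto simp: y_def norm_mult)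
    ultimately have "\<bar>x - y\<bar> * (x + y) \<le> d * (2 * R + 1)"
      using d by (intro mult_mono) (auto simp: x_def)
    moreover have "\<bar>x\<^sup>2 - y\<^sup>2\<bar> = \<bar>x - y\<bar> * (x + y)"
      using y by (simp add: x_def power2_eq_square square_diff_square_factored abs_mult
          mult.commute)
    ultimately show ?thesis using H(2)[OF that] d by (simp add: x_def y_def)
  qed
  then show ?thesis using H by blast
qed

text \<open>For \<open>x = \<bar>z - c\<bar>\<close> this function of \<open>z\<close> has Laplacian \<open>-2\<close> and vanishes on the circle of
radius \<open>\<rho>\<close> around \<open>c\<close>: it is a barrier on any domain between that circle and the circle of
radius \<open>S\<close>.\<close>

lemma log_barrier_nonneg:
  assumes "0 < \<rho>" "\<rho> \<le> x" "x \<le> (S::real)"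
  shows "0 \<le> S\<^sup>2 * ln (x / \<rho>) - (x\<^sup>2 - \<rho>\<^sup>2) / 2"
proof -
  have x: "0 < x" using assms by simp
  have "ln (\<rho> / x) \<le> \<rho> / x - 1" using assms x by (intro ln_le_minus_one) simp
  then have "(x - \<rho>) / x \<le> ln (x / \<rho>)"
    using assms x by (simp add: ln_div field_simps)
  then have "S\<^sup>2 * ((x - \<rho>) / x) \<le> S\<^sup>2 * ln (x / \<rho>)" by (intro mult_left_mono) auto
  moreover have "(x\<^sup>2 - \<rho>\<^sup>2) / 2 \<le> S\<^sup>2 * ((x - \<rho>) / x)"
  proof -
    have "(x\<^sup>2 - \<rho>\<^sup>2) / 2 = (x - \<rho>) * ((x + \<rho>) / 2)" by (simp add: power2_eq_square algebra_simps)
    also have "\<dots> \<le> (x - \<rho>) * (S\<^sup>2 / x)"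
    proof (intro mult_left_mono)
      have "(x + \<rho>) / 2 * x \<le> x * x" using assms x by (intro mult_right_mono) auto
      also have "\<dots> \<le> S * S" using assms x by (intro mult_mono) auto
      finally show "(x + \<rho>) / 2 \<le> S\<^sup>2 / x" using x by (simp add: le_divide_eq power2_eq_square)
    qed (use assms in auto)
    finally show ?thesis by (simp add: mult.commute)
  qed
  ultimately show ?thesis by linarith
qed

text \<open>The Dirichlet problem is solved approximately on the discs of radius \<open>r n < 1\<close>. The
harmonic approximations \<open>Re (H n)\<close> are uniformly bounded, so Montel's theorem applies to \<open>exp (H
n)\<close>, whose limit has no zeros because \<open>Re (H n)\<close> is bounded below as well. Both bounds \<open>0 \<le> v\<close>
and \<open>v \<le> W\<close> for a barrier \<open>W\<close> hold approximately on the circles, hence inside by the maximum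
principle, hence in the limit; so no boundary behaviour of the Riemann map is needed.\<close>

theorem torsion_function_representation:
  assumes \<Omega>: "open \<Omega>" "bounded \<Omega>" "simply_connected \<Omega>" "\<Omega> \<noteq> {}"
    and ext: "\<And>w. w \<in> frontier \<Omega> \<Longrightarrow>
      \<exists>c \<rho>. 0 < \<rho> \<and> norm (w - c) = \<rho> \<and> (\<forall>p\<in>\<Omega>. \<rho> \<le> norm (p - c))"
  obtains v G where "G holomorphic_on \<Omega>" "\<And>z. z \<in> \<Omega> \<Longrightarrow> v z = Re (G z) - (norm z)\<^sup>2 / 2"
    "continuous_on (closure \<Omega>) v" "\<And>z. z \<notin> \<Omega> \<Longrightarrow> v z = 0" "\<And>z. 0 \<le> v z"
proof -
  have "\<Omega> \<noteq> UNIV" using \<Omega>(2) not_bounded_UNIV by blast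
  have "\<Omega> = {} \<or> \<Omega> = UNIV \<or> (\<exists>f g. f holomorphic_on \<Omega> \<and> g holomorphic_on ball 0 1 \<and>
           (\<forall>z \<in> \<Omega>. f z \<in> ball 0 1 \<and> g(f z) = z) \<and> (\<forall>z \<in> ball 0 1. g z \<in> \<Omega> \<and> f(g z) = z))"
    using Riemann_mapping_theorem[of \<Omega>] \<Omega> by blast
  then obtain \<phi> f where \<phi>: "\<phi> holomorphic_on \<Omega>" and f: "f holomorphic_on ball 0 1"
    and \<phi>f: "\<forall>z\<in>\<Omega>. \<phi> z \<in> ball 0 1 \<and> f (\<phi> z) = z" and f\<phi>: "\<forall>\<zeta>\<in>ball 0 1. f \<zeta> \<in> \<Omega> \<and> \<phi> (f \<zeta>) = \<zeta>"
    using \<Omega>(4) \<open>\<Omega> \<noteq> UNIV\<close> by blast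
  obtain R where R: "\<And>z. z \<in> \<Omega> \<Longrightarrow> norm z \<le> R" using \<Omega>(2) bounded_iff by blast
  have R0: "0 \<le> R" using R \<Omega>(4) norm_ge_zero order_trans by blast
  define r where "r n = 1 - 1 / real (n + 2)" for n
  have r: "0 \<le> r n" "r n < 1" for n by (auto simp: r_def)
  have r_lim: "r \<longlonglongrightarrow> 1"
    unfolding r_def by real_asymp
  define e where "e n = 1 / real (n + 1)" for n
  have e: "0 < e n" "e n \<le> 1" for n by (auto simp: e_def)
  have e_lim: "e \<longlonglongrightarrow> 0" unfolding e_def by real_asymp
  have "\<exists>H. \<forall>n. H n holomorphic_on UNIV \<and>
    (\<forall>\<zeta>. norm \<zeta> = 1 \<longrightarrow> \<bar>Re (H n \<zeta>) - (norm (f (of_real (r n) * \<zeta>)))\<^sup>2\<bar> \<le> e n)"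
    using f\<phi> R by (intro choice allI circle_data_approx[OF f, of R] r e) auto
  then obtain H where Hh: "\<And>n. H n holomorphic_on UNIV"
    and H: "\<And>n \<zeta>. norm \<zeta> = 1 \<Longrightarrow> \<bar>Re (H n \<zeta>) - (norm (f (of_real (r n) * \<zeta>)))\<^sup>2\<bar> \<le> e n"
    by blast
  define fr where "fr n \<zeta> = f (of_real (r n) * \<zeta>)" for n \<zeta>
  have in_ball: "of_real (r n) * \<zeta> \<in> ball 0 1" if "\<zeta> \<in> cball 0 1" for n and \<zeta> :: complex
  proof -
    have "norm (of_real (r n) * \<zeta>) \<le> r n * 1"
      using that r[of n] by (simp add: norm_mult mult_left_le)
    then show ?thesis using r[of n] by simp
  qed
  have fr_in: "fr n \<zeta> \<in> \<Omega>" if "\<zeta> \<in> cball 0 1" for n \<zeta>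
    using f\<phi> in_ball[OF that] by (simp add: fr_def)
  have fr_cont: "continuous_on (cball 0 1) (fr n)" for n
    unfolding fr_def
    by (intro continuous_on_compose2[OF holomorphic_on_imp_continuous_on[OF f]] continuous_intros)
       (use in_ball in auto)
  have fr_hol: "fr n holomorphic_on ball 0 1" for n
  proof -
    have "(f \<circ> (\<lambda>\<zeta>. of_real (r n) * \<zeta>)) holomorphic_on ball 0 1"
      by (intro holomorphic_on_compose_gen[OF _ f] holomorphic_intros) (use in_ball in force)
    then show ?thesis by (simp add: fr_def[abs_def] o_def)
  qed
  have H_cont: "continuous_on S (H n)" for S n
    using holomorphic_on_imp_continuous_on[OF Hh] continuous_on_subset by blast
  have H_hol: "H n holomorphic_on S" for S n using Hh holomorphic_on_subset by blast
  have max: "u \<zeta> \<le> B"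
    if "continuous_on (cball 0 1) u" "harmonic_on (ball 0 1) u" "\<And>\<xi>. norm \<xi> = 1 \<Longrightarrow> u \<xi> \<le> B"
      "\<zeta> \<in> ball 0 1" for u B and \<zeta> :: complex
    by (rule harmonic_max_principle[of "ball 0 1"]) (use that in auto)
  have H_on_circle: "Re (H n \<xi>) \<le> (norm (fr n \<xi>))\<^sup>2 + e n" "(norm (fr n \<xi>))\<^sup>2 - e n \<le> Re (H n \<xi>)"
    if "norm \<xi> = 1" for n \<xi>
    using H[OF that, of n] by (auto simp: fr_def abs_le_iff)
  have H_le: "Re (H n \<zeta>) \<le> R\<^sup>2 + 1" if "\<zeta> \<in> ball 0 1" for n \<zeta>
  proof (rule max[OF _ _ _ that])
    show "continuous_on (cball 0 1) (\<lambda>\<zeta>. Re (H n \<zeta>))" by (intro continuous_intros H_cont)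
    show "harmonic_on (ball 0 1) (\<lambda>\<zeta>. Re (H n \<zeta>))" by (intro harmonic_on_Re H_hol open_ball)
    fix \<xi> :: complex assume \<xi>: "norm \<xi> = 1"
    have "(norm (fr n \<xi>))\<^sup>2 \<le> R\<^sup>2" using R[OF fr_in, of \<xi> n] \<xi> by (intro power_mono) auto
    then show "Re (H n \<xi>) \<le> R\<^sup>2 + 1" using H_on_circle(1)[OF \<xi>, of n] e(2)[of n] by linarith
  qed
  have H_ge: "(norm (fr n \<zeta>))\<^sup>2 - e n \<le> Re (H n \<zeta>)" if \<zeta>: "\<zeta> \<in> ball 0 1" for n \<zeta>
  proof -
    \<comment> \<open>compare with the tangent of the convex function \<open>\<bar>w\<bar>\<^sup>2\<close> at \<open>a\<close>, which is harmonic\<close>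
    define a where "a = fr n \<zeta>"
    have sq: "2 * Re (cnj a * w) \<le> (norm a)\<^sup>2 + (norm w)\<^sup>2" for w
    proof -
      have "(norm a)\<^sup>2 + (norm w)\<^sup>2 - 2 * Re (cnj a * w) = (norm (w - a))\<^sup>2"
        unfolding cmod_power2 by (simp add: power2_eq_square algebra_simps)
      then show ?thesis using zero_le_power2[of "norm (w - a)"] by linarith
    qed
    have "Re (2 * cnj a * fr n \<zeta> - H n \<zeta>) \<le> (norm a)\<^sup>2 + e n"
    proof (rule max[OF _ _ _ \<zeta>])
      show "continuous_on (cball 0 1) (\<lambda>\<zeta>. Re (2 * cnj a * fr n \<zeta> - H n \<zeta>))"
        by (intro continuous_intros H_cont fr_cont)
      show "harmonic_on (ball 0 1) (\<lambda>\<zeta>. Re (2 * cnj a * fr n \<zeta> - H n \<zeta>))"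
        by (intro harmonic_on_Re holomorphic_intros H_hol fr_hol open_ball)
      fix \<xi> :: complex assume "norm \<xi> = 1"
      from H_on_circle(2)[OF this, of n] sq[of "fr n \<xi>"]
      show "Re (2 * cnj a * fr n \<xi> - H n \<xi>) \<le> (norm a)\<^sup>2 + e n" by simp
    qed
    moreover have "Re (2 * cnj a * fr n \<zeta>) = 2 * (norm a)\<^sup>2"
      unfolding a_def[symmetric] cmod_power2 by (simp add: power2_eq_square)
    ultimately show ?thesis by (simp add: a_def)
  qed
  define \<H> where "\<H> = {h. h holomorphic_on ball 0 1 \<and> (\<forall>\<zeta>\<in>ball 0 1. norm (h \<zeta>) \<le> exp (R\<^sup>2 + 1))}"
  obtain E k where E: "E holomorphic_on ball 0 1" and k: "strict_mono (k :: nat \<Rightarrow> nat)"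
    and lim: "\<And>\<zeta>. \<zeta> \<in> ball 0 1 \<Longrightarrow> (\<lambda>n. exp (H (k n) \<zeta>)) \<longlonglongrightarrow> E \<zeta>"
  proof (rule Montel[of "ball 0 1" \<H> "\<lambda>n \<zeta>. exp (H n \<zeta>)"])
    show "range (\<lambda>n \<zeta>. exp (H n \<zeta>)) \<subseteq> \<H>"
      using H_le by (auto simp: \<H>_def intro!: holomorphic_intros H_hol)
    show "\<exists>B. \<forall>h\<in>\<H>. \<forall>z\<in>K. norm (h z) \<le> B" if "K \<subseteq> ball 0 1" for K
      using that by (intro exI[of _ "exp (R\<^sup>2 + 1)"]) (auto simp: \<H>_def)
  qed (auto simp: \<H>_def)
  have E_low: "exp (- 1) \<le> norm (E \<zeta>)" if \<zeta>: "\<zeta> \<in> ball 0 1" for \<zeta>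
  proof (rule LIMSEQ_le_const[OF tendsto_norm[OF lim[OF \<zeta>]]], intro exI allI impI)
    fix n
    have "- 1 \<le> Re (H (k n) \<zeta>)"
      using H_ge[OF \<zeta>, of "k n"] e(2)[of "k n"] zero_le_power2[of "norm (fr (k n) \<zeta>)"] by linarith
    then show "exp (- 1) \<le> norm (exp (H (k n) \<zeta>))" by simp
  qed
  have E0: "E \<zeta> \<noteq> 0" if "\<zeta> \<in> ball 0 1" for \<zeta>
    using E_low[OF that] exp_gt_zero[of "-1"] by (metis norm_zero not_less)
  obtain g where g: "g holomorphic_on ball 0 1" "\<And>\<zeta>. \<zeta> \<in> ball 0 1 \<Longrightarrow> E \<zeta> = exp (g \<zeta>)"
    using contractible_imp_holomorphic_log[OF E] E0 convex_imp_contractible[OF convex_ball] by metis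
  have H_lim: "(\<lambda>n. Re (H (k n) \<zeta>)) \<longlonglongrightarrow> Re (g \<zeta>)" if \<zeta>: "\<zeta> \<in> ball 0 1" for \<zeta>
  proof -
    have "(\<lambda>n. ln (norm (exp (H (k n) \<zeta>)))) \<longlonglongrightarrow> ln (norm (E \<zeta>))"
      by (intro tendsto_ln tendsto_norm lim \<zeta>) (use E0[OF \<zeta>] in simp)
    then show ?thesis using g(2)[OF \<zeta>] by simp
  qed
  have e_lim': "(\<lambda>n. e (k n)) \<longlonglongrightarrow> 0"
    using LIMSEQ_subseq_LIMSEQ[OF e_lim k] by (simp add: o_def)
  have fr_lim: "(\<lambda>n. fr (k n) \<zeta>) \<longlonglongrightarrow> f \<zeta>" if \<zeta>: "\<zeta> \<in> ball 0 1" for \<zeta>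
  proof -
    have "(\<lambda>n. r (k n)) \<longlonglongrightarrow> 1" using LIMSEQ_subseq_LIMSEQ[OF r_lim k] by (simp add: o_def)
    then have "(\<lambda>n. of_real (r (k n)) * \<zeta>) \<longlonglongrightarrow> of_real 1 * \<zeta>"
      by (intro tendsto_intros)
    moreover have "isCont f \<zeta>"
      using holomorphic_on_imp_continuous_on[OF f] \<zeta> by (simp add: continuous_on_eq_continuous_at)
    ultimately show ?thesis unfolding fr_def using isCont_tendsto_compose
        by (metis mult_1 of_real_1)
  qed
  define v where "v z = (if z \<in> \<Omega> then Re (g (\<phi> z)) / 2 - (norm z)\<^sup>2 / 2 else 0)" for z
  have v0: "0 \<le> v z" for z
  proof (cases "z \<in> \<Omega>")
    case True
    then have \<zeta>: "\<phi> z \<in> ball 0 1" "f (\<phi> z) = z" using \<phi>f by auto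
    have "(norm (f (\<phi> z)))\<^sup>2 - 0 \<le> Re (g (\<phi> z))"
      by (rule LIMSEQ_le[OF tendsto_diff[OF tendsto_power[OF tendsto_norm[OF fr_lim[OF \<zeta>(1)]]] e_lim']
            H_lim[OF \<zeta>(1)]]) (use H_ge[OF \<zeta>(1)] in auto)
    then show ?thesis using True \<zeta> by (simp add: v_def)
  qed (simp add: v_def)
  have barrier: "v z \<le> (R + norm c)\<^sup>2 * ln (norm (z - c) / \<rho>) - ((norm (z - c))\<^sup>2 - \<rho>\<^sup>2) / 2"
    if \<rho>: "0 < \<rho>" and c: "\<And>p. p \<in> \<Omega> \<Longrightarrow> \<rho> \<le> norm (p - c)" and z: "z \<in> \<Omega>" for c \<rho> z
  proof -
    define A where "A = (R + norm c)\<^sup>2"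
    define W where "W p = A * ln (norm (p - c) / \<rho>) - ((norm (p - c))\<^sup>2 - \<rho>\<^sup>2) / 2" for p
    have ne: "p - c \<noteq> 0" if "p \<in> \<Omega>" for p using c[OF that] \<rho> by auto
    have W0: "0 \<le> W p" if "p \<in> \<Omega>" for p
      unfolding W_def A_def using R[OF that] norm_triangle_ineq4[of p c]
      by (intro log_barrier_nonneg \<rho> c that) linarith
    \<comment> \<open>the quadratic terms cancel, so that the difference is harmonic\<close>
    have W_eq: "Re (h / 2) - (norm p)\<^sup>2 / 2 - W p =
        Re (h / 2 - cnj c * p + of_real ((norm c)\<^sup>2 / 2 + A * ln \<rho> - \<rho>\<^sup>2 / 2)) + (- A) * ln (norm
            (p - c))"
      if "p \<in> \<Omega>" for h p
    proof -
      have "A * ln (norm (p - c) / \<rho>) = A * ln (norm (p - c)) - A * ln \<rho>"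
        using ne[OF that] \<rho> by (simp add: ln_div right_diff_distrib)
      moreover have "(norm (p - c))\<^sup>2 = (norm p)\<^sup>2 - 2 * Re (cnj c * p) + (norm c)\<^sup>2"
        unfolding cmod_power2 by (simp add: power2_eq_square algebra_simps)
      ultimately show ?thesis by (simp add: W_def algebra_simps add_divide_distrib
          diff_divide_distrib)
    qed
    have W_cont: "isCont W p" if "p \<in> \<Omega>" for p
      unfolding W_def using ne[OF that] \<rho> by (intro continuous_intros) auto
    define \<zeta> where "\<zeta> = \<phi> z"
    have \<zeta>: "\<zeta> \<in> ball 0 1" "f \<zeta> = z" using \<phi>f z by (auto simp: \<zeta>_def)
    have main: "Re (H n \<zeta> / 2) - (norm (fr n \<zeta>))\<^sup>2 / 2 - W (fr n \<zeta>) \<le> e n / 2" for n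
    proof -
      define u where "u \<zeta> = Re (H n \<zeta> / 2 - cnj c * fr n \<zeta> + of_real ((norm c)\<^sup>2 / 2 + A * ln \<rho> -
          \<rho>\<^sup>2 / 2))
          + (- A) * ln (norm (fr n \<zeta> - c))" for \<zeta>
      have u: "Re (H n \<xi> / 2) - (norm (fr n \<xi>))\<^sup>2 / 2 - W (fr n \<xi>) = u \<xi>" if "\<xi> \<in> cball 0 1" for \<xi>
        unfolding u_def by (rule W_eq[OF fr_in[OF that]])
      have "u \<zeta> \<le> e n / 2"
      proof (rule max[OF _ _ _ \<zeta>(1)])
        show "continuous_on (cball 0 1) u"
          unfolding u_def by (intro continuous_intros H_cont fr_cont) (use ne[OF fr_in] in auto)
        show "harmonic_on (ball 0 1) u"
          unfolding u_def
          by (intro harmonic_on_add harmonic_on_cmul harmonic_on_Re harmonic_on_ln_norm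
              holomorphic_intros
              H_hol fr_hol open_ball) (use ne[OF fr_in] in auto)
        fix \<xi> :: complex assume \<xi>: "norm \<xi> = 1"
        have "u \<xi> = Re (H n \<xi>) / 2 - (norm (fr n \<xi>))\<^sup>2 / 2 - W (fr n \<xi>)"
          using u[of \<xi>] \<xi> by simp
        also have "\<dots> \<le> e n / 2"
          using H_on_circle(1)[OF \<xi>, of n] W0[OF fr_in[of \<xi> n]] \<xi> by simp
        finally show "u \<xi> \<le> e n / 2" .
      qed
      then show ?thesis using u[of \<zeta>] \<zeta> by simp
    qed
    have "Re (g \<zeta>) / 2 - (norm (f \<zeta>))\<^sup>2 / 2 - W (f \<zeta>) \<le> 0 / 2"
    proof (rule LIMSEQ_le)
      show "(\<lambda>n. Re (H (k n) \<zeta>) / 2 - (norm (fr (k n) \<zeta>))\<^sup>2 / 2 - W (fr (k n) \<zeta>))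
          \<longlonglongrightarrow> Re (g \<zeta>) / 2 - (norm (f \<zeta>))\<^sup>2 / 2 - W (f \<zeta>)"
        by (intro tendsto_intros H_lim fr_lim \<zeta>(1) isCont_tendsto_compose[OF W_cont]) (use \<zeta> z in
            auto)
      show "(\<lambda>n. e (k n) / 2) \<longlonglongrightarrow> 0 / 2" by (intro tendsto_intros e_lim') auto
    qed (use main in auto)
    then show ?thesis using z \<zeta> by (simp add: v_def W_def A_def \<zeta>_def)
  qed
  define G where "G z = 1 / 2 * g (\<phi> z)" for z
  have "(g \<circ> \<phi>) holomorphic_on \<Omega>"
    by (rule holomorphic_on_compose_gen[OF \<phi> g(1)]) (use \<phi>f in auto)
  then have G: "G holomorphic_on \<Omega>"
    using holomorphic_on_mult[OF holomorphic_on_const[of "1 / 2"]]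
    unfolding G_def[abs_def] o_def by blast
  have vG: "v z = Re (G z) - (norm z)\<^sup>2 / 2" if "z \<in> \<Omega>" for z
    using that by (simp add: v_def G_def)
  have "continuous_on \<Omega> (\<lambda>z. Re (G z) - (norm z)\<^sup>2 / 2)"
    by (intro continuous_intros holomorphic_on_imp_continuous_on[OF G]) simp
  then have vcont: "continuous_on \<Omega> v" using vG by (simp cong: continuous_on_cong)
  have "continuous_on (closure \<Omega>) v"
    unfolding continuous_on_eq_continuous_within
  proof
    fix x assume x: "x \<in> closure \<Omega>"
    show "continuous (at x within closure \<Omega>) v"
    proof (cases "x \<in> \<Omega>")
      case True
      then have "isCont v x" using vcont \<Omega>(1) by (simp add: continuous_on_eq_continuous_at)
      then show ?thesis using continuous_at_imp_continuous_at_within by blast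
    next
      case False
      then have "x \<in> frontier \<Omega>" using x \<Omega>(1) by (simp add: frontier_def interior_open)
      then obtain c \<rho> where c: "0 < \<rho>" "norm (x - c) = \<rho>" "\<forall>p\<in>\<Omega>. \<rho> \<le> norm (p - c)"
        using ext by blast
      define W where "W z = (R + norm c)\<^sup>2 * ln (norm (z - c) / \<rho>) - ((norm (z - c))\<^sup>2 - \<rho>\<^sup>2) / 2"
          for z
      have "isCont W x" unfolding W_def using c by (intro continuous_intros) auto
      moreover have "W x = 0" using c by (simp add: W_def)
      ultimately have W: "(W \<longlongrightarrow> 0) (at x)" by (simp add: isCont_def)
      have "(v \<longlongrightarrow> 0) (at x)"
      proof (rule Lim_null_comparison[OF always_eventually tendsto_rabs_zero[OF W]], intro allI)
        show "norm (v z) \<le> \<bar>W z\<bar>" for z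
        proof (cases "z \<in> \<Omega>")
          case True
          then have "v z \<le> W z" unfolding W_def using barrier[OF c(1) _ True] c(3) by blast
          then show ?thesis using v0[of z] by simp
        qed (simp add: v_def)
      qed
      moreover have "v x = 0" using False by (simp add: v_def)
      ultimately have "isCont v x" by (simp add: isCont_def)
      then show ?thesis using continuous_at_imp_continuous_at_within by blast
    qed
  qed
  then show thesis
    using that[OF G, of v] vG v0 by (simp add: v_def)
qed

lemma torsion_function_of_holomorphic:
  assumes U: "open U" and G: "G holomorphic_on U"
      and v: "\<And>z. z \<in> U \<Longrightarrow> v z = Re (G z) - (norm z)\<^sup>2 / 2"
  shows "C2_on U v" "\<And>z. z \<in> U \<Longrightarrow> laplacian v z = -2"
proof -
  have dd: "(u has_derivative u') (at z) \<Longrightarrow> dir_deriv b u z = u' b" for u u' b and z :: complex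
    unfolding dir_deriv_def using frechet_derivative_at by metis
  have G': "deriv G holomorphic_on U" "deriv (deriv G) holomorphic_on U"
    using G U by (auto intro: holomorphic_deriv)
  have Gd: "(G has_derivative (\<lambda>h. deriv G z * h)) (at z)"
    and G'd: "(deriv G has_derivative (\<lambda>h. deriv (deriv G) z * h)) (at z)" if "z \<in> U" for z
    using holomorphic_derivI[OF G U that] holomorphic_derivI[OF G'(1) U that]
    by (auto simp: has_field_derivative_def)
  have v1: "(v has_derivative (\<lambda>h. Re (deriv G z * h) - z \<bullet> h)) (at z)" if z: "z \<in> U" for z
  proof -
    have "((\<lambda>z. z \<bullet> z) has_derivative (\<lambda>h. z \<bullet> h + h \<bullet> z)) (at z)"
      by (intro has_derivative_inner has_derivative_ident)
    then have "((\<lambda>z. Re (G z) - 1 / 2 * (z \<bullet> z)) has_derivative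
        (\<lambda>h. Re (deriv G z * h) - 1 / 2 * (z \<bullet> h + h \<bullet> z))) (at z)"
      by (intro has_derivative_diff has_derivative_mult_right
          bounded_linear.has_derivative[OF bounded_linear_Re] Gd z)
    then have "((\<lambda>z. Re (G z) - (z \<bullet> z) / 2) has_derivative (\<lambda>h. Re (deriv G z * h) - z \<bullet> h)) (at
        z)"
      by (simp add: inner_commute)
    then show ?thesis
      by (rule has_derivative_transform_within_open[OF _ U z]) (simp add: v power2_norm_eq_inner)
  qed
  have d1: "dir_deriv b v z = Re (deriv G z * b) - z \<bullet> b" if "z \<in> U" for b z
    using dd[OF v1[OF that]] .
  have v2: "(dir_deriv b v has_derivative (\<lambda>h. Re (deriv (deriv G) z * h * b) - h \<bullet> b)) (at z)"
    if z: "z \<in> U" for b z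
  proof -
    have "((\<lambda>z. Re (deriv G z * b) - z \<bullet> b) has_derivative
        (\<lambda>h. Re (deriv (deriv G) z * h * b) - h \<bullet> b)) (at z)"
      by (intro derivative_intros G'd z bounded_linear.has_derivative[OF bounded_linear_Re])
    then show ?thesis
      by (rule has_derivative_transform_within_open[OF _ U z]) (simp add: d1)
  qed
  have d2: "dir_deriv c (dir_deriv b v) z = Re (deriv (deriv G) z * c * b) - c \<bullet> b" if "z \<in> U"
      for b c z
    using dd[OF v2[OF that]] .
  have "continuous_on U (dir_deriv c (dir_deriv b v))" for b c
  proof -
    have "continuous_on U (\<lambda>z. Re (deriv (deriv G) z * c * b) - c \<bullet> b)"
      by (intro continuous_intros holomorphic_on_imp_continuous_on[OF G'(2)])
    then show ?thesis using d2 by (simp cong: continuous_on_cong)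
  qed
  then show "C2_on U v"
    unfolding C2_on_def using v1 v2 differentiableI by blast
  show "laplacian v z = -2" if "z \<in> U" for z
    using d2[OF that] by (simp add: laplacian_def Basis_complex_def)
qed

section \<open>Comparison with the strip and with the annulus\<close>

lemma cos_ge_half: "\<bar>b\<bar> \<le> 1 \<Longrightarrow> 1 / 2 \<le> cos (b::real)"
  using cos_monotone_0_pi_le[of "\<bar>b\<bar>" "pi / 3"] pi_gt3 by (simp add: cos_60)

text \<open>This is \<open>2 cosh x cos y\<close> at \<open>w = x + \<i> y\<close>, a harmonic function, positive in the strip \<open>\<bar>y\<bar>
\<le> 1\<close>, that grows exponentially along it. It absorbs unknown boundary values at the far ends of a
thin tube at an exponentially small cost in the middle.\<close>

definition ripple :: "complex \<Rightarrow> real" where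
  "ripple w = Re (exp w + exp (- w))"

lemma ripple: "ripple w = (exp (Re w) + exp (- Re w)) * cos (Im w)"
  by (simp add: ripple_def Re_exp algebra_simps)

lemma ripple_nonneg: "\<bar>Im w\<bar> \<le> 1 \<Longrightarrow> 0 \<le> ripple w"
  unfolding ripple using cos_ge_half[of "Im w"] by (intro mult_nonneg_nonneg add_nonneg_nonneg) auto

lemma ripple_ge: "\<bar>Im w\<bar> \<le> 1 \<Longrightarrow> exp \<bar>Re w\<bar> / 2 \<le> ripple w"
proof -
  assume "\<bar>Im w\<bar> \<le> 1"
  then have "exp \<bar>Re w\<bar> * (1 / 2) \<le> (exp (Re w) + exp (- Re w)) * cos (Im w)"
    using cos_ge_half by (intro mult_mono add_nonneg_nonneg) (auto simp: abs_if)
  then show ?thesis by (simp add: ripple)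
qed

locale torsion_pair =
  fixes \<Omega> :: "complex set" and v :: "complex \<Rightarrow> real" and G :: "complex \<Rightarrow> complex"
  assumes open_dom: "open \<Omega>" and bounded_dom: "bounded \<Omega>" and G: "G holomorphic_on \<Omega>"
    and v_eq: "\<And>z. z \<in> \<Omega> \<Longrightarrow> v z = Re (G z) - (norm z)\<^sup>2 / 2"
    and v_cont: "continuous_on (closure \<Omega>) v"
    and v_out: "\<And>z. z \<notin> \<Omega> \<Longrightarrow> v z = 0" and v_nonneg: "\<And>z. 0 \<le> v z"
begin

lemma v_le:
  assumes R: "\<And>z. z \<in> \<Omega> \<Longrightarrow> norm z \<le> R"
  shows "v z \<le> R\<^sup>2 / 2"
proof (cases "z \<in> \<Omega>")
  case True
  have "v z + (norm z)\<^sup>2 / 2 \<le> R\<^sup>2 / 2"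
  proof (rule harmonic_max_principle[OF open_dom bounded_dom _ _ _ True])
    show "continuous_on (closure \<Omega>) (\<lambda>z. v z + (norm z)\<^sup>2 / 2)"
      by (intro continuous_intros v_cont) auto
    have "harmonic_on \<Omega> (\<lambda>z. Re (G z))" by (intro harmonic_on_Re open_dom G)
    then show "harmonic_on \<Omega> (\<lambda>z. v z + (norm z)\<^sup>2 / 2)"
      by (rule harmonic_on_cong) (auto simp: v_eq open_dom)
    fix w assume w: "w \<in> frontier \<Omega>"
    then have "w \<notin> \<Omega>" using open_dom by (auto simp: frontier_def interior_open)
    moreover have "norm w \<le> R"
    proof -
      have "closure \<Omega> \<subseteq> cball 0 R" using R by (intro closure_minimal) auto
      then show ?thesis using w by (auto simp: frontier_def)
    qed
    then have "(norm w)\<^sup>2 \<le> R\<^sup>2" by (intro power_mono) auto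
    ultimately show "v w + (norm w)\<^sup>2 / 2 \<le> R\<^sup>2 / 2" by (simp add: v_out)
  qed
  then show ?thesis using zero_le_power2[of "norm z"] by linarith
qed (simp add: v_out)

text \<open>Only the part of the domain within distance \<open>1 / 2\<close> of the cut is used. There \<open>\<epsilon>\<^sup>2 - (y -
h)\<^sup>2\<close> plus a multiple of \<open>ripple\<close> with wavelength of order \<open>\<epsilon>\<close> dominates \<open>v\<close>.\<close>

lemma strip_upper_bound:
  assumes C: "0 \<le> C" "\<And>z. v z \<le> C" and \<epsilon>: "0 < \<epsilon>" "\<epsilon> < 1 / 2"
    and strip: "\<And>z. z \<in> \<Omega> \<Longrightarrow> \<bar>Re z\<bar> < 1 / 2 \<Longrightarrow> \<bar>Im z - h\<bar> < 1 / 2 \<Longrightarrow> \<bar>Im z - h\<bar> < \<epsilon>"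
    and z: "z \<in> \<Omega>" "Re z = 0" "\<bar>Im z - h\<bar> < 1 / 2"
  shows "v z \<le> \<epsilon>\<^sup>2 + 4 * C * exp (- 1 / (2 * \<epsilon>))"
proof -
  \<comment> \<open>makes \<open>C' * ripple\<close> at least \<open>C\<close> at distance \<open>1 / 2\<close> from the cut\<close>
  define C' where "C' = 2 * C * exp (- 1 / (2 * \<epsilon>))"
  define q where "q w = of_real (1 / \<epsilon>) * (w - \<i> * of_real h)" for w
  have q: "Re (q w) = Re w / \<epsilon>" "Im (q w) = (Im w - h) / \<epsilon>" for w by (simp_all add: q_def)
  define W where "W w = \<epsilon>\<^sup>2 - (Im w - h)\<^sup>2 + C' * ripple (q w)" for w
  define Q where "Q = \<Omega> \<inter> {w. \<bar>Re w\<bar> < 1 / 2} \<inter> {w. \<bar>Im w - h\<bar> < 1 / 2}"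
  have "open Q"
    unfolding Q_def by (intro open_Int open_dom open_Collect_less continuous_intros)
  moreover have "bounded Q" using bounded_dom by (rule bounded_subset) (auto simp: Q_def)
  moreover have "continuous_on (closure Q) (\<lambda>w. v w - W w)"
  proof -
    have "closure Q \<subseteq> closure \<Omega>" by (intro closure_mono) (auto simp: Q_def)
    then have "continuous_on (closure Q) v" using v_cont continuous_on_subset by blast
    then show ?thesis unfolding W_def ripple_def q_def by (intro continuous_intros)
  qed
  moreover have "harmonic_on Q (\<lambda>w. v w - W w)"
  proof (rule harmonic_on_cong[OF harmonic_on_Re[OF \<open>open Q\<close>] \<open>open Q\<close>])
    show "(\<lambda>w. G w - w\<^sup>2 / 2 + 2 * of_real h * \<i> * w + of_real (h\<^sup>2 - \<epsilon>\<^sup>2)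
        - of_real C' * (exp (q w) + exp (- q w))) holomorphic_on Q"
      unfolding q_def by (intro holomorphic_intros holomorphic_on_subset[OF G]) (auto simp: Q_def)
    fix w assume "w \<in> Q"
    then have "v w = Re (G w) - (norm w)\<^sup>2 / 2" by (auto simp: Q_def v_eq)
    then show "v w - W w = Re (G w - w\<^sup>2 / 2 + 2 * of_real h * \<i> * w + of_real (h\<^sup>2 - \<epsilon>\<^sup>2)
        - of_real C' * (exp (q w) + exp (- q w)))"
      unfolding cmod_power2 W_def ripple_def by (simp add: power2_eq_square field_simps)
  qed
  moreover have "v w - W w \<le> 0" if w: "w \<in> frontier Q" for w
  proof -
    have "Q \<subseteq> {w. \<bar>Re w\<bar> \<le> 1 / 2} \<inter> {w. \<bar>Im w - h\<bar> \<le> \<epsilon>}"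
      using strip by (force simp: Q_def)
    moreover have "closed ({w. \<bar>Re w\<bar> \<le> 1 / 2} \<inter> {w. \<bar>Im w - h\<bar> \<le> \<epsilon>})"
      by (intro closed_Int closed_Collect_le continuous_intros)
    ultimately have "closure Q \<subseteq> {w. \<bar>Re w\<bar> \<le> 1 / 2} \<inter> {w. \<bar>Im w - h\<bar> \<le> \<epsilon>}"
      by (rule closure_minimal)
    then have w': "\<bar>Re w\<bar> \<le> 1 / 2" "\<bar>Im w - h\<bar> \<le> \<epsilon>" using w by (auto simp: frontier_def)
    have Imq: "\<bar>Im (q w)\<bar> \<le> 1" using w'(2) \<epsilon> by (simp add: q)
    have sq: "(Im w - h)\<^sup>2 \<le> \<epsilon>\<^sup>2" using w'(2) \<epsilon> by (intro power2_le_iff_abs_le[THEN iffD2]) auto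
    have C': "0 \<le> C'" using C by (simp add: C'_def)
    have "w \<notin> Q" using w \<open>open Q\<close> by (auto simp: frontier_def interior_open)
    show ?thesis
    proof (cases "w \<in> \<Omega>")
      case False
      then show ?thesis using sq mult_nonneg_nonneg[OF C' ripple_nonneg[OF Imq]]
          by (simp add: v_out W_def)
    next
      case True
      then have "\<bar>Re w\<bar> = 1 / 2" using \<open>w \<notin> Q\<close> w' \<epsilon> by (auto simp: Q_def)
      then have "\<bar>Re (q w)\<bar> = 1 / (2 * \<epsilon>)"
        unfolding q abs_divide using \<epsilon> by (simp add: field_simps)
      then have "exp (1 / (2 * \<epsilon>)) / 2 \<le> ripple (q w)"
        using ripple_ge[OF Imq] by simp
      then have "C' * (exp (1 / (2 * \<epsilon>)) / 2) \<le> C' * ripple (q w)" using C'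
          by (intro mult_left_mono)
      moreover have "C' * (exp (1 / (2 * \<epsilon>)) / 2) = C" by (simp add: C'_def exp_minus)
      ultimately show ?thesis using sq C(2)[of w] by (simp add: W_def)
    qed
  qed
  moreover have "z \<in> Q" using z by (simp add: Q_def)
  ultimately have "v z - W z \<le> 0" by (rule harmonic_max_principle)
  then have "v z \<le> \<epsilon>\<^sup>2 - (Im z - h)\<^sup>2 + C' * ripple (q z)" by (simp add: W_def)
  moreover have "C' * ripple (q z) \<le> C' * 2"
    using C z(2) by (intro mult_left_mono) (auto simp: ripple q C'_def)
  moreover have "C' * 2 = 4 * C * exp (- 1 / (2 * \<epsilon>))" by (simp add: C'_def)
  ultimately show ?thesis using zero_le_power2[of "Im z - h"] by linarith
qed

text \<open>The comparison takes place in the coordinate \<open>\<zeta>\<close> with \<open>z = c + \<sigma> exp \<zeta>\<close>, in which the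
sector becomes a rectangle and \<open>ripple\<close> is available again. The radial torsion function of the
annulus is \<open>- \<rho>\<^sup>2 / 2 + A ln \<rho> + B\<close>, with \<open>A\<close> and \<open>B\<close> determined by its zeros at \<open>\<rho> = 1 - e\<close> and
\<open>\<rho> = 1 + e\<close>.\<close>

lemma annulus_lower_bound:
  assumes \<sigma>: "norm \<sigma> = 1" and e: "0 < e" "e < 1 / 2"
    and sector: "\<And>\<rho> \<theta>. 1 - e < \<rho> \<Longrightarrow> \<rho> < 1 + e \<Longrightarrow> \<bar>\<theta>\<bar> < 1 / 2 \<Longrightarrow> c + \<sigma> * (of_real \<rho> * cis \<theta>) \<in> \<Omega>"
  shows "(1 + e)\<^sup>2 / 2 - 1 / 2 - 2 * e / (ln (1 + e) - ln (1 - e)) * ln (1 + e) - 8 * exp (- 1 /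
      (4 * e)) \<le> v (c + \<sigma>)"
proof -
  define t0 t1 where "t0 = ln (1 - e)" and "t1 = ln (1 + e)"
  define A where "A = 2 * e / (t1 - t0)"
  define B where "B = (1 + e)\<^sup>2 / 2 - A * t1"
  have ex: "exp t0 = 1 - e" "exp t1 = 1 + e" using e by (auto simp: t0_def t1_def)
  have t: "t0 < 0" "0 < t1" using e by (auto simp: t0_def t1_def)
  have tb: "- 2 * e \<le> t0" "t1 \<le> 2 * e"
  proof -
    have "ln (1 / (1 - e)) \<le> 1 / (1 - e) - 1" using e by (intro ln_le_minus_one) simp
    also have "\<dots> \<le> 2 * e" using e by (simp add: field_simps)
    finally show "- 2 * e \<le> t0" using e by (simp add: t0_def ln_div)
    show "t1 \<le> 2 * e" unfolding t1_def using ln_add_one_self_le_self[of e] e by simp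
  qed
  have A: "0 < A" "A * (t1 - t0) = 2 * e" using e t by (auto simp: A_def)
  \<comment> \<open>makes \<open>C0 * ripple\<close> at least \<open>2\<close>, an upper bound for \<open>V\<close>, at the ends \<open>\<bar>Im \<zeta>\<bar> = 1 / 2\<close>\<close>
  define C0 where "C0 = 4 * exp (- 1 / (4 * e))"
  define V where "V x = - (exp x)\<^sup>2 / 2 + A * x + B" for x
  have V0: "V t0 = 0" "V t1 = 0"
    using A(2) by (auto simp: V_def ex B_def power2_eq_square field_simps)
  define q where "q \<zeta> = - \<i> * of_real (1 / (2 * e)) * \<zeta>" for \<zeta>
  have q: "Re (q \<zeta>) = Im \<zeta> / (2 * e)" "Im (q \<zeta>) = - Re \<zeta> / (2 * e)" for \<zeta> by (simp_all add: q_def)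
  define w where "w \<zeta> = V (Re \<zeta>) - C0 * ripple (q \<zeta>)" for \<zeta>
  define m where "m \<zeta> = c + \<sigma> * exp \<zeta>" for \<zeta>
  define S where "S = {\<zeta>. t0 < Re \<zeta>} \<inter> {\<zeta>. Re \<zeta> < t1} \<inter> {\<zeta>. \<bar>Im \<zeta>\<bar> < 1 / 2}"
  define S' where "S' = {\<zeta>. t0 \<le> Re \<zeta>} \<inter> {\<zeta>. Re \<zeta> \<le> t1} \<inter> {\<zeta>. \<bar>Im \<zeta>\<bar> \<le> 1 / 2}"
  have "open S" unfolding S_def by (intro open_Int open_Collect_less continuous_intros)
  have clS: "closure S \<subseteq> S'"
  proof (rule closure_minimal)
    show "closed S'" unfolding S'_def by (intro closed_Int closed_Collect_le continuous_intros)
  qed (auto simp: S_def S'_def)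
  have "bounded S"
  proof -
    have "norm \<zeta> \<le> 2" if "\<zeta> \<in> S" for \<zeta>
      using cmod_le[of \<zeta>] that tb e by (auto simp: S_def abs_if split: if_splits)
    then show ?thesis by (auto simp: bounded_iff)
  qed
  have mS: "m ` S \<subseteq> \<Omega>"
  proof
    fix x assume "x \<in> m ` S"
    then obtain \<zeta> where \<zeta>: "\<zeta> \<in> S" "x = m \<zeta>" by blast
    have "exp t0 < exp (Re \<zeta>)" "exp (Re \<zeta>) < exp t1" using \<zeta> by (auto simp: S_def)
    then have "c + \<sigma> * (of_real (exp (Re \<zeta>)) * cis (Im \<zeta>)) \<in> \<Omega>"
      using \<zeta> by (intro sector) (auto simp: ex S_def)
    moreover have "exp \<zeta> = of_real (exp (Re \<zeta>)) * cis (Im \<zeta>)"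
      by (simp add: exp_eq_polar)
    ultimately show "x \<in> \<Omega>" using \<zeta> by (simp add: m_def)
  qed
  have m_cont: "continuous_on X m" for X unfolding m_def by (intro continuous_intros)
  have mcl: "m ` closure S \<subseteq> closure \<Omega>"
    by (rule image_closure_subset[OF m_cont closed_closure]) (use mS closure_subset in blast)
  note \<open>open S\<close> \<open>bounded S\<close>
  moreover have "continuous_on (closure S) (\<lambda>\<zeta>. w \<zeta> - v (m \<zeta>))"
    unfolding w_def V_def ripple_def q_def
    by (intro continuous_intros continuous_on_compose2[OF v_cont m_cont mcl]) auto
  moreover have "harmonic_on S (\<lambda>\<zeta>. w \<zeta> - v (m \<zeta>))"
  proof (rule harmonic_on_cong[OF harmonic_on_Re[OF \<open>open S\<close>] \<open>open S\<close>])
    have "(G \<circ> m) holomorphic_on S"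
      by (rule holomorphic_on_compose_gen[OF _ G])
         (use mS in \<open>auto simp: m_def[abs_def] intro!: holomorphic_intros\<close>)
    then show "(\<lambda>\<zeta>. of_real A * \<zeta> + of_real (B + (norm c)\<^sup>2 / 2) - of_real C0 * (exp (q \<zeta>) + exp
        (- q \<zeta>))
        - (G \<circ> m) \<zeta> + cnj c * \<sigma> * exp \<zeta>) holomorphic_on S"
      unfolding q_def by (intro holomorphic_intros)
    fix \<zeta> assume "\<zeta> \<in> S"
    then have "v (m \<zeta>) = Re (G (m \<zeta>)) - (norm (m \<zeta>))\<^sup>2 / 2" using mS by (intro v_eq) auto
    moreover have "(norm (m \<zeta>))\<^sup>2 = (norm c)\<^sup>2 + 2 * Re (cnj c * \<sigma> * exp \<zeta>) + (exp (Re \<zeta>))\<^sup>2"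
    proof -
      have "(norm (c + x))\<^sup>2 = (norm c)\<^sup>2 + 2 * Re (cnj c * x) + (norm x)\<^sup>2" for x
        unfolding cmod_power2 by (simp add: power2_eq_square algebra_simps)
      from this[of "\<sigma> * exp \<zeta>"] show ?thesis
        using \<sigma> by (simp add: m_def norm_mult mult.assoc)
    qed
    ultimately show "w \<zeta> - v (m \<zeta>) = Re (of_real A * \<zeta> + of_real (B + (norm c)\<^sup>2 / 2)
        - of_real C0 * (exp (q \<zeta>) + exp (- q \<zeta>)) - (G \<circ> m) \<zeta> + cnj c * \<sigma> * exp \<zeta>)"
      by (simp add: w_def V_def ripple_def add_divide_distrib)
  qed
  moreover have "w \<zeta> - v (m \<zeta>) \<le> 0" if \<zeta>: "\<zeta> \<in> frontier S" for \<zeta>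
  proof -
    have \<zeta>': "t0 \<le> Re \<zeta>" "Re \<zeta> \<le> t1" "\<bar>Im \<zeta>\<bar> \<le> 1 / 2" using \<zeta> clS
        by (auto simp: frontier_def S'_def)
    have "\<zeta> \<notin> S" using \<zeta> \<open>open S\<close> by (auto simp: frontier_def interior_open)
    then have cs: "Re \<zeta> = t0 \<or> Re \<zeta> = t1 \<or> \<bar>Im \<zeta>\<bar> = 1 / 2" using \<zeta>' by (auto simp: S_def)
    have Imq: "\<bar>Im (q \<zeta>)\<bar> \<le> 1" using \<zeta>' tb e by (auto simp: q abs_le_iff field_simps)
    have C0: "0 \<le> C0" by (simp add: C0_def)
    have "w \<zeta> \<le> 0"
    proof (cases "\<bar>Im \<zeta>\<bar> = 1 / 2")
      case True
      then have "\<bar>Re (q \<zeta>)\<bar> = 1 / (4 * e)"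
        unfolding q abs_divide using e by (simp add: field_simps)
      then have "exp (1 / (4 * e)) / 2 \<le> ripple (q \<zeta>)"
        using ripple_ge[OF Imq] by simp
      then have "C0 * (exp (1 / (4 * e)) / 2) \<le> C0 * ripple (q \<zeta>)" using C0
          by (intro mult_left_mono)
      moreover have "C0 * (exp (1 / (4 * e)) / 2) = 2" by (simp add: C0_def exp_minus)
      moreover have "V (Re \<zeta>) \<le> 2"
      proof -
        have "A * Re \<zeta> \<le> A * t1" using A \<zeta>' by simp
        moreover have "(1 + e)\<^sup>2 \<le> 2\<^sup>2" using e by (intro power_mono) auto
        ultimately show ?thesis
          using zero_le_power2[of "exp (Re \<zeta>)"]
              unfolding V_def B_def power2_eq_square[of "2::real"] by linarith
      qed
      ultimately show ?thesis by (simp add: w_def)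
    next
      case False
      then have "V (Re \<zeta>) = 0" using cs V0 by auto
      then show ?thesis using mult_nonneg_nonneg[OF C0 ripple_nonneg[OF Imq]] by (simp add: w_def)
    qed
    then show ?thesis using v_nonneg[of "m \<zeta>"] by linarith
  qed
  moreover have "0 \<in> S" using t by (simp add: S_def)
  ultimately have "w 0 - v (m 0) \<le> 0" by (rule harmonic_max_principle)
  moreover have "w 0 = - 1 / 2 + B - 8 * exp (- 1 / (4 * e))"
    by (simp add: w_def V_def ripple q C0_def)
  ultimately show ?thesis
    by (simp add: m_def B_def A_def t0_def t1_def)
qed

end

text \<open>The right-hand side is \<open>e\<^sup>2 + e\<^sup>4 / 12 + O(e\<^sup>6)\<close>, the left-hand side \<open>e\<^sup>2 + O(e\<^sup>7)\<close>. The
outer radius \<open>e + e\<^sup>6\<close> of the tube and its inner radius \<open>e\<close> leave room for the taper.\<close>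

lemma bend_beats_strip:
  fixes C :: real
  assumes "C \<ge> 0"
  shows "\<forall>\<^sub>F e in at_right 0.
    (e + e ^ 6)\<^sup>2 + 4 * C * exp (- 1 / (2 * (e + e ^ 6)))
    < (1 + e)\<^sup>2 / 2 - 1 / 2 - 2 * e / (ln (1 + e) - ln (1 - e)) * ln (1 + e) - 8 * exp (- 1 /
        (4 * e))"
proof (cases "C = 0")
  case True
  then show ?thesis by simp real_asymp
next
  case False
  then have "C > 0" using assms by simp
  then show ?thesis by real_asymp
qed

section \<open>Many local maxima of the torsion function, one of the distance\<close>

theorem theorem1p2:
  fixes M :: nat and \<eta> :: real
  assumes "M > 1" and "\<eta> > 0"
  shows "\<exists>(\<Gamma> :: complex set) (z :: real \<Rightarrow> complex) (L :: real) (\<epsilon> :: real) (\<delta> :: real) (\<Omega> ::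
      complex set).
      alters_arcs_near_junctions M \<eta> \<Gamma> \<and> C3_arclength_param z L \<Gamma> \<and>
      \<epsilon> > \<delta> \<and> \<delta> > 0 \<and> (\<forall>s\<in>{0..L}. \<epsilon> - \<delta> * s > 0) \<and> \<Omega> = tapered_tube z L \<epsilon> \<delta> \<and>
      open \<Omega> \<and> connected \<Omega> \<and> bounded \<Omega> \<and> simply_connected \<Omega> \<and>
      (\<exists>v. is_torsion_function \<Omega> v \<and>
        (\<exists>A. A \<subseteq> local_max_points \<Omega> v \<and> finite A \<and> card A = M)) \<and>
      card (local_max_points \<Omega> (\<lambda>p. infdist p (frontier \<Omega>))) = 1"
proof -
  obtain K where M: "M = K + 2" using assms(1) by (metis Suc_1 Suc_leI le_Suc_ex add.commute)
  \<comment> \<open>a smaller smoothing radius also serves, and keeps the tips of the semicircles unaltered\<close>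
  define \<eta>0 where "\<eta>0 = min \<eta> (1 / 2)"
  have \<eta>0: "0 < \<eta>0" "\<eta>0 \<le> 1 / 2" "\<eta>0 \<le> \<eta>" using assms(2) by (auto simp: \<eta>0_def)
  define \<Gamma> where "\<Gamma> = trace \<eta>0 K"
  obtain f1 m where f1: "\<And>t. (snake \<eta>0 K has_vector_derivative f1 t) (at t)" and m: "m > 0"
      "\<And>t. m \<le> norm (f1 t)"
    by (rule snake_speed[OF \<eta>0(1,2), of K]) (rule that)
  have snakeC: "Ck_on (Suc 2) UNIV (snake \<eta>0 K)" using Ck_on_snake[OF \<eta>0(1,2), of K]
      by (simp add: eval_nat_numeral)
  obtain z z1 L where L: "0 < L" and zC: "Ck_on (Suc 2) UNIV z"
    and z: "\<And>s. (z has_vector_derivative z1 s) (at s)" and z1: "\<And>s. norm (z1 s) = 1"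
    and im: "z ` {0..L} = snake \<eta>0 K ` {snake_start..snake_end K}"
    and inj: "inj_on (snake \<eta>0 K) {snake_start..snake_end K} \<Longrightarrow> inj_on z {0..L}"
    by (rule unit_speed_reparametrization[OF snakeC f1 m snake_start_less_end]) (rule that)
  have im: "z ` {0..L} = \<Gamma>" using im by (simp add: \<Gamma>_def trace_def)
  have inj: "inj_on z {0..L}" using inj snake_inj[OF \<eta>0(1,2)] by blast
  have z1C: "Ck_on (Suc 1) UNIV z1" using Ck_on_deriv[OF zC z] by (simp add: eval_nat_numeral)
  then obtain z2 where z2: "\<And>s. (z1 has_vector_derivative z2 s) (at s)" "Ck_on 1 UNIV z2"
    unfolding Ck_on.simps by auto
  interpret arc: unit_speed_arc z z1 z2 L
    by unfold_locales (fact L z z1 z2(1) inj Ck_on_imp_continuous_on[OF z2(2)])+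
  obtain \<epsilon>0 \<mu> where \<epsilon>0: "0 < \<epsilon>0" and \<mu>: "0 < \<mu>" and thin:
    "\<And>\<epsilon> \<delta>. \<epsilon> < \<epsilon>0 \<Longrightarrow> 0 < \<delta> \<Longrightarrow> \<delta> \<le> 1 / 2 \<Longrightarrow> \<delta> * L < \<epsilon> \<Longrightarrow> thin_tube z z1 z2 L \<epsilon> \<delta> \<mu>"
    by (rule arc.thin_tube_exists) (rule that)
  have "bounded \<Gamma>"
    unfolding im[symmetric] by (intro compact_imp_bounded compact_continuous_image arc.z_cont) auto
  then obtain R0 where R0: "\<And>q. q \<in> \<Gamma> \<Longrightarrow> norm q \<le> R0" by (auto simp: bounded_iff)
  define C where "C = (R0 + 1)\<^sup>2 / 2"
  have C: "0 \<le> C" by (simp add: C_def)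
  have "\<forall>\<^sub>F e in at_right 0. (0::real) < e \<and> e < 1 / 2 \<and> e + e ^ 6 < min \<epsilon>0 (1 / 2) \<and> e ^ 6
      < 1 / 2 \<and>
    (e + e ^ 6)\<^sup>2 + 4 * C * exp (- 1 / (2 * (e + e ^ 6)))
    < (1 + e)\<^sup>2 / 2 - 1 / 2 - 2 * e / (ln (1 + e) - ln (1 - e)) * ln (1 + e) - 8 * exp (- 1 /
        (4 * e))"
  proof (intro eventually_conj bend_beats_strip[OF C])
    show "\<forall>\<^sub>F e in at_right 0. (0::real) < e" by (rule eventually_at_right_less)
    show "\<forall>\<^sub>F e in at_right 0. e < (1 / 2::real)" by real_asymp
    show "\<forall>\<^sub>F e in at_right 0. e ^ 6 < (1 / 2::real)" by real_asymp
    have "((\<lambda>e::real. e + e ^ 6) \<longlongrightarrow> 0) (at_right 0)" by real_asymp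
    then show "\<forall>\<^sub>F e in at_right 0. e + e ^ 6 < min \<epsilon>0 (1 / 2)"
      by (rule order_tendstoD) (use \<epsilon>0 in simp)
  qed
  then obtain e where e: "0 < e" "e < 1 / 2" "e + e ^ 6 < \<epsilon>0" "e + e ^ 6 < 1 / 2" "e ^ 6 < 1 / 2"
    and gap: "(e + e ^ 6)\<^sup>2 + 4 * C * exp (- 1 / (2 * (e + e ^ 6)))
    < (1 + e)\<^sup>2 / 2 - 1 / 2 - 2 * e / (ln (1 + e) - ln (1 - e)) * ln (1 + e) - 8 * exp (- 1 /
        (4 * e))"
    by (auto dest!: eventually_happens simp: trivial_limit_at_right_real)
  define \<epsilon> \<delta> where "\<epsilon> = e + e ^ 6" and "\<delta> = e ^ 6 / (L + 1)"
  have e6: "0 < e ^ 6" using e by simp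
  have \<delta>: "0 < \<delta>" "\<delta> \<le> e ^ 6" "\<delta> * L \<le> e ^ 6"
    using e6 L by (auto simp: \<delta>_def field_simps)
  have \<epsilon>: "0 < \<epsilon>" "\<epsilon> < 1 / 2" unfolding \<epsilon>_def using e e6 by linarith+
  interpret tube: thin_tube z z1 z2 L \<epsilon> \<delta> \<mu>
  proof (rule thin)
    show "\<epsilon> < \<epsilon>0" unfolding \<epsilon>_def by (rule e(3))
    show "0 < \<delta>" "\<delta> \<le> 1 / 2" using \<delta> e by linarith+
    show "\<delta> * L < \<epsilon>" unfolding \<epsilon>_def using \<delta> e by linarith
  qed
  define \<Omega> where "\<Omega> = tapered_tube z L \<epsilon> \<delta>"
  have near: "\<exists>q\<in>\<Gamma>. norm (p - q) < \<epsilon>" if "p \<in> \<Omega>" for p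
    using tube.tube_near_axis[of p] that unfolding \<Omega>_def im by blast
  obtain v G where vG: "G holomorphic_on \<Omega>" "\<And>z. z \<in> \<Omega> \<Longrightarrow> v z = Re (G z) - (norm z)\<^sup>2 / 2"
    "continuous_on (closure \<Omega>) v" "\<And>z. z \<notin> \<Omega> \<Longrightarrow> v z = 0" "\<And>z. 0 \<le> v z"
  proof (rule torsion_function_representation[of \<Omega>])
    show "open \<Omega>" "bounded \<Omega>" "simply_connected \<Omega>"
      unfolding \<Omega>_def by (rule tube.open_tube tube.bounded_tube tube.simply_connected_tube)+
    show "\<Omega> \<noteq> {}" unfolding \<Omega>_def using tube.axis_in_tube[of 0] L by auto
    show "\<exists>c \<rho>. 0 < \<rho> \<and> norm (w - c) = \<rho> \<and> (\<forall>p\<in>\<Omega>. \<rho> \<le> norm (p - c))" if "w \<in> frontier \<Omega>" for w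
      by (rule tube.exterior_ball[of w]) (use that in \<open>auto simp: \<Omega>_def\<close>)
  qed (rule that)
  interpret torsion_pair \<Omega> v G
    by unfold_locales (use vG tube.open_tube tube.bounded_tube in \<open>auto simp: \<Omega>_def\<close>)
  have vC: "v p \<le> C" for p
    unfolding C_def
  proof (rule v_le)
    fix p assume "p \<in> \<Omega>"
    then obtain q where "q \<in> \<Gamma>" "norm (p - q) < \<epsilon>" using near by blast
    then show "norm p \<le> R0 + 1" using R0[of q] \<epsilon> norm_triangle_ineq[of q "p - q"] by simp
  qed
  define \<beta> where "\<beta> = \<epsilon>\<^sup>2 + 4 * C * exp (- 1 / (2 * \<epsilon>))"
  have \<beta>: "0 < \<beta>" using \<epsilon> C by (simp add: \<beta>_def add_pos_nonneg)
  have cut: "v p \<le> \<beta>" if p: "p \<in> \<Omega>" "Re p = 0" for p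
  proof -
    have height: "\<exists>k\<in>{1..Suc K}. \<bar>Im w - 2 * real k\<bar> < \<epsilon>" if w: "w \<in> \<Omega>" "\<bar>Re w\<bar> < 1 / 2" for w
    proof -
      obtain q where q: "q \<in> \<Gamma>" "norm (w - q) < \<epsilon>" using near w by blast
      have "\<bar>Re w - Re q\<bar> < \<epsilon>" "\<bar>Im w - Im q\<bar> < \<epsilon>"
        using q(2) abs_Re_le_cmod[of "w - q"] abs_Im_le_cmod[of "w - q"] by auto
      moreover from this have "\<bar>Re q\<bar> < 1" using w \<epsilon> by linarith
      ultimately show ?thesis
        using trace_inner_height[OF \<eta>0(1,2), of q K] q by (auto simp: \<Gamma>_def)
    qed
    obtain k where k: "\<bar>Im p - 2 * real k\<bar> < \<epsilon>" using height[of p] p by auto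
    show ?thesis
      unfolding \<beta>_def
    proof (rule strip_upper_bound[OF C vC \<epsilon>])
      fix w assume w: "w \<in> \<Omega>" "\<bar>Re w\<bar> < 1 / 2" "\<bar>Im w - 2 * real k\<bar> < 1 / 2"
      obtain j where j: "\<bar>Im w - 2 * real j\<bar> < \<epsilon>" using height[OF w(1,2)] by blast
      have "\<bar>real j - real k\<bar> < 1" using j w(3) \<epsilon> by linarith
      then have "j = k" by linarith
      then show "\<bar>Im w - 2 * real k\<bar> < \<epsilon>" using j by simp
    qed (use p k \<epsilon> in auto)
  qed
  define c where "c i = Complex (side i) (2 * real i + 1)" for i
  define tip where "tip i = c i + of_real (side i)" for i
  have side: "side i = 1 \<or> side i = -1" for i by (simp add: side_def)
  have sector: "c i + of_real (side i) * (of_real \<rho> * cis \<theta>) \<in> \<Omega>"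
    if i: "i \<le> Suc K" and \<rho>: "1 - e < \<rho>" "\<rho> < 1 + e" and \<theta>: "\<bar>\<theta>\<bar> < 1 / 2" for i \<rho> \<theta>
  proof -
    have "c i + side i *\<^sub>R cis \<theta> \<in> \<Gamma>"
      unfolding \<Gamma>_def using tip_arc_in_trace[OF \<eta>0(1,2) i, of \<theta>] \<theta> by (simp add: c_def)
    then obtain s where s: "s \<in> {0..L}" "z s = c i + side i *\<^sub>R cis \<theta>"
      unfolding im[symmetric] by auto
    have "c i + of_real (side i) * (of_real \<rho> * cis \<theta>) - z s
        = of_real (side i * (\<rho> - 1)) * cis \<theta>"
      unfolding s by (simp add: scaleR_conv_of_real algebra_simps)
    then have "norm (c i + of_real (side i) * (of_real \<rho> * cis \<theta>) - z s) = \<bar>side i * (\<rho> - 1)\<bar>"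
      by (simp only: norm_mult norm_cis norm_of_real mult_1_right)
    also have "\<dots> = \<bar>\<rho> - 1\<bar>" using side[of i] by auto
    also have "\<dots> < e" using \<rho> by auto
    also have "e \<le> tube.r s" using tube.r_ge[OF s(1)] \<delta> by (simp add: \<epsilon>_def)
    finally show ?thesis unfolding \<Omega>_def tube.tube_iff using s(1) by blast
  qed
  have tip: "tip i \<in> \<Omega>" "\<beta> < v (tip i)" if i: "i \<le> Suc K" for i
  proof -
    show "tip i \<in> \<Omega>" using sector[OF i, of 1 0] e by (simp add: tip_def)
    have "norm (of_real (side i) :: complex) = 1" using side[of i] by auto
    from annulus_lower_bound[OF this e(1,2) sector[OF i]] gap
    show "\<beta> < v (tip i)" by (simp add: tip_def \<beta>_def \<epsilon>_def)
  qed
  \<comment> \<open>the piece of the tube around the \<open>i\<close>-th semicircle, up to the cross-cuts on the imaginary axis\<close>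
  define U where "U i = \<Omega> \<inter> {p. 0 < side i * Re p} \<inter> {p. \<bar>Im p - (2 * real i + 1)\<bar> < 2}" for i
  have U_open: "open (U i)" for i
    unfolding U_def by (intro open_Int open_dom open_Collect_less continuous_intros)
  have U_frontier: "v p \<le> \<beta>" if p: "p \<in> closure (U i)" "p \<notin> U i" for i p
  proof (cases "p \<in> \<Omega>")
    case True
    have "closure (U i) \<subseteq> {p. 0 \<le> side i * Re p} \<inter> {p. \<bar>Im p - (2 * real i + 1)\<bar> \<le> 2}"
    proof (rule closure_minimal)
      show "closed ({p. 0 \<le> side i * Re p} \<inter> {p. \<bar>Im p - (2 * real i + 1)\<bar> \<le> 2})"
        by (intro closed_Int closed_Collect_le continuous_intros)
    qed (auto simp: U_def)
    then have p': "0 \<le> side i * Re p" "\<bar>Im p - (2 * real i + 1)\<bar> \<le> 2" using p(1) by auto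
    have "side i * Re p = 0"
    proof (rule ccontr)
      assume "side i * Re p \<noteq> 0"
      then have two: "\<bar>Im p - (2 * real i + 1)\<bar> = 2" using p(2) True p' by (auto simp: U_def)
      obtain q where q: "q \<in> \<Gamma>" "norm (p - q) < \<epsilon>" using near True by blast
      have d: "\<bar>Re p - Re q\<bar> < 1 / 2" "\<bar>Im p - Im q\<bar> < 1 / 2"
        using q(2) abs_Re_le_cmod[of "p - q"] abs_Im_le_cmod[of "p - q"] \<epsilon> by auto
      have "- 1 < side i * Re q" using side[of i]
      proof
        assume "side i = 1"
        then have "0 \<le> Re p" using p'(1) by simp
        then show ?thesis unfolding \<open>side i = 1\<close> using d(1) by linarith
      next
        assume "side i = -1"
        then have "Re p \<le> 0" using p'(1) by simp
        then show ?thesis unfolding \<open>side i = -1\<close> using d(1) by linarith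
      qed
      then obtain j where j: "side j = side i" "\<bar>Im q - (2 * real j + 1)\<bar> \<le> 1"
        using trace_side_height[OF \<eta>0(1,2), of q K i] q by (auto simp: \<Gamma>_def)
      have "even (int i - int j)" using j(1) by (auto simp: side_def split: if_splits)
      \<comment> \<open>semicircles on one side are \<open>4\<close> apart in height, which puts \<open>p\<close> too far from all\<close>
      then obtain n where "int i - int j = 2 * n" by (rule evenE)
      then have n: "real i - real j = 2 * of_int n" by linarith
      have "\<bar>Im p - (2 * real j + 1)\<bar> < 2" using d(2) j(2) by linarith
      moreover have "Im p = 2 * real i + 1 + 2 \<or> Im p = 2 * real i + 1 - 2" using two by linarith
      ultimately have "\<bar>4 * real_of_int n + 2\<bar> < 2 \<or> \<bar>4 * real_of_int n - 2\<bar> < 2"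
        using n by (elim disjE) (rule disjI1, linarith, rule disjI2, linarith)
      then have "\<bar>4 * n + 2\<bar> < 2 \<or> \<bar>4 * n - 2\<bar> < 2" by linarith
      then show False by presburger
    qed
    then have "Re p = 0" using side[of i] by auto
    then show ?thesis using cut True by blast
  qed (use \<beta> in \<open>simp add: v_out\<close>)
  have "\<exists>y. y \<in> U i \<and> y \<in> local_max_points \<Omega> v" if i: "i \<le> Suc K" for i
  proof -
    have tU: "tip i \<in> U i" using tip(1)[OF i] side[of i] by (auto simp: U_def tip_def c_def)
    have sub: "closure (U i) \<subseteq> closure \<Omega>" by (intro closure_mono) (auto simp: U_def)
    have "compact (closure (U i))"
      using bounded_subset[OF bounded_dom, of "U i"] by (simp add: U_def compact_closure Int_assoc)
    moreover have "continuous_on (closure (U i)) v" using v_cont sub continuous_on_subset by blast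
    ultimately obtain y where y: "y \<in> closure (U i)" "\<forall>p\<in>closure (U i). v p \<le> v y"
      using continuous_attains_sup[of "closure (U i)" v] tU closure_subset by blast
    have "v (tip i) \<le> v y" using y(2) tU closure_subset by blast
    then have yU: "y \<in> U i" using U_frontier[OF y(1)] tip(2)[OF i] by force
    have "\<forall>\<^sub>F p in at y within \<Omega>. v p \<le> v y"
    proof -
      have "\<forall>\<^sub>F p in at y within \<Omega>. p \<in> U i"
        using eventually_at_in_open'[OF U_open yU] by (rule filter_leD[OF at_le, rotated]) simp
      then show ?thesis by eventually_elim (use y(2) closure_subset in blast)
    qed
    then show ?thesis using yU by (auto simp: local_max_points_def U_def)
  qed
  then obtain y where y: "\<And>i. i \<le> Suc K \<Longrightarrow> y i \<in> U i" "\<And>i. i \<le> Suc K \<Longrightarrow> y i \<in> local_max_points \<Omega> v"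
    by metis
  have "inj_on y {..Suc K}"
  proof (rule inj_onI)
    fix i j assume ij: "i \<in> {..Suc K}" "j \<in> {..Suc K}" "y i = y j"
    then have "y i \<in> U i" "y i \<in> U j" using y(1)[of i] y(1)[of j] by auto
    then have s: "0 < side i * Re (y i)" "0 < side j * Re (y i)"
      and h: "\<bar>Im (y i) - (2 * real i + 1)\<bar> < 2" "\<bar>Im (y i) - (2 * real j + 1)\<bar> < 2"
          by (auto simp: U_def)
    have "side i = side j" using s side[of i] side[of j] by auto
    then have "even (int i - int j)" by (auto simp: side_def split: if_splits)
    then obtain n where n: "int i - int j = 2 * n" by (rule evenE)
    have "\<bar>real i - real j\<bar> < 2" using h by linarith
    then have "\<bar>int i - int j\<bar> < 2" by linarith
    then have "n = 0" using n by linarith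
    then show "i = j" using n by simp
  qed
  then have "card (y ` {..Suc K}) = M" by (simp add: card_image M)
  moreover have "y ` {..Suc K} \<subseteq> local_max_points \<Omega> v" using y(2) by auto
  moreover have "is_torsion_function \<Omega> v"
  proof -
    have "w \<notin> \<Omega>" if "w \<in> frontier \<Omega>" for w
      using that open_dom by (auto simp: frontier_def interior_open)
    then show ?thesis
      unfolding is_torsion_function_def
      using v_cont v_out torsion_function_of_holomorphic[OF open_dom G v_eq] by blast
  qed
  ultimately have torsion: "\<exists>v. is_torsion_function \<Omega> v \<and>
      (\<exists>A. A \<subseteq> local_max_points \<Omega> v \<and> finite A \<and> card A = M)" by blast
  have dist: "card (local_max_points \<Omega> (\<lambda>p. infdist p (frontier \<Omega>))) = 1"
    unfolding \<Omega>_def tube.local_max_depth by simp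
  have "C3_arclength_param z L \<Gamma>"
    unfolding C3_arclength_param_def
  proof (intro conjI ballI L inj im)
    show "Ck_on 3 {0..L} z" using Ck_on_subset[OF zC] by (simp add: eval_nat_numeral)
    fix s assume s: "s \<in> {0..L}"
    have "vector_derivative z (at s within {0..L}) = z1 s"
      using vector_derivative_within_cbox[of 0 L s z "z1 s"]
          has_vector_derivative_at_within[OF z, of s "{0..L}"] s L
      by simp
    then show "norm (vector_derivative z (at s within {0..L})) = 1" by (simp add: z1)
  qed
  moreover have "alters_arcs_near_junctions M \<eta> \<Gamma>"
    unfolding M \<Gamma>_def by (rule trace_alters_arcs[OF \<eta>0])
  moreover have "\<delta> < \<epsilon>" using \<delta> e by (simp add: \<epsilon>_def)
  moreover have "\<forall>s\<in>{0..L}. \<epsilon> - \<delta> * s > 0" using tube.r_pos by (simp add: tube.r_def)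
  ultimately show ?thesis
    using \<delta>(1) torsion dist tube.open_tube tube.bounded_tube tube.connected_tube
        tube.simply_connected_tube
    by (intro exI[of _ \<Gamma>] exI[of _ z] exI[of _ L] exI[of _ \<epsilon>] exI[of _ \<delta>] exI[of _ \<Omega>] conjI)
       (simp_all add: \<Omega>_def)
qed

end
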